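(* Let $\Gamma$ be a junction with edges $E_1,\dots,E_N$, junction point $O$ and boundary vertices $\mathbf{v}_1,\dots,\mathbf{v}_N$. Assume: (1) $\lambda>0$ and $h_i\in\mathbb{R}$ ($1\le i\le N$) are given. (2) For all $1\le i\le N$, $H_i:\bar E_i\times\mathbb{R}\to\mathbb{R}$ is continuous and, for all $x,y\in\bar E_i$, $p,q\in\mathbb{R}$, $|H_i(x,p)-H_i(y,p)|\le C_H(1+|p|)|x-y|$ and $|H_i(x,p)-H_i(x,q)|\le C_H|p-q|$; and $a_i:\bar E_i\to[0,\infty)$ has the form $a_i=\sigma_i^2$ with $|\sigma_i(x)-\sigma_i(y)|\le C_a|x-y|$ for $x,y\in\bar E_i$. (3) If $a_i(O)=0$, then $H_i$ is coercive on $\bar E_i$: $H_i(x,p)\ge C_H^{-1}|p|-C_H$ for all $x\in\bar E_i$, $p\in\mathbb{R}$. (4) $F:\mathbb{R}\times\mathbb{R}^N\to\mathbb{R}$ is continuous and satisfies: (i) for all $r,s\in\mathbb{R}$, $\mathbf{p},\mathbf{q}\in\mathbb{R}^N$, if $r\ge s$ and $p_i\le q_i$ for all $i$, then $F(r,\mathbf{p})\ge F(s,\mathbf{q})$, and if moreover there exists $j$ such that $p_j<q_j$, then $F(r,\mathbf{p})>F(s,\mathbf{q})$; (ii) for all $i$, $r\in\mathbb{R}$ and $\{p_j\}_{j\ne i}$, $\lim_{p_i\to-\infty}F(r,p_1,\dots,p_i,\dots,p_N)=+\infty$. (5) For any $i$, either $a_i(\mathbf{v}_i)>0$, or the inequality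 $H_i(x,p)\ge C_H^{-1}|p|-C_H$ holds for all $p\in\mathbb{R}$ and all $x$ in a neighborhood of $\mathbf{v}_i$ in $\bar E_i$. Let $u\in USC(\Gamma)$ be a viscosity subsolution and $v\in LSC(\Gamma)$ be a viscosity supersolution of the problem $$\lambda u-a_i(x)u_{xx}+H_i(x,u_x)=0\ \text{ in }E_i\ (1\le i\le N),\qquad F(u(O),u_{x_1}(O),\dots,u_{x_N}(O))=0,\qquad u(\mathbf{v}_i)=h_i\ (1\le i\le N).$$ Define $\tilde u$ on $\Gamma$ by $\tilde u(x)=u(x)$ if $x\notin\{\mathbf{v}_1,\dots,\mathbf{v}_N\}$ and $\tilde u(\mathbf{v}_i)=\limsup_{x\to\mathbf{v}_i,\,x\in E_i}u(x)$ for $1\le i\le N$. Then $\tilde u\le v$ on $\Gamma$. In particular, $u\le v$ on $\Gamma\setminus\{\mathbf{v}_1,\dots,\mathbf{v}_N\}$.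
   Context: Junction. Let $d\ge2$, $O=(0,\dots,0)\in\mathbb{R}^d$, and let $\mathbf{v}_1,\dots,\mathbf{v}_N\in\mathbb{R}^d\setminus\{O\}$ be pairwise non collinear. Put $E_i=\{t\mathbf{v}_i:t\in(0,1)\}$ (open edge), $\bar E_i$ its closure in $\mathbb{R}^d$, $\ell_i=|\mathbf{v}_i|$, and $\Gamma=\bigcup_{i=1}^N\bar E_i$. Each $\bar E_i$ is parametrized by arc length, $x\in\bar E_i\mapsto x_i=|x|\in[0,\ell_i]$. For $u:\Gamma\to\mathbb{R}$, $u_i:[0,\ell_i]\to\mathbb{R}$ is defined by $u_i(x_i)=u(x)$ for $x\in\bar E_i$, and $u_x(x)=u_{x_i}(x)=u_i'(x_i)$, $u_{xx}(x)=u_{x_ix_i}(x)=u_i''(x_i)$. $USC(\Gamma)$ (resp. $LSC(\Gamma)$) is the set of functions $u:\Gamma\to\mathbb{R}$ such that all $u_i$ are upper (resp. lower) semicontinuous on $[0,\ell_i]$; $C(\Gamma)=USC(\Gamma)\cap LSC(\Gamma)$; $C^m(\Gamma)$ is the set of $u\in C(\Gamma)$ with $u_i\in C^m([0,\ell_i])$ for all $i$. For $\varphi\in C^1(\Gamma)$, $\varphi_{x_i}(O)=\varphi_i'(0)$, $\varphi_{x_i}(\mathbf{v}_i)=\varphi_i'(\ell_i)$ (and similarly for second derivatives), and $\boldsymbol{\varphi_x(O)}=(\varphi_{x_1}(O),\dots,\varphi_{x_N}(O))$. Viscosity solutions. Set $G_i(r,p,X,x)=\lambda r-a_i(x)X+H_i(x,p)$.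 A function $u\in USC(\Gamma)$ is a viscosity subsolution if, for each $x\in\Gamma$ and $\varphi\in C^2(\Gamma)$ such that $x$ is a local maximum point of $u-\varphi$ on $\Gamma$: - if $x\in E_i$: $G_i(u(x),\varphi_{x_i}(x),\varphi_{x_ix_i}(x),x)\le0$; - if $x=O$: $\min\{\min_{1\le i\le N}G_i(u(O),\varphi_{x_i}(O),\varphi_{x_ix_i}(O),O),\,F(u(O),\boldsymbol{\varphi_x(O)})\}\le0$; - if $x=\mathbf{v}_i$: $\min\{G_i(u(x),\varphi_{x_i}(x),\varphi_{x_ix_i}(x),x),\,u(x)-h_i\}\le0$. A function $v\in LSC(\Gamma)$ is a viscosity supersolution if, for each $x\in\Gamma$ and $\varphi\in C^2(\Gamma)$ such that $x$ is a local minimum point of $v-\varphi$ on $\Gamma$, the same conditions hold with $u$ replaced by $v$, every $\min$ replaced by $\max$ and every $\le0$ replaced by $\ge0$. $C_H,C_a>0$ denote fixed constants. *)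

theory Defs
  imports "HOL-Analysis.Analysis"
begin

text \<open>
  A junction is given by its boundary vertices \<open>V i\<close>, indexed by a (nonempty) finite type;
  the junction point is \<open>0\<close>. Functions on the junction are total functions on the ambient space
  whose values outside the junction are never used.
\<close>

definition junction_vertices :: "('n::finite \<Rightarrow> 'a::euclidean_space) \<Rightarrow> bool" where
  "junction_vertices V \<longleftrightarrow>
     (\<forall>i. V i \<noteq> 0) \<and> (\<forall>i j. i \<noteq> j \<longrightarrow> \<not> collinear {0, V i, V j})"

definition edge :: "'a::euclidean_space \<Rightarrow> 'a set" where
  "edge w = {t *\<^sub>R w | t. 0 < t \<and> t < 1}"

definition junction :: "('n::finite \<Rightarrow> 'a::euclidean_space) \<Rightarrow> 'a set" where
  "junction V = (\<Union>i. closure (edge (V i)))"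

text \<open>The function \<open>u\<^sub>i\<close> of arc length: \<open>t *\<^sub>R sgn w\<close> is the point of \<open>closure (edge w)\<close> with norm \<open>t\<close>.\<close>

definition edge_fun :: "'a::euclidean_space \<Rightarrow> ('a \<Rightarrow> real) \<Rightarrow> real \<Rightarrow> real" where
  "edge_fun w u t = u (t *\<^sub>R sgn w)"

lemma closure_edge: "closure (edge w) = {t *\<^sub>R w | t. 0 \<le> t \<and> t \<le> 1}"
proof (cases "w = 0")
  case True
  have "edge w = {0}"
    using True by (auto simp: edge_def intro: exI[of _ "1/2"])
  then show ?thesis using True by (auto intro: exI[of _ 0])
next
  case False
  then have "edge w = open_segment 0 w"
    by (auto simp: edge_def in_segment)
  then have "closure (edge w) = closed_segment 0 w"
    using False by simp
  then show ?thesis by (auto simp: in_segment)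
qed

lemma edge_fun_norm:
  assumes "x \<in> closure (edge w)"
  shows "edge_fun w u (norm x) = u x"
proof -
  obtain t where t: "x = t *\<^sub>R w" "0 \<le> t"
    using assms by (auto simp: closure_edge)
  then have "norm x *\<^sub>R sgn w = x"
    by (cases "w = 0") (simp_all add: sgn_div_norm)
  then show ?thesis by (simp add: edge_fun_def)
qed

definition usc_on :: "real set \<Rightarrow> (real \<Rightarrow> real) \<Rightarrow> bool" where
  "usc_on S g \<longleftrightarrow> (\<forall>t\<in>S. \<forall>c > g t. eventually (\<lambda>s. g s < c) (at t within S))"

definition lsc_on :: "real set \<Rightarrow> (real \<Rightarrow> real) \<Rightarrow> bool" where
  "lsc_on S g \<longleftrightarrow> (\<forall>t\<in>S. \<forall>c < g t. eventually (\<lambda>s. c < g s) (at t within S))"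

text \<open>Derivative of a function on \<open>[0, l]\<close>, one-sided at the end points.\<close>

definition interval_deriv :: "real \<Rightarrow> (real \<Rightarrow> real) \<Rightarrow> real \<Rightarrow> real" where
  "interval_deriv l g t = vector_derivative g (at t within {0..l})"

primrec Cm_interval :: "nat \<Rightarrow> real \<Rightarrow> (real \<Rightarrow> real) \<Rightarrow> bool" where
  "Cm_interval 0 l g \<longleftrightarrow> continuous_on {0..l} g"
| "Cm_interval (Suc m) l g \<longleftrightarrow> g differentiable_on {0..l} \<and> Cm_interval m l (interval_deriv l g)"

definition USC_junction :: "('n::finite \<Rightarrow> 'a::euclidean_space) \<Rightarrow> ('a \<Rightarrow> real) set" where
  "USC_junction V = {u. \<forall>i. usc_on {0..norm (V i)} (edge_fun (V i) u)}"

definition LSC_junction :: "('n::finite \<Rightarrow> 'a::euclidean_space) \<Rightarrow> ('a \<Rightarrow> real) set" where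
  "LSC_junction V = {u. \<forall>i. lsc_on {0..norm (V i)} (edge_fun (V i) u)}"

definition C_junction :: "('n::finite \<Rightarrow> 'a::euclidean_space) \<Rightarrow> ('a \<Rightarrow> real) set" where
  "C_junction V = USC_junction V \<inter> LSC_junction V"

definition Cm_junction :: "nat \<Rightarrow> ('n::finite \<Rightarrow> 'a::euclidean_space) \<Rightarrow> ('a \<Rightarrow> real) set" where
  "Cm_junction m V = {u \<in> C_junction V. \<forall>i. Cm_interval m (norm (V i)) (edge_fun (V i) u)}"

text \<open>First and second arc-length derivatives along the edge with vertex \<open>w\<close>, at \<open>x \<in> closure (edge w)\<close>.\<close>

definition edge_dx :: "'a::euclidean_space \<Rightarrow> ('a \<Rightarrow> real) \<Rightarrow> 'a \<Rightarrow> real" where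
  "edge_dx w \<phi> x = interval_deriv (norm w) (edge_fun w \<phi>) (norm x)"

definition edge_dxx :: "'a::euclidean_space \<Rightarrow> ('a \<Rightarrow> real) \<Rightarrow> 'a \<Rightarrow> real" where
  "edge_dxx w \<phi> x =
     interval_deriv (norm w) (interval_deriv (norm w) (edge_fun w \<phi>)) (norm x)"

definition local_max_on :: "'a::topological_space set \<Rightarrow> ('a \<Rightarrow> real) \<Rightarrow> 'a \<Rightarrow> bool" where
  "local_max_on S f x \<longleftrightarrow> x \<in> S \<and> eventually (\<lambda>y. f y \<le> f x) (at x within S)"

definition local_min_on :: "'a::topological_space set \<Rightarrow> ('a \<Rightarrow> real) \<Rightarrow> 'a \<Rightarrow> bool" where
  "local_min_on S f x \<longleftrightarrow> x \<in> S \<and> eventually (\<lambda>y. f x \<le> f y) (at x within S)"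

definition G_op ::
  "real \<Rightarrow> ('n \<Rightarrow> 'a \<Rightarrow> real) \<Rightarrow> ('n \<Rightarrow> 'a \<Rightarrow> real \<Rightarrow> real) \<Rightarrow> 'n \<Rightarrow> real \<Rightarrow> real \<Rightarrow> real \<Rightarrow> 'a \<Rightarrow> real"
where
  "G_op lam a H i r p X x = lam * r - a i x * X + H i x p"

definition visc_subsolution ::
  "('n::finite \<Rightarrow> 'a::euclidean_space) \<Rightarrow> real \<Rightarrow> ('n \<Rightarrow> 'a \<Rightarrow> real) \<Rightarrow> ('n \<Rightarrow> 'a \<Rightarrow> real \<Rightarrow> real) \<Rightarrow>
   (real \<Rightarrow> real ^ 'n \<Rightarrow> real) \<Rightarrow> ('n \<Rightarrow> real) \<Rightarrow> ('a \<Rightarrow> real) \<Rightarrow> bool"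
where
  "visc_subsolution V lam a H F h u \<longleftrightarrow> u \<in> USC_junction V \<and>
     (\<forall>x\<in>junction V. \<forall>\<phi>\<in>Cm_junction 2 V. local_max_on (junction V) (\<lambda>y. u y - \<phi> y) x \<longrightarrow>
        (\<forall>i. x \<in> edge (V i) \<longrightarrow>
           G_op lam a H i (u x) (edge_dx (V i) \<phi> x) (edge_dxx (V i) \<phi> x) x \<le> 0) \<and>
        (x = 0 \<longrightarrow>
           min (Min (range (\<lambda>i. G_op lam a H i (u 0) (edge_dx (V i) \<phi> 0) (edge_dxx (V i) \<phi> 0) 0)))
               (F (u 0) (\<chi> i. edge_dx (V i) \<phi> 0)) \<le> 0) \<and>
        (\<forall>i. x = V i \<longrightarrow>
           min (G_op lam a H i (u x) (edge_dx (V i) \<phi> x) (edge_dxx (V i) \<phi> x) x)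
               (u x - h i) \<le> 0))"

definition visc_supersolution ::
  "('n::finite \<Rightarrow> 'a::euclidean_space) \<Rightarrow> real \<Rightarrow> ('n \<Rightarrow> 'a \<Rightarrow> real) \<Rightarrow> ('n \<Rightarrow> 'a \<Rightarrow> real \<Rightarrow> real) \<Rightarrow>
   (real \<Rightarrow> real ^ 'n \<Rightarrow> real) \<Rightarrow> ('n \<Rightarrow> real) \<Rightarrow> ('a \<Rightarrow> real) \<Rightarrow> bool"
where
  "visc_supersolution V lam a H F h v \<longleftrightarrow> v \<in> LSC_junction V \<and>
     (\<forall>x\<in>junction V. \<forall>\<phi>\<in>Cm_junction 2 V. local_min_on (junction V) (\<lambda>y. v y - \<phi> y) x \<longrightarrow>
        (\<forall>i. x \<in> edge (V i) \<longrightarrow>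
           G_op lam a H i (v x) (edge_dx (V i) \<phi> x) (edge_dxx (V i) \<phi> x) x \<ge> 0) \<and>
        (x = 0 \<longrightarrow>
           max (Max (range (\<lambda>i. G_op lam a H i (v 0) (edge_dx (V i) \<phi> 0) (edge_dxx (V i) \<phi> 0) 0)))
               (F (v 0) (\<chi> i. edge_dx (V i) \<phi> 0)) \<ge> 0) \<and>
        (\<forall>i. x = V i \<longrightarrow>
           max (G_op lam a H i (v x) (edge_dx (V i) \<phi> x) (edge_dxx (V i) \<phi> x) x)
               (v x - h i) \<ge> 0))"

text \<open>
  At a vertex \<open>x = V i\<close> the edge \<open>E\<^sub>i\<close> is \<open>edge x\<close>. The value is extended real because
  upper semicontinuity alone does not exclude that the limsup is \<open>- \<infinity>\<close>.
\<close>

definition vertex_limsup ::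
  "('n::finite \<Rightarrow> 'a::euclidean_space) \<Rightarrow> ('a \<Rightarrow> real) \<Rightarrow> 'a \<Rightarrow> ereal" where
  "vertex_limsup V u x =
     (if x \<in> range V then Limsup (at x within edge x) (\<lambda>y. ereal (u y)) else ereal (u x))"

end

theory Submission
  imports Defs
begin

text \<open>
  Suppose that \<open>u - v\<close>, with \<open>u\<close> replaced at each vertex by its limit superior along the edge, has a
  positive maximum. The maximum is excluded in each of the three possible positions: inside an edge,
  at a vertex, at the junction point. The analysis is carried out on one edge at a time, in arc
  length, and with quadratic test functions.

  The common tool is the behaviour at \<open>0\<close> of an upper semicontinuous subsolution \<open>f\<close> on
  \<open>[0, r]\<close>, described by its \<open>upper_slope\<close> \<open>P\<close>, the limit superior of \<open>(f z - f 0) / z\<close>.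
  Comparison with quadratic barriers shows two things. If \<open>\<sigma> 0 \<noteq> 0\<close>, the equation is uniformly
  elliptic near \<open>0\<close>, and \<open>f\<close> bends upwards at least as much as the equation prescribes:
  \<open>f z \<ge> f 0 + P z + (K - \<eta>) z\<^sup>2 / 2\<close> with \<open>K = (lam * f 0 + h 0 P) / (\<sigma> 0)\<^sup>2\<close>
  (\<open>second_order_expansion\<close>). If \<open>\<sigma> 0 = 0\<close>, the diffusion coefficient is at most \<open>C\<^sup>2 z\<^sup>2\<close>, which is
  invisible at the scale \<open>z\<close>, and \<open>P\<close> satisfies the first order inequality
  \<open>lam * f 0 + h 0 P \<le> 0\<close> (\<open>critical_slope\<close>). The same holds for \<open>- v\<close>, which is a subsolution for
  the mirrored Hamiltonian \<open>- h x (- p)\<close>.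

  Inside an edge the variables are doubled, and the expansion takes the place of the theorem on sums.
  At a maximum point \<open>(x, y)\<close> of \<open>f x - g y - (x - y)\<^sup>2 / (2 \<epsilon>)\<close> the expansions of \<open>f\<close> at \<open>x\<close> and of
  \<open>g\<close> at \<open>y\<close> are compared along the direction \<open>(\<bar>\<sigma> x\<bar>, \<bar>\<sigma> y\<bar>)\<close>, which is, up to
  signs, the direction in which the matrix inequality of that theorem would be tested. If \<open>\<sigma> x\<close> or \<open>\<sigma> y\<close> vanishes,
  the penalization itself is a sufficient test function (\<open>doubled_inequality\<close>).

  At the junction point, \<open>edge_gap\<close> produces on every edge slopes \<open>s < t\<close> such that \<open>s\<close> is a test slope
  for \<open>u\<close> at which the operator of the edge is positive and \<open>t\<close> is a test slope for \<open>v\<close> at which it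
  is negative. The alternatives offered by the edges in the junction condition then fail, so
  \<open>F(u(O), s) \<le> 0 \<le> F(v(O), t)\<close>, which contradicts the strict monotonicity of \<open>F\<close>. On an elliptic edge
  the gap is Hopf's lemma for \<open>u - v\<close>; on a degenerate edge it comes from following the interval of
  slopes at which the operator of \<open>u\<close> is nonpositive, together with the critical slopes of \<open>u\<close> and
  of \<open>v\<close>. The growth of \<open>F\<close> as one slope tends to \<open>- \<infinity>\<close> bounds the slopes of \<open>u\<close> from below.

  At a vertex, a barrier gives \<open>u \<le> h\<close>. A positive maximum there forces \<open>v < h\<close>, so \<open>v\<close> satisfies
  the supersolution inequality of the equation up to the vertex, and \<open>edge_gap\<close>, or a plain barrier
  in the elliptic case, contradicts it. Here the lower bound for the slope of \<open>u\<close> comes from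
  coercivity, by a logarithmic barrier.
\<close>

section \<open>Semicontinuous functions\<close>

lemma usc_on_iff:
  "usc_on S g \<longleftrightarrow> (\<forall>t\<in>S. \<forall>c>g t. \<exists>d>0. \<forall>s\<in>S. \<bar>s - t\<bar> < d \<longrightarrow> g s < c)"
proof -
  have "(\<exists>d>0. \<forall>s\<in>S. s \<noteq> t \<and> dist s t < d \<longrightarrow> g s < c) \<longleftrightarrow>
        (\<exists>d>0. \<forall>s\<in>S. \<bar>s - t\<bar> < d \<longrightarrow> g s < c)" if "g t < c" for t c
    using that by (auto simp: dist_real_def)
  then show ?thesis
    unfolding usc_on_def eventually_at by blast
qed

lemma lsc_on_iff_usc: "lsc_on S g \<longleftrightarrow> usc_on S (\<lambda>x. - g x)"
proof
  assume l: "lsc_on S g"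
  show "usc_on S (\<lambda>x. - g x)"
    unfolding usc_on_def
  proof (intro ballI allI impI)
    fix t c assume "t \<in> S" "- g t < c"
    then have "eventually (\<lambda>s. - c < g s) (at t within S)"
      using l unfolding lsc_on_def by simp
    then show "eventually (\<lambda>s. - g s < c) (at t within S)"
      by (rule eventually_mono) simp
  qed
next
  assume l: "usc_on S (\<lambda>x. - g x)"
  show "lsc_on S g"
    unfolding lsc_on_def
  proof (intro ballI allI impI)
    fix t c assume "t \<in> S" "c < g t"
    then have "eventually (\<lambda>s. - g s < - c) (at t within S)"
      using l unfolding usc_on_def by (metis neg_less_iff_less)
    then show "eventually (\<lambda>s. c < g s) (at t within S)"
      by (rule eventually_mono) simp
  qed
qed

text \<open>
  If there were no maximum, the sets \<open>{g < g (w t)}\<close> with \<open>g t < g (w t)\<close> would form an open cover of \<open>K\<close>; the best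
  \<open>w t\<close> of a finite subcover lies in none of its members.
\<close>

lemma usc_attains_max:
  fixes g :: "'b::metric_space \<Rightarrow> real"
  assumes K: "compact K" "K \<noteq> {}"
    and usc: "\<And>t c. t \<in> K \<Longrightarrow> g t < c \<Longrightarrow> \<exists>d>0. \<forall>s\<in>K. dist s t < d \<longrightarrow> g s < c"
  shows "\<exists>t\<in>K. \<forall>s\<in>K. g s \<le> g t"
proof (rule ccontr)
  assume "\<not> ?thesis"
  then have "\<forall>t\<in>K. \<exists>s\<in>K. g t < g s" by (meson not_le)
  then obtain w where w: "\<And>t. t \<in> K \<Longrightarrow> w t \<in> K \<and> g t < g (w t)" by metis
  have "\<forall>t\<in>K. \<exists>d>0. \<forall>s\<in>K. dist s t < d \<longrightarrow> g s < g (w t)"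
    using usc w by blast
  then obtain d where d: "\<And>t. t \<in> K \<Longrightarrow> d t > 0"
    "\<And>t s. \<lbrakk>t \<in> K; s \<in> K; dist s t < d t\<rbrakk> \<Longrightarrow> g s < g (w t)" by metis
  obtain T where T: "T \<subseteq> K" "finite T" "K \<subseteq> (\<Union>t\<in>T. ball t (d t))"
  proof (rule compactE_image[OF K(1), of K "\<lambda>t. ball t (d t)"])
    show "K \<subseteq> (\<Union>t\<in>K. ball t (d t))" using d(1) by force
  qed auto
  then have "T \<noteq> {}" using K(2) by auto
  define m where "m = Max ((\<lambda>t. g (w t)) ` T)"
  have "m \<in> (\<lambda>t. g (w t)) ` T"
    unfolding m_def using \<open>finite T\<close> \<open>T \<noteq> {}\<close> by (intro Max_in) auto
  then obtain t where t: "t \<in> T" "m = g (w t)" by blast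
  obtain t' where t': "t' \<in> T" "w t \<in> ball t' (d t')"
    using T w t by (metis UN_E subsetD)
  then have "g (w t) < g (w t')"
    using d(2) T(1) w t(1) by (metis dist_commute mem_ball subsetD)
  also have "g (w t') \<le> m"
    unfolding m_def using \<open>finite T\<close> t'(1) by (intro Max_ge) auto
  finally show False using t(2) by simp
qed

lemma usc_on_subset: "usc_on S g \<Longrightarrow> T \<subseteq> S \<Longrightarrow> usc_on T g"
  unfolding usc_on_iff by (meson subsetD)

lemma usc_on_attains_max:
  assumes "usc_on {a..b} g" "a \<le> b"
  shows "\<exists>t\<in>{a..b}. \<forall>s\<in>{a..b}. g s \<le> g t"
  by (rule usc_attains_max) (use assms in \<open>auto simp: usc_on_iff dist_real_def\<close>)

lemma usc_on_add:
  assumes "usc_on S g" "usc_on S k"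
  shows "usc_on S (\<lambda>x. g x + k x)"
  unfolding usc_on_def
proof (intro ballI allI impI)
  fix t c assume t: "t \<in> S" "g t + k t < c"
  define e where "e = (c - (g t + k t)) / 2"
  have e: "e > 0" using t by (simp add: e_def)
  have "eventually (\<lambda>s. g s < g t + e) (at t within S)"
    using assms(1) t(1) e unfolding usc_on_def by simp
  moreover have "eventually (\<lambda>s. k s < k t + e) (at t within S)"
    using assms(2) t(1) e unfolding usc_on_def by simp
  ultimately show "eventually (\<lambda>s. g s + k s < c) (at t within S)"
  proof eventually_elim
    case (elim s)
    then show ?case by (simp add: e_def field_simps)
  qed
qed

lemma continuous_imp_usc_on: "continuous_on S k \<Longrightarrow> usc_on S k"
  unfolding usc_on_def continuous_on_def by (auto intro: order_tendstoD(2))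

lemma usc_on_add_continuous: "usc_on S g \<Longrightarrow> continuous_on S k \<Longrightarrow> usc_on S (\<lambda>x. g x + k x)"
  by (rule usc_on_add[OF _ continuous_imp_usc_on])

section \<open>Subsolutions and slopes on an interval\<close>

text \<open>
  The equation on an edge in the arc length variable, with \<open>a = \<sigma>\<^sup>2\<close>. Quadratic test functions suffice
  for the whole argument. There is no separate notion of supersolution: \<open>g\<close> is a
  supersolution when \<open>- g\<close> is a subsolution for the mirrored Hamiltonian.
\<close>

definition visc_sub_on ::
  "real \<Rightarrow> (real \<Rightarrow> real) \<Rightarrow> (real \<Rightarrow> real \<Rightarrow> real) \<Rightarrow> (real \<Rightarrow> real) \<Rightarrow> real set \<Rightarrow> bool" where
  "visc_sub_on lam \<sigma> h f S \<longleftrightarrow> (\<forall>x\<in>S. \<forall>p X.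
     (\<forall>\<^sub>F y in at x. f y \<le> f x + p * (y - x) + X / 2 * (y - x)\<^sup>2) \<longrightarrow>
     lam * f x - (\<sigma> x)\<^sup>2 * X + h x p \<le> 0)"

definition touch_above :: "(real \<Rightarrow> real) \<Rightarrow> real \<Rightarrow> bool" where
  "touch_above f s \<longleftrightarrow> (\<forall>\<^sub>F z in at_right 0. f z \<le> f 0 + s * z)"

text \<open>
  \<open>P\<close> is the limit superior of \<open>(f z - f 0) / z\<close> as \<open>z\<close> tends to \<open>0\<close> from the right, and it is finite.
\<close>

definition upper_slope :: "(real \<Rightarrow> real) \<Rightarrow> real \<Rightarrow> bool" where
  "upper_slope f P \<longleftrightarrow> (\<forall>s>P. touch_above f s) \<and> (\<forall>s<P. \<not> touch_above f s)"

definition jet_above :: "(real \<Rightarrow> real) \<Rightarrow> real \<Rightarrow> real \<Rightarrow> bool" where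
  "jet_above f s X \<longleftrightarrow> (\<forall>\<^sub>F z in at_right 0. f z \<le> f 0 + s * z + X / 2 * z\<^sup>2)"

lemma eventually_at_right_0:
  "eventually P (at_right (0::real)) \<longleftrightarrow> (\<exists>d>0. \<forall>z. 0 < z \<and> z < d \<longrightarrow> P z)"
  by (auto simp: eventually_at_right_field)

lemma touch_above_mono:
  assumes "touch_above f s" "s \<le> s'" shows "touch_above f s'"
  using assms(1) unfolding touch_above_def eventually_at_right_0
proof (elim exE conjE)
  fix d :: real assume d: "0 < d" "\<forall>z. 0 < z \<and> z < d \<longrightarrow> f z \<le> f 0 + s * z"
  have "f z \<le> f 0 + s' * z" if "0 < z" "z < d" for z
    using d(2)[rule_format, of z] that mult_right_mono[OF assms(2), of z] by linarith
  then show "\<exists>d>0. \<forall>z. 0 < z \<and> z < d \<longrightarrow> f z \<le> f 0 + s' * z"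
    using d(1) by blast
qed

lemma touch_above_quadratic:
  assumes "p < s" "\<delta> > 0" "\<And>z. 0 < z \<Longrightarrow> z < \<delta> \<Longrightarrow> f z \<le> f 0 + p * z + X / 2 * z\<^sup>2"
  shows "touch_above f s"
proof -
  define d where "d = min \<delta> ((s - p) / (\<bar>X\<bar> + 1))"
  have d: "d > 0" using assms by (simp add: d_def)
  have "f z \<le> f 0 + s * z" if z: "0 < z" "z < d" for z
  proof -
    have "X / 2 * z \<le> (\<bar>X\<bar> + 1) * z" using z(1) by (intro mult_right_mono) auto
    also have "\<dots> \<le> s - p"
      using z by (simp add: d_def field_simps)
    finally have "z * (X / 2 * z) \<le> z * (s - p)" using z(1) by (intro mult_left_mono) auto
    moreover have "f z \<le> f 0 + p * z + X / 2 * z\<^sup>2" using assms(3) z by (simp add: d_def)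
    ultimately show ?thesis by (simp add: power2_eq_square algebra_simps)
  qed
  then show ?thesis unfolding touch_above_def eventually_at_right_0 using d by blast
qed

text \<open>
  A strictly larger slope leaves room for an arbitrary second derivative; this freedom is what makes
  the equation ineffective in the tests at elliptic end points.
\<close>

lemma jet_above_of_touch:
  assumes "touch_above f p" "p < s"
  shows "jet_above f s X"
proof -
  obtain \<delta> where \<delta>: "\<delta> > 0" "\<And>z. 0 < z \<Longrightarrow> z < \<delta> \<Longrightarrow> f z \<le> f 0 + p * z"
    using assms(1) unfolding touch_above_def eventually_at_right_0 by blast
  define d where "d = min \<delta> ((s - p) / (\<bar>X\<bar> + 1))"
  have d: "d > 0" using assms \<delta> by (simp add: d_def)
  have "f z \<le> f 0 + s * z + X / 2 * z\<^sup>2" if z: "0 < z" "z < d" for z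
  proof -
    have "- X / 2 * z \<le> (\<bar>X\<bar> + 1) * z" using z(1) by (intro mult_right_mono) auto
    also have "\<dots> \<le> s - p"
      using z by (simp add: d_def field_simps)
    finally have "z * (- X / 2 * z) \<le> z * (s - p)" using z(1) by (intro mult_left_mono) auto
    moreover have "f z \<le> f 0 + p * z" using \<delta> z by (simp add: d_def)
    ultimately show ?thesis by (simp add: power2_eq_square algebra_simps)
  qed
  then show ?thesis unfolding jet_above_def eventually_at_right_0 using d by blast
qed

lemma upper_slopeI:
  assumes "touch_above f s1" "\<not> touch_above f s0"
  shows "\<exists>P. upper_slope f P"
proof -
  let ?S = "{s. touch_above f s}"
  have bdd: "bdd_below ?S"
    by (rule bdd_belowI[of _ s0]) (use assms(2) touch_above_mono in \<open>meson mem_Collect_eq linear\<close>)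
  have "touch_above f s" if s: "s > Inf ?S" for s
  proof -
    obtain s' where "s' \<in> ?S" "s' < s"
      using cInf_less_iff[OF _ bdd, of s] s assms(1) by blast
    then show ?thesis using touch_above_mono by force
  qed
  moreover have "\<not> touch_above f s" if "s < Inf ?S" for s
    using that cInf_lower[OF _ bdd, of s] by auto
  ultimately show ?thesis unfolding upper_slope_def by blast
qed

definition lipschitz_coeffs ::
  "real \<Rightarrow> (real \<Rightarrow> real) \<Rightarrow> (real \<Rightarrow> real \<Rightarrow> real) \<Rightarrow> real set \<Rightarrow> bool" where
  "lipschitz_coeffs C \<sigma> h S \<longleftrightarrow> C > 0 \<and>
     (\<forall>x\<in>S. \<forall>y\<in>S. \<bar>\<sigma> x - \<sigma> y\<bar> \<le> C * \<bar>x - y\<bar>) \<and>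
     (\<forall>x\<in>S. \<forall>y\<in>S. \<forall>p. \<bar>h x p - h y p\<bar> \<le> C * (1 + \<bar>p\<bar>) * \<bar>x - y\<bar>) \<and>
     (\<forall>x\<in>S. \<forall>p q. \<bar>h x p - h x q\<bar> \<le> C * \<bar>p - q\<bar>)"

text \<open>
  Semicontinuity holds up to the end points, the differential inequality only between them: at the end
  points it is replaced by the junction condition or by the boundary condition.
\<close>

locale hj_sub =
  fixes lam C :: real and \<sigma> :: "real \<Rightarrow> real" and h :: "real \<Rightarrow> real \<Rightarrow> real"
    and r :: real and f :: "real \<Rightarrow> real"
  assumes lam_pos: "lam > 0" and r_pos: "r > 0"
    and coeffs: "lipschitz_coeffs C \<sigma> h {0..r}"
    and usc: "usc_on {0..r} f"
    and sub: "visc_sub_on lam \<sigma> h f {0<..<r}"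
begin

lemma C_pos: "C > 0" using coeffs by (simp add: lipschitz_coeffs_def)

lemma \<sigma>_lip: "\<lbrakk>x \<in> {0..r}; y \<in> {0..r}\<rbrakk> \<Longrightarrow> \<bar>\<sigma> x - \<sigma> y\<bar> \<le> C * \<bar>x - y\<bar>"
  using coeffs unfolding lipschitz_coeffs_def by blast

lemma h_x: "\<lbrakk>x \<in> {0..r}; y \<in> {0..r}\<rbrakk> \<Longrightarrow> \<bar>h x p - h y p\<bar> \<le> C * (1 + \<bar>p\<bar>) * \<bar>x - y\<bar>"
  using coeffs unfolding lipschitz_coeffs_def by blast

lemma h_p: "x \<in> {0..r} \<Longrightarrow> \<bar>h x p - h x q\<bar> \<le> C * \<bar>p - q\<bar>"
  using coeffs unfolding lipschitz_coeffs_def by blast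

text \<open>
  At a positive maximum of \<open>f\<close> minus a quadratic barrier, \<open>f\<close> exceeds the barrier, so the zero order
  term only helps. Hence strictness is required at the values of the barrier alone, which is what
  makes the comparison work for functions that are unbounded below.
\<close>

lemma quad_comparison:
  assumes d: "0 < d" "d \<le> r"
    and end0: "f 0 \<le> c" and endd: "f d \<le> c + p * d + X / 2 * d\<^sup>2"
    and strict: "\<And>x. 0 < x \<Longrightarrow> x < d \<Longrightarrow>
      lam * (c + p * x + X / 2 * x\<^sup>2) - (\<sigma> x)\<^sup>2 * X + h x (p + X * x) > 0"
    and x: "0 \<le> x" "x \<le> d"
  shows "f x \<le> c + p * x + X / 2 * x\<^sup>2"
proof -
  define k where "k x = f x + - (c + p * x + X / 2 * x\<^sup>2)" for x
  have "usc_on {0..d} k"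
    unfolding k_def using d by (intro usc_on_add_continuous usc_on_subset[OF usc] continuous_intros) auto
  then obtain y where y: "y \<in> {0..d}" "\<And>s. s \<in> {0..d} \<Longrightarrow> k s \<le> k y"
    using usc_on_attains_max[of 0 d k] d by auto
  have "k y \<le> 0"
  proof (rule ccontr)
    assume "\<not> k y \<le> 0"
    then have ky: "k y > 0" by simp
    then have y0: "0 < y" "y < d"
      using y(1) end0 endd by (auto simp: k_def order.order_iff_strict)
    have "\<forall>\<^sub>F z in at y. z \<in> {0<..<d}"
      using y0 by (intro eventually_at_in_open') auto
    then have "\<forall>\<^sub>F z in at y. f z \<le> f y + (p + X * y) * (z - y) + X / 2 * (z - y)\<^sup>2"
    proof eventually_elim
      case (elim z)
      have e: "(p + X * y) * (z - y) + X / 2 * (z - y)\<^sup>2 =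
        (c + p * z + X / 2 * z\<^sup>2) - (c + p * y + X / 2 * y\<^sup>2)"
        by (simp add: power2_eq_square field_simps)
      from y(2)[of z] elim show ?case unfolding k_def using e by simp
    qed
    then have "lam * f y - (\<sigma> y)\<^sup>2 * X + h y (p + X * y) \<le> 0"
      using sub y0 d(2) unfolding visc_sub_on_def by auto
    moreover have "lam * f y > lam * (c + p * y + X / 2 * y\<^sup>2)"
      using ky lam_pos by (simp add: k_def)
    ultimately show False using strict[OF y0] by simp
  qed
  then show ?thesis using y(2)[of x] x by (simp add: k_def)
qed

text \<open>
  Strict inequalities at \<open>0\<close> persist nearby, uniformly in all values \<open>w\<close> above \<open>r0 - \<theta>\<close>. This turns a
  failure of the equation at \<open>0\<close> into a strict barrier.
\<close>

lemma stability:
  assumes gap: "c < lam * r0 - (\<sigma> 0)\<^sup>2 * X + h 0 q0"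
  shows "\<exists>\<theta>>0. \<theta> \<le> r \<and> (\<forall>x q w. 0 \<le> x \<longrightarrow> x \<le> \<theta> \<longrightarrow> \<bar>q - q0\<bar> \<le> \<theta> \<longrightarrow> r0 - \<theta> \<le> w \<longrightarrow>
    c < lam * w - (\<sigma> x)\<^sup>2 * X + h x q)"
proof -
  let ?L = "\<lambda>t. lam * (r0 - t) - (\<sigma> 0)\<^sup>2 * X - (C * t * (2 * \<bar>\<sigma> 0\<bar> + C * t)) * \<bar>X\<bar> + h 0 q0
      - C * t - C * (1 + \<bar>q0\<bar> + t) * t"
  have "(?L \<longlongrightarrow> ?L 0) (at_right 0)"
    by (intro tendsto_intros)
  then have "\<forall>\<^sub>F t in at_right 0. c < ?L t"
    by (rule order_tendstoD(1)) (use gap in simp)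
  then obtain d where d: "d > 0" "\<And>t. 0 < t \<Longrightarrow> t < d \<Longrightarrow> c < ?L t"
    unfolding eventually_at_right_0 by blast
  define \<theta> where "\<theta> = min (d / 2) r"
  have \<theta>: "\<theta> > 0" "\<theta> \<le> r" "c < ?L \<theta>"
    using d r_pos by (auto simp: \<theta>_def)
  have "c < lam * w - (\<sigma> x)\<^sup>2 * X + h x q"
    if x: "0 \<le> x" "x \<le> \<theta>" and q: "\<bar>q - q0\<bar> \<le> \<theta>" and w: "r0 - \<theta> \<le> w" for x q w
  proof -
    have C0: "C \<ge> 0" using C_pos by simp
    have Ct: "C * x \<le> C * \<theta>" using x C0 by (intro mult_left_mono)
    have s1: "\<bar>\<sigma> x - \<sigma> 0\<bar> \<le> C * \<theta>"
      using \<sigma>_lip[of x 0] x \<theta> Ct by simp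
    have "\<bar>(\<sigma> x)\<^sup>2 - (\<sigma> 0)\<^sup>2\<bar> = \<bar>\<sigma> x - \<sigma> 0\<bar> * \<bar>\<sigma> x + \<sigma> 0\<bar>"
      by (simp add: abs_mult[symmetric] power2_eq_square algebra_simps)
    also have "\<dots> \<le> (C * \<theta>) * (2 * \<bar>\<sigma> 0\<bar> + C * \<theta>)"
      using s1 C0 \<theta> by (intro mult_mono) auto
    finally have "\<bar>(\<sigma> x)\<^sup>2 - (\<sigma> 0)\<^sup>2\<bar> * \<bar>X\<bar> \<le> (C * \<theta> * (2 * \<bar>\<sigma> 0\<bar> + C * \<theta>)) * \<bar>X\<bar>"
      by (intro mult_right_mono) auto
    then have a: "(\<sigma> x)\<^sup>2 * X \<le> (\<sigma> 0)\<^sup>2 * X + (C * \<theta> * (2 * \<bar>\<sigma> 0\<bar> + C * \<theta>)) * \<bar>X\<bar>"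
      unfolding abs_mult[symmetric] by (simp add: algebra_simps abs_le_iff)
    have "\<bar>h x q - h 0 q\<bar> \<le> C * (1 + \<bar>q\<bar>) * \<bar>x - 0\<bar>"
      using h_x[of x 0 q] x \<theta> by simp
    also have "\<dots> \<le> C * (1 + \<bar>q0\<bar> + \<theta>) * \<theta>"
      using x q C0 \<theta> by (intro mult_mono) auto
    finally have b: "\<bar>h x q - h 0 q\<bar> \<le> C * (1 + \<bar>q0\<bar> + \<theta>) * \<theta>" .
    have "\<bar>h 0 q - h 0 q0\<bar> \<le> C * \<bar>q - q0\<bar>" using h_p r_pos by auto
    also have "\<dots> \<le> C * \<theta>" using q C0 by (intro mult_left_mono)
    finally have e: "\<bar>h 0 q - h 0 q0\<bar> \<le> C * \<theta>" .
    have "lam * (r0 - \<theta>) \<le> lam * w" using w lam_pos by simp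
    then show ?thesis using a b e \<theta>(3) by linarith
  qed
  then show ?thesis using \<theta> by blast
qed

end

section \<open>Behaviour of a subsolution at an end point\<close>

text \<open>
  The alternative of the hypotheses at an end point placed at \<open>0\<close>: ellipticity or coercivity. In both
  cases the operator can be made positive with steep test functions, by concavity or by the slope.
\<close>

definition steep_or_elliptic :: "(real \<Rightarrow> real) \<Rightarrow> (real \<Rightarrow> real \<Rightarrow> real) \<Rightarrow> bool" where
  "steep_or_elliptic \<sigma> h \<longleftrightarrow> \<sigma> 0 \<noteq> 0 \<or>
     (\<exists>\<rho>>0. \<exists>k>0. \<exists>c. \<forall>x p. 0 \<le> x \<longrightarrow> x \<le> \<rho> \<longrightarrow> k * \<bar>p\<bar> - c \<le> h x p)"

lemma not_touch_aboveD:
  assumes "\<not> touch_above f s" "\<delta> > 0"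
  obtains \<zeta> where "0 < \<zeta>" "\<zeta> < \<delta>" "f \<zeta> > f 0 + s * \<zeta>"
  using assms unfolding touch_above_def eventually_at_right_0 by (meson not_le)

lemma touch_aboveD:
  assumes "touch_above f s"
  obtains \<delta> where "\<delta> > 0" "\<And>z. 0 < z \<Longrightarrow> z < \<delta> \<Longrightarrow> f z \<le> f 0 + s * z"
  using assms unfolding touch_above_def eventually_at_right_0 by blast

lemma touch_aboveI:
  assumes "\<delta> > 0" "\<And>z. 0 < z \<Longrightarrow> z < \<delta> \<Longrightarrow> f z \<le> f 0 + s * z"
  shows "touch_above f s"
  using assms unfolding touch_above_def eventually_at_right_0 by blast

lemma strict_jet:
  assumes "steep_or_elliptic \<sigma> h"
  shows "\<exists>S. \<forall>s. S \<le> \<bar>s\<bar> \<longrightarrow> (\<exists>X. 0 < lam * w - (\<sigma> 0)\<^sup>2 * X + h 0 s)"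
proof (cases "\<sigma> 0 = 0")
  case False
  have "\<exists>X. 0 < lam * w - (\<sigma> 0)\<^sup>2 * X + h 0 s" for s
    using False
    by (intro exI[of _ "- (\<bar>lam * w + h 0 s\<bar> + 1) / (\<sigma> 0)\<^sup>2"]) (simp add: abs_if)
  then show ?thesis by blast
next
  case True
  then obtain k c where k: "k > 0" "\<And>p. k * \<bar>p\<bar> - c \<le> h 0 p"
    using assms unfolding steep_or_elliptic_def by (metis less_eq_real_def)
  have "0 < lam * w - (\<sigma> 0)\<^sup>2 * 0 + h 0 s" if "(c + 1 - lam * w) / k \<le> \<bar>s\<bar>" for s
    using that k(1) k(2)[of s] by (simp add: field_simps)
  then show ?thesis by blast
qed

context hj_sub
begin

lemma bounded_above: "\<exists>A. \<forall>x. 0 \<le> x \<longrightarrow> x \<le> r \<longrightarrow> f x \<le> A"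
  using usc_on_attains_max[OF usc] r_pos by (metis atLeastAtMost_iff less_imp_le)

text \<open>
  The barrier is \<open>f 0 + P z - M z\<^sup>2 / 2\<close> on a fixed interval \<open>[0, d]\<close>. In the elliptic case \<open>M\<close> has to absorb
  the first order term and is therefore proportional to \<open>P\<close>; \<open>d\<close> is so small that \<open>M d \<le> P / 2\<close>
  nevertheless. In the coercive case \<open>M = 0\<close>. For large \<open>P\<close> the barrier is above \<open>f\<close> at \<open>d\<close>.
\<close>

lemma touch_above_exists:
  assumes "steep_or_elliptic \<sigma> h"
  shows "\<exists>P. touch_above f P"
proof -
  obtain A where A: "\<And>x. 0 \<le> x \<Longrightarrow> x \<le> r \<Longrightarrow> f x \<le> A"
    using bounded_above by blast
  show ?thesis
  proof (cases "\<sigma> 0 = 0")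
    case False
    \<comment> \<open>\<open>\<alpha>\<close> is a lower bound for the diffusion coefficient on \<open>[0, d]\<close>, and \<open>B\<close> collects the terms without \<open>P\<close>.\<close>
    define \<alpha> where "\<alpha> = (\<sigma> 0)\<^sup>2 / 4"
    define B where "B = lam * \<bar>f 0\<bar> + (\<bar>h 0 0\<bar> + C * r) + 1"
    define d where "d = min (min r (\<bar>\<sigma> 0\<bar> / (2 * C))) (\<alpha> / (4 * C))"
    define P where "P = 4 * B * d / \<alpha> + 2 * \<bar>A - f 0\<bar> / d"
    define M where "M = (B + C * P) / \<alpha>"
    have \<alpha>: "\<alpha> > 0" using False by (simp add: \<alpha>_def)
    have B: "B > 0" unfolding B_def using lam_pos C_pos r_pos by (intro add_nonneg_pos) auto
    have d: "d > 0" "d \<le> r" "C * d \<le> \<bar>\<sigma> 0\<bar> / 2" "4 * C * d \<le> \<alpha>"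
      using r_pos C_pos False \<alpha> by (auto simp: d_def min_def field_simps)
    have P: "P > 0" "B * d / \<alpha> \<le> P / 4" "A - f 0 \<le> P * d / 2"
    proof -
      have t: "4 * B * d / \<alpha> > 0" "2 * \<bar>A - f 0\<bar> / d \<ge> 0" using B d \<alpha> by auto
      then show "P > 0" "B * d / \<alpha> \<le> P / 4" unfolding P_def by (simp_all add: mult_ac)
      have "2 * \<bar>A - f 0\<bar> / d * d / 2 \<le> P * d / 2"
        using t d by (intro divide_right_mono mult_right_mono) (auto simp: P_def)
      then have "\<bar>A - f 0\<bar> \<le> P * d / 2" using d(1) by simp
      then show "A - f 0 \<le> P * d / 2" by linarith
    qed
    have M: "M > 0" "M * d \<le> P / 2"
    proof -
      show "M > 0" unfolding M_def using B C_pos P \<alpha> by (intro divide_pos_pos add_pos_pos) auto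
      have "4 * C * d * P \<le> \<alpha> * P" using d(4) P by (intro mult_right_mono) auto
      then have "C * P * d / \<alpha> \<le> P / 4" using \<alpha> by (simp add: field_simps)
      moreover have "M * d = B * d / \<alpha> + C * P * d / \<alpha>"
        by (simp add: M_def add_divide_distrib distrib_right)
      ultimately show "M * d \<le> P / 2" using P(2) by linarith
    qed
    have *: "f x \<le> f 0 + P * x + (- M) / 2 * x\<^sup>2" if x: "0 \<le> x" "x \<le> d" for x
    proof (rule quad_comparison[OF d(1,2) _ _ _ x])
      have "M * d * d \<le> P / 2 * d" using M d by (intro mult_right_mono) auto
      moreover have "- M / 2 * d\<^sup>2 = - (M * d * d / 2)" by (simp add: power2_eq_square)
      ultimately show "f d \<le> f 0 + P * d + - M / 2 * d\<^sup>2"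
        using A[of d] d(1,2) P(3) mult_pos_pos[OF P(1) d(1)] by linarith
      fix x assume x: "0 < x" "x < d"
      have "M * x \<le> M * d" using M x by simp
      then have Mx: "M * x \<le> P / 2" using M by linarith
      have "C * x \<le> C * d" using x C_pos by simp
      then have "\<bar>\<sigma> 0\<bar> / 2 \<le> \<bar>\<sigma> x\<bar>"
        using \<sigma>_lip[of x 0] x d by simp
      then have "(\<bar>\<sigma> 0\<bar> / 2)\<^sup>2 \<le> \<bar>\<sigma> x\<bar>\<^sup>2" by (intro power_mono) auto
      then have "\<alpha> \<le> (\<sigma> x)\<^sup>2" by (simp add: \<alpha>_def power_divide)
      then have s: "\<alpha> * M \<le> (\<sigma> x)\<^sup>2 * M" using M by (intro mult_right_mono) auto
      have "M * x * x \<le> P / 2 * x" using Mx x by (intro mult_right_mono) auto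
      then have "P * x + - M / 2 * x\<^sup>2 \<ge> 0" using x P by (simp add: power2_eq_square)
      then have "- \<bar>f 0\<bar> \<le> f 0 + P * x + - M / 2 * x\<^sup>2" by linarith
      then have "lam * - \<bar>f 0\<bar> \<le> lam * (f 0 + P * x + - M / 2 * x\<^sup>2)"
        using lam_pos by (intro mult_left_mono) auto
      then have v: "lam * (f 0 + P * x + - M / 2 * x\<^sup>2) \<ge> - (lam * \<bar>f 0\<bar>)" by simp
      have "\<bar>h x (P - M * x) - h x 0\<bar> \<le> C * \<bar>P - M * x - 0\<bar>" using x d by (intro h_p) auto
      also have "\<dots> \<le> C * P" using C_pos Mx M x P
        by (intro mult_left_mono) (auto simp: abs_if)
      finally have h1: "\<bar>h x (P - M * x) - h x 0\<bar> \<le> C * P" .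
      have "C * x \<le> C * r" using C_pos x d by simp
      then have h2: "\<bar>h x 0 - h 0 0\<bar> \<le> C * r" using h_x[of x 0 0] x d by simp
      have "\<alpha> * M = B + C * P" using \<alpha> by (simp add: M_def)
      then have "lam * (f 0 + P * x + - M / 2 * x\<^sup>2) + (\<sigma> x)\<^sup>2 * M + h x (P - M * x) > 0"
        using h1 h2 v s unfolding B_def by linarith
      then show "0 < lam * (f 0 + P * x + - M / 2 * x\<^sup>2) - (\<sigma> x)\<^sup>2 * - M + h x (P + - M * x)"
        by simp
    qed simp
    have "touch_above f P"
    proof (rule touch_aboveI[OF d(1)])
      fix z assume "0 < z" "z < d"
      then show "f z \<le> f 0 + P * z" using *[of z] M by (smt (verit) mult_nonneg_nonneg divide_nonneg_nonneg zero_le_power2 mult_minus_left minus_divide_left)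
    qed
    then show ?thesis by blast
  next
    case True
    then obtain \<rho> k c where k: "\<rho> > 0" "k > 0" "\<And>x p. 0 \<le> x \<Longrightarrow> x \<le> \<rho> \<Longrightarrow> k * \<bar>p\<bar> - c \<le> h x p"
      using assms unfolding steep_or_elliptic_def by blast
    define d where "d = min \<rho> r"
    define P where "P = \<bar>A - f 0\<bar> / d + (\<bar>c\<bar> + lam * \<bar>f 0\<bar> + 1) / k"
    have d: "d > 0" "d \<le> r" "d \<le> \<rho>" using k r_pos by (auto simp: d_def)
    have t: "\<bar>A - f 0\<bar> / d \<ge> 0" "(\<bar>c\<bar> + lam * \<bar>f 0\<bar> + 1) / k > 0" 
      using d k lam_pos by (auto intro!: divide_pos_pos add_nonneg_pos)
    have P: "P > 0" "A - f 0 \<le> P * d" "\<bar>c\<bar> + lam * \<bar>f 0\<bar> + 1 \<le> k * P"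
    proof -
      show "P > 0" using t by (simp add: P_def)
      have "\<bar>A - f 0\<bar> / d * d \<le> P * d" using t d by (intro mult_right_mono) (auto simp: P_def)
      then show "A - f 0 \<le> P * d" using d by simp
      have "k * ((\<bar>c\<bar> + lam * \<bar>f 0\<bar> + 1) / k) \<le> k * P"
        using t k by (intro mult_left_mono) (auto simp: P_def)
      then show "\<bar>c\<bar> + lam * \<bar>f 0\<bar> + 1 \<le> k * P" using k by simp
    qed
    have *: "f x \<le> f 0 + P * x + 0 / 2 * x\<^sup>2" if x: "0 \<le> x" "x \<le> d" for x
    proof (rule quad_comparison[OF d(1,2) _ _ _ x])
      show "f d \<le> f 0 + P * d + 0 / 2 * d\<^sup>2" using A[of d] d P by simp
      fix x assume x: "0 < x" "x < d"
      have "lam * (P * x) \<ge> 0" using lam_pos P x by simp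
      moreover have "lam * - \<bar>f 0\<bar> \<le> lam * f 0"
        using lam_pos by (intro mult_left_mono) auto
      ultimately show "0 < lam * (f 0 + P * x + 0 / 2 * x\<^sup>2) - (\<sigma> x)\<^sup>2 * 0 + h x (P + 0 * x)"
        using k(3)[of x P] x d P by (simp add: algebra_simps)
    qed simp
    have "touch_above f P"
      by (rule touch_aboveI[OF d(1)]) (use * in auto)
    then show ?thesis by blast
  qed
qed

text \<open>
  A test function at the end point itself that violates the equation there. A boundary condition of
  the form "equation or condition" is thus reduced to the condition.
\<close>

lemma jet_above_strict:
  assumes "steep_or_elliptic \<sigma> h"
  shows "\<exists>s X. jet_above f s X \<and> 0 < lam * f 0 - (\<sigma> 0)\<^sup>2 * X + h 0 s"
proof -
  obtain P where P: "touch_above f P" using touch_above_exists[OF assms] by blast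
  obtain S where S: "\<And>s. S \<le> \<bar>s\<bar> \<Longrightarrow> \<exists>X. 0 < lam * f 0 - (\<sigma> 0)\<^sup>2 * X + h 0 s"
    using strict_jet[OF assms] by metis
  obtain X where "0 < lam * f 0 - (\<sigma> 0)\<^sup>2 * X + h 0 (\<bar>P\<bar> + \<bar>S\<bar> + 1)"
    using S[of "\<bar>P\<bar> + \<bar>S\<bar> + 1"] by fastforce
  moreover have "jet_above f (\<bar>P\<bar> + \<bar>S\<bar> + 1) X"
    by (rule jet_above_of_touch[OF P]) simp
  ultimately show ?thesis by blast
qed

text \<open>
  If the graph of \<open>f\<close> is above and below the line of slope \<open>p\<close> through \<open>(0, f 0)\<close> arbitrarily close to
  \<open>0\<close>, then \<open>f\<close> minus this line has positive interior maxima arbitrarily close to \<open>0\<close>, and the line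
  is a test function there.
\<close>

lemma crossing_slope:
  assumes above: "\<not> touch_above f p"
    and below: "\<And>\<delta>. \<delta> > 0 \<Longrightarrow> \<exists>z. 0 < z \<and> z < \<delta> \<and> f z < f 0 + p * z"
  shows "lam * f 0 + h 0 p \<le> 0"
proof (rule ccontr)
  assume "\<not> ?thesis"
  then have "0 < lam * f 0 - (\<sigma> 0)\<^sup>2 * 0 + h 0 p" by simp
  from stability[OF this] obtain \<theta> where \<theta>: "\<theta> > 0" "\<theta> \<le> r"
    "\<And>x q w. 0 \<le> x \<Longrightarrow> x \<le> \<theta> \<Longrightarrow> \<bar>q - p\<bar> \<le> \<theta> \<Longrightarrow> f 0 - \<theta> \<le> w \<Longrightarrow>
       0 < lam * w - (\<sigma> x)\<^sup>2 * 0 + h x q" by blast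
  obtain z where z: "0 < z" "z < min \<theta> (\<theta> / (\<bar>p\<bar> + 1))" "f z < f 0 + p * z"
    using below[of "min \<theta> (\<theta> / (\<bar>p\<bar> + 1))"] \<theta> by auto
  have *: "f x \<le> f 0 + p * x + 0 / 2 * x\<^sup>2" if x: "0 \<le> x" "x \<le> z" for x
  proof (rule quad_comparison[OF z(1) _ _ _ _ x])
    fix y assume y: "0 < y" "y < z"
    have "\<bar>p * y\<bar> \<le> (\<bar>p\<bar> + 1) * z" unfolding abs_mult using y by (intro mult_mono) auto
    also have "\<dots> \<le> \<theta>" using z by (simp add: field_simps)
    finally show "0 < lam * (f 0 + p * y + 0 / 2 * y\<^sup>2) - (\<sigma> y)\<^sup>2 * 0 + h y (p + 0 * y)"
      using \<theta>(3)[of y p "f 0 + p * y"] \<theta>(1) y z by simp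
  qed (use z \<theta> in auto)
  obtain \<zeta> where "0 < \<zeta>" "\<zeta> < z" "f \<zeta> > f 0 + p * \<zeta>"
    using not_touch_aboveD[OF above z(1)] .
  then show False using *[of \<zeta>] by simp
qed

text \<open>
  A convex parabola that starts with slope \<open>P - 4 \<theta>\<close> and gains \<open>10 \<theta>\<close> on an interval of length
  \<open>z\<close> is above \<open>f\<close> at \<open>z\<close> but below \<open>f\<close> at \<open>z / 2\<close> for suitable small \<open>z\<close>. Its second derivative
  is of order \<open>\<theta> / z\<close>, while the diffusion coefficient is at most \<open>C\<^sup>2 z\<^sup>2\<close>, so that the second order
  term tends to \<open>0\<close> with \<open>z\<close>, and only slopes close to \<open>P\<close> occur.
\<close>

lemma critical_slope:
  assumes \<sigma>0: "\<sigma> 0 = 0" and P: "upper_slope f P"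
  shows "lam * f 0 + h 0 P \<le> 0"
proof (rule ccontr)
  assume "\<not> ?thesis"
  define g where "g = lam * f 0 + h 0 P"
  have g: "g > 0" using \<open>\<not> _\<close> by (simp add: g_def)
  have "g / 2 < lam * f 0 - (\<sigma> 0)\<^sup>2 * 0 + h 0 P" using g by (simp add: g_def)
  from stability[OF this] obtain \<theta>1 where \<theta>1: "\<theta>1 > 0" "\<theta>1 \<le> r"
    "\<And>x q w. 0 \<le> x \<Longrightarrow> x \<le> \<theta>1 \<Longrightarrow> \<bar>q - P\<bar> \<le> \<theta>1 \<Longrightarrow> f 0 - \<theta>1 \<le> w \<Longrightarrow>
       g / 2 < lam * w + h x q" by (auto simp: algebra_simps)
  \<comment> \<open>The slopes of the parabola differ from \<open>P\<close> by at most \<open>6 \<theta>\<close>.\<close>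
  define \<theta> where "\<theta> = \<theta>1 / 6"
  have \<theta>: "\<theta> > 0" using \<theta>1 by (simp add: \<theta>_def)
  obtain \<delta> where \<delta>: "\<delta> > 0" "\<And>z. 0 < z \<Longrightarrow> z < \<delta> \<Longrightarrow> f z \<le> f 0 + (P + \<theta>) * z"
    using P \<theta> touch_aboveD[of f "P + \<theta>"] unfolding upper_slope_def by auto
  define b where "b = min (min \<delta> \<theta>1) (min (\<theta>1 / (\<bar>P\<bar> + 9 * \<theta>)) (g / (20 * C\<^sup>2 * \<theta>)))"
  have b: "b > 0" using \<delta> \<theta>1 \<theta> g C_pos by (auto simp: b_def intro!: divide_pos_pos add_nonneg_pos)
  have "\<not> touch_above f (P - \<theta>)" using P \<theta> unfolding upper_slope_def by simp
  then obtain \<zeta> where \<zeta>: "0 < \<zeta>" "\<zeta> < b / 2" "f \<zeta> > f 0 + (P - \<theta>) * \<zeta>"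
    using not_touch_aboveD[of f "P - \<theta>" "b / 2"] b by auto
  define z where "z = 2 * \<zeta>"
  have z: "0 < z" "z < b" using \<zeta> by (auto simp: z_def)
  have z1: "z < \<delta>" "z < \<theta>1" "z * (\<bar>P\<bar> + 9 * \<theta>) < \<theta>1" "C\<^sup>2 * z * (10 * \<theta>) < g / 2"
  proof -
    show "z < \<delta>" "z < \<theta>1" using z by (auto simp: b_def)
    have "z < \<theta>1 / (\<bar>P\<bar> + 9 * \<theta>)" using z by (auto simp: b_def)
    then show "z * (\<bar>P\<bar> + 9 * \<theta>) < \<theta>1" using \<theta> by (subst (asm) pos_less_divide_eq) auto
    have "z < g / (20 * C\<^sup>2 * \<theta>)" using z by (auto simp: b_def)
    then show "C\<^sup>2 * z * (10 * \<theta>) < g / 2"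
      using \<theta> C_pos by (subst (asm) pos_less_divide_eq) (auto simp: algebra_simps)
  qed
  define X where "X = 10 * \<theta> / z"
  have X: "X > 0" "X * z = 10 * \<theta>" using z \<theta> by (auto simp: X_def)
  have *: "f x \<le> f 0 + (P - 4 * \<theta>) * x + X / 2 * x\<^sup>2" if x: "0 \<le> x" "x \<le> z" for x
  proof (rule quad_comparison[OF z(1) _ _ _ _ x])
    show "z \<le> r" using z1 \<theta>1 by simp
    have "X / 2 * z\<^sup>2 = 5 * \<theta> * z" using X by (simp add: power2_eq_square)
    then show "f z \<le> f 0 + (P - 4 * \<theta>) * z + X / 2 * z\<^sup>2"
      using \<delta>(2)[OF z(1) z1(1)] by (simp add: algebra_simps)
    fix y assume y: "0 < y" "y < z"
    have Xy: "0 < X * y" "X * y \<le> 10 * \<theta>"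
      using X y mult_left_mono[of y z X] mult_pos_pos[of X y] by linarith+
    have q: "\<bar>(P - 4 * \<theta> + X * y) - P\<bar> \<le> \<theta>1" using Xy \<theta> by (simp add: \<theta>_def abs_le_iff)
    have e: "(P - 4 * \<theta>) * y + X / 2 * y\<^sup>2 = (P - 4 * \<theta> + X * y / 2) * y"
      by (simp add: power2_eq_square algebra_simps)
    have "\<bar>P - 4 * \<theta> + X * y / 2\<bar> \<le> \<bar>P\<bar> + 9 * \<theta>" using Xy \<theta> by linarith
    then have "\<bar>(P - 4 * \<theta> + X * y / 2) * y\<bar> \<le> (\<bar>P\<bar> + 9 * \<theta>) * z"
      unfolding abs_mult using y by (intro mult_mono) auto
    then have w: "f 0 - \<theta>1 \<le> f 0 + (P - 4 * \<theta>) * y + X / 2 * y\<^sup>2"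
      using z1(3) e by (simp add: mult.commute)
    have "\<bar>\<sigma> y\<bar> \<le> C * y" using \<sigma>_lip[of y 0] \<sigma>0 y z1 \<theta>1 by simp
    then have "\<bar>\<sigma> y\<bar>\<^sup>2 \<le> (C * y)\<^sup>2" by (intro power_mono) auto
    then have "(\<sigma> y)\<^sup>2 * X \<le> (C * y)\<^sup>2 * X" using X by (intro mult_right_mono) auto
    also have "\<dots> = C\<^sup>2 * y * (X * y)" by (simp add: power2_eq_square)
    also have "\<dots> \<le> C\<^sup>2 * z * (10 * \<theta>)"
      using Xy y by (intro mult_mono[of "C\<^sup>2 * y"] mult_left_mono) auto
    finally have "(\<sigma> y)\<^sup>2 * X < g / 2" using z1 by simp
    then show "0 < lam * (f 0 + (P - 4 * \<theta>) * y + X / 2 * y\<^sup>2) - (\<sigma> y)\<^sup>2 * X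
        + h y (P - 4 * \<theta> + X * y)"
      using \<theta>1(3)[OF _ _ q w, of y] y z1 by linarith
  qed simp
  have "X * \<zeta> = 5 * \<theta>" using X(2) by (simp add: z_def)
  then have "X / 2 * \<zeta>\<^sup>2 = 5 / 2 * \<theta> * \<zeta>" by (simp add: power2_eq_square)
  then have "f \<zeta> \<le> f 0 + (P - \<theta>) * \<zeta> - \<theta> * \<zeta> / 2"
    using *[of \<zeta>] \<zeta> by (simp add: z_def algebra_simps)
  then show False using \<zeta> \<theta> by (smt (verit) mult_pos_pos divide_pos_pos)
qed

text \<open>
  In the elliptic case the limit superior is a limit. If \<open>f\<close> were below the line of slope \<open>P - \<theta>\<close> at
  some \<open>z\<close>, a strongly concave barrier of slope \<open>P - \<theta> / 2\<close> at \<open>0\<close> would dominate \<open>f\<close> on \<open>[0, z]\<close>,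
  and its slope is smaller than \<open>P\<close>.
\<close>

lemma lower_slope:
  assumes \<sigma>0: "\<sigma> 0 \<noteq> 0" and P: "upper_slope f P" and \<theta>: "\<theta> > 0"
  shows "\<exists>\<rho>>0. \<rho> \<le> r \<and> (\<forall>z. 0 < z \<longrightarrow> z \<le> \<rho> \<longrightarrow> f 0 + (P - \<theta>) * z \<le> f z)"
proof -
  define M where "M = (\<bar>lam * f 0 + h 0 P\<bar> + 1) / (\<sigma> 0)\<^sup>2"
  have M: "M > 0" unfolding M_def using \<sigma>0 by (intro divide_pos_pos add_nonneg_pos) auto
  have "(\<sigma> 0)\<^sup>2 * M = \<bar>lam * f 0 + h 0 P\<bar> + 1" using \<sigma>0 by (simp add: M_def)
  then have "0 < lam * f 0 - (\<sigma> 0)\<^sup>2 * (- M) + h 0 P" by simp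
  from stability[OF this] obtain \<theta>1 where \<theta>1: "\<theta>1 > 0" "\<theta>1 \<le> r"
    "\<And>x q w. 0 \<le> x \<Longrightarrow> x \<le> \<theta>1 \<Longrightarrow> \<bar>q - P\<bar> \<le> \<theta>1 \<Longrightarrow> f 0 - \<theta>1 \<le> w \<Longrightarrow>
       0 < lam * w - (\<sigma> x)\<^sup>2 * (- M) + h x q" by blast
  define t where "t = min \<theta> (\<theta>1 / 2)"
  have t: "t > 0" "t \<le> \<theta>" "2 * t \<le> \<theta>1" using \<theta> \<theta>1 by (auto simp: t_def)
  define \<rho> where "\<rho> = min (min 1 \<theta>1) (t / (M + \<bar>P\<bar> + t + 1))"
  have pos: "M + \<bar>P\<bar> + t + 1 > 0" using M t by simp
  have \<rho>: "\<rho> > 0" "\<rho> \<le> 1" "\<rho> \<le> \<theta>1" "\<rho> * (M + \<bar>P\<bar> + t + 1) \<le> t"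
  proof -
    show "\<rho> > 0" "\<rho> \<le> 1" "\<rho> \<le> \<theta>1" using \<theta>1 t pos by (auto simp: \<rho>_def)
    have "\<rho> \<le> t / (M + \<bar>P\<bar> + t + 1)" by (simp add: \<rho>_def)
    then show "\<rho> * (M + \<bar>P\<bar> + t + 1) \<le> t" using pos by (subst (asm) pos_le_divide_eq) auto
  qed
  have "f 0 + (P - \<theta>) * z \<le> f z" if z: "0 < z" "z \<le> \<rho>" for z
  proof (rule ccontr)
    assume "\<not> ?thesis"
    then have fz: "f z < f 0 + (P - \<theta>) * z" by simp
    have bnd: "M * y \<le> t" "\<bar>(P - t / 2) * y + (- M) / 2 * y\<^sup>2\<bar> \<le> \<theta>1" if y: "0 < y" "y \<le> z" for y
    proof -
      have le: "y * (M + \<bar>P\<bar> + t + 1) \<le> t"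
        using \<rho>(4) y z pos mult_right_mono[of y \<rho> "M + \<bar>P\<bar> + t + 1"] by linarith
      have nn: "y * \<bar>P\<bar> \<ge> 0" "y * t \<ge> 0" "y * M \<ge> 0" using y t M by auto
      have le': "y * M + y * \<bar>P\<bar> + y * t + y \<le> t" using le by (simp add: algebra_simps)
      show "M * y \<le> t" using le' nn y mult.commute[of M y] by linarith
      have "y\<^sup>2 \<le> y" using y z \<rho> by (simp add: power2_eq_square mult_left_le_one_le)
      then have "M / 2 * y\<^sup>2 \<le> M * y" using M y
        by (intro mult_mono) auto
      moreover have "\<bar>(P - t / 2) * y\<bar> \<le> (\<bar>P\<bar> + t) * y"
        unfolding abs_mult using t y by (intro mult_mono) auto
      moreover have "M / 2 * y\<^sup>2 \<ge> 0" using M by simp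
      ultimately show "\<bar>(P - t / 2) * y + (- M) / 2 * y\<^sup>2\<bar> \<le> \<theta>1"
        using le' y t \<theta>1 by (simp add: algebra_simps)
    qed
    have *: "f x \<le> f 0 + (P - t / 2) * x + (- M) / 2 * x\<^sup>2" if x: "0 \<le> x" "x \<le> z" for x
    proof (rule quad_comparison[OF z(1) _ _ _ _ x])
      show "z \<le> r" using z \<rho> \<theta>1 by simp
      have "M * z * z \<le> t * z" using bnd(1)[of z] z by (intro mult_right_mono) auto
      moreover have "t * z \<le> \<theta> * z" using t z by (intro mult_right_mono) auto
      ultimately show "f z \<le> f 0 + (P - t / 2) * z + - M / 2 * z\<^sup>2"
        using fz by (simp add: power2_eq_square algebra_simps)
      fix y assume y: "0 < y" "y < z"
      have q: "\<bar>(P - t / 2 + - M * y) - P\<bar> \<le> \<theta>1"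
      proof -
        have "M * y \<ge> 0" using M y by simp
        then show ?thesis using bnd(1)[of y] y t by simp
      qed
      show "0 < lam * (f 0 + (P - t / 2) * y + - M / 2 * y\<^sup>2) - (\<sigma> y)\<^sup>2 * - M + h y (P - t / 2 + - M * y)"
        by (rule \<theta>1(3)[OF _ _ q]) (use y z \<rho> bnd(2)[of y] in auto)
    qed simp
    have "touch_above f (P - t / 4)"
      by (rule touch_above_quadratic[of "P - t / 2" _ z _ "- M"]) (use * z t in auto)
    then show False using P t unfolding upper_slope_def by simp
  qed
  then show ?thesis using \<rho> \<theta>1 by (intro exI[of _ \<rho>]) auto
qed

text \<open>
  \<open>X\<close> is slightly less than the second derivative that the equation dictates at \<open>0\<close>, so quadratics with
  second derivative \<open>X\<close> and slope near \<open>P\<close> are strict barriers. The one that meets \<open>f\<close> at \<open>0\<close> and at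
  \<open>z\<close> dominates \<open>f\<close> in between, so its slope at \<open>0\<close> is at least \<open>P\<close>; this is the claim at \<open>z\<close>.
\<close>

lemma second_order_expansion:
  assumes \<sigma>0: "\<sigma> 0 \<noteq> 0" and P: "upper_slope f P" and \<eta>: "\<eta> > 0"
  defines "X \<equiv> (lam * f 0 + h 0 P) / (\<sigma> 0)\<^sup>2 - \<eta>"
  shows "\<exists>\<rho>>0. \<rho> \<le> r \<and> (\<forall>z. 0 < z \<longrightarrow> z \<le> \<rho> \<longrightarrow> f 0 + P * z + X / 2 * z\<^sup>2 \<le> f z)"
proof -
  have "(\<sigma> 0)\<^sup>2 * X = lam * f 0 + h 0 P - (\<sigma> 0)\<^sup>2 * \<eta>"
    using \<sigma>0 by (simp add: X_def right_diff_distrib)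
  moreover have "(\<sigma> 0)\<^sup>2 * \<eta> > 0" using \<sigma>0 \<eta> by simp
  ultimately have "0 < lam * f 0 - (\<sigma> 0)\<^sup>2 * X + h 0 P" by simp
  from stability[OF this] obtain \<theta>1 where \<theta>1: "\<theta>1 > 0" "\<theta>1 \<le> r"
    "\<And>x q w. 0 \<le> x \<Longrightarrow> x \<le> \<theta>1 \<Longrightarrow> \<bar>q - P\<bar> \<le> \<theta>1 \<Longrightarrow> f 0 - \<theta>1 \<le> w \<Longrightarrow>
       0 < lam * w - (\<sigma> x)\<^sup>2 * X + h x q" by blast
  define t where "t = \<theta>1 / 4"
  have t: "t > 0" using \<theta>1 by (simp add: t_def)
  obtain \<rho>1 where \<rho>1: "\<rho>1 > 0" "\<And>z. 0 < z \<Longrightarrow> z \<le> \<rho>1 \<Longrightarrow> f 0 + (P - t) * z \<le> f z"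
    using lower_slope[OF \<sigma>0 P t] by blast
  define \<rho> where "\<rho> = min (min 1 \<theta>1) (min \<rho>1 (t / (\<bar>X\<bar> + \<bar>P\<bar> + 2 * t + 1)))"
  have pos: "\<bar>X\<bar> + \<bar>P\<bar> + 2 * t + 1 > 0" using t by simp
  have \<rho>: "\<rho> > 0" "\<rho> \<le> 1" "\<rho> \<le> \<theta>1" "\<rho> \<le> \<rho>1" "\<rho> * (\<bar>X\<bar> + \<bar>P\<bar> + 2 * t + 1) \<le> t"
  proof -
    show "\<rho> > 0" "\<rho> \<le> 1" "\<rho> \<le> \<theta>1" "\<rho> \<le> \<rho>1" using \<theta>1 \<rho>1 t pos by (auto simp: \<rho>_def)
    have "\<rho> \<le> t / (\<bar>X\<bar> + \<bar>P\<bar> + 2 * t + 1)" by (simp add: \<rho>_def)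
    then show "\<rho> * (\<bar>X\<bar> + \<bar>P\<bar> + 2 * t + 1) \<le> t" using pos by (subst (asm) pos_le_divide_eq) auto
  qed
  have "f 0 + P * z + X / 2 * z\<^sup>2 \<le> f z" if z: "0 < z" "z \<le> \<rho>" for z
  proof (rule ccontr)
    assume "\<not> ?thesis"
    then have fz: "f z < f 0 + P * z + X / 2 * z\<^sup>2" by simp
    define p where "p = (f z - f 0) / z - X / 2 * z"
    have pz: "f z = f 0 + p * z + X / 2 * z\<^sup>2"
      using z by (simp add: p_def power2_eq_square field_simps)
    then have pP: "p < P" using fz z by simp
    have le: "y * \<bar>X\<bar> + y * \<bar>P\<bar> + 2 * y * t + y \<le> t" if y: "0 < y" "y \<le> z" for y
      using \<rho>(5) y z pos mult_right_mono[of y \<rho> "\<bar>X\<bar> + \<bar>P\<bar> + 2 * t + 1"]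
      by (simp add: algebra_simps)
    have Xy: "\<bar>X * y\<bar> \<le> t" if y: "0 < y" "y \<le> z" for y
    proof -
      have "y * \<bar>P\<bar> \<ge> 0" "y * t \<ge> 0" using y t by auto
      moreover have "\<bar>X * y\<bar> = y * \<bar>X\<bar>" using y by (simp add: abs_mult)
      ultimately show ?thesis using le[OF y] y by linarith
    qed
    have plow: "P - 2 * t \<le> p"
    proof -
      have "(P - t) * z \<le> (p + X / 2 * z) * z" using \<rho>1(2)[OF z(1)] z \<rho> pz
        by (simp add: power2_eq_square algebra_simps)
      then have "P - t \<le> p + X / 2 * z" using z by simp
      then show ?thesis using Xy[of z] z t by simp
    qed
    have *: "f x \<le> f 0 + p * x + X / 2 * x\<^sup>2" if x: "0 \<le> x" "x \<le> z" for x
    proof (rule quad_comparison[OF z(1) _ _ _ _ x])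
      show "z \<le> r" using z \<rho> \<theta>1 by simp
      show "f z \<le> f 0 + p * z + X / 2 * z\<^sup>2" using pz by simp
      fix y assume y: "0 < y" "y < z"
      have q: "\<bar>(p + X * y) - P\<bar> \<le> \<theta>1"
        using Xy[of y] y plow pP by (simp add: t_def)
      have "\<bar>p\<bar> \<le> \<bar>P\<bar> + 2 * t" using plow pP by simp
      then have a: "\<bar>p * y\<bar> \<le> (\<bar>P\<bar> + 2 * t) * y"
        unfolding abs_mult using y t by (intro mult_mono) auto
      have "y\<^sup>2 \<le> y" using y z \<rho> by (simp add: power2_eq_square mult_left_le_one_le)
      then have "\<bar>X / 2 * y\<^sup>2\<bar> \<le> \<bar>X\<bar> * y"
        unfolding abs_mult using y by (intro mult_mono) auto
      then have w: "f 0 - \<theta>1 \<le> f 0 + p * y + X / 2 * y\<^sup>2"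
        using a le[of y] y t by (simp add: t_def algebra_simps)
      show "0 < lam * (f 0 + p * y + X / 2 * y\<^sup>2) - (\<sigma> y)\<^sup>2 * X + h y (p + X * y)"
        by (rule \<theta>1(3)[OF _ _ q w]) (use y z \<rho> in auto)
    qed simp
    have "touch_above f ((p + P) / 2)"
      by (rule touch_above_quadratic[of p _ z _ X]) (use * z pP in auto)
    then show False using P pP unfolding upper_slope_def by simp
  qed
  then show ?thesis using \<rho> \<theta>1 by (intro exI[of _ \<rho>]) auto
qed

end

section \<open>A subsolution above a supersolution at an end point\<close>

abbreviation mirror :: "(real \<Rightarrow> real \<Rightarrow> real) \<Rightarrow> real \<Rightarrow> real \<Rightarrow> real" where
  "mirror h \<equiv> (\<lambda>x p. - h x (- p))"

locale hj_sub_super = F: hj_sub lam C \<sigma> h r f + G: hj_sub lam C \<sigma> "mirror h" r "\<lambda>x. - g x"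
  for lam C \<sigma> h r f g

locale hj_pair = hj_sub_super +
  assumes max0: "\<And>z. 0 \<le> z \<Longrightarrow> z \<le> r \<Longrightarrow> f z - g z \<le> f 0 - g 0"
    and gap: "g 0 < f 0"
begin

abbreviation (input) "touch_below t \<equiv> touch_above (\<lambda>x. - g x) (- t)"

text \<open>
  Let \<open>D s = lam * f 0 + h 0 s\<close>, and let \<open>[P, b]\<close> be the longest interval starting at \<open>P\<close> on which
  \<open>D \<le> 0\<close>; coercivity makes it bounded. Just beyond \<open>b\<close> there are slopes with \<open>D > 0\<close> but
  \<open>D < lam * (f 0 - g 0)\<close>, which is the wanted gap, unless no slope beyond \<open>b\<close> touches \<open>g\<close> from below.
  In that case the supremum \<open>Q\<close> of the slopes touching \<open>g\<close> from below is at most \<open>b\<close>. All slopes \<open>p\<close>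
  with \<open>Q < p < P\<close> are crossed by \<open>f\<close>, because \<open>f z - f 0 \<le> g z - g 0\<close>, and hence have \<open>D p \<le> 0\<close>.
  By coercivity \<open>Q\<close> is finite, and \<open>D Q \<le> 0\<close> whether \<open>Q\<close> is below \<open>P\<close> or in \<open>[P, b]\<close>. But
  \<open>Q\<close> is critical for \<open>g\<close>, which gives \<open>D Q \<ge> lam * (f 0 - g 0) > 0\<close>.
\<close>

lemma degenerate_gap:
  assumes \<sigma>0: "\<sigma> 0 = 0" and k: "k > 0" "\<And>p. k * \<bar>p\<bar> - c \<le> h 0 p"
    and P: "upper_slope f P"
  shows "\<exists>s t t'. P < s \<and> s < t \<and> t < t' \<and> 0 < lam * f 0 + h 0 s \<and>
    touch_below t' \<and> lam * g 0 + h 0 t < 0"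
proof -
  define D where "D s = lam * f 0 + h 0 s" for s
  define m where "m = lam * (f 0 - g 0)"
  have m: "m > 0" using gap F.lam_pos by (simp add: m_def)
  have Dlip: "\<bar>D x - D y\<bar> \<le> C * \<bar>x - y\<bar>" for x y
    using F.h_p[of 0 x y] F.r_pos by (simp add: D_def)
  have C: "C > 0" by (rule F.C_pos)
  have Dlim: "D x \<le> 0" if x: "\<And>\<delta>. \<delta> > 0 \<Longrightarrow> \<exists>y. \<bar>x - y\<bar> < \<delta> \<and> D y \<le> 0" for x
  proof (rule ccontr)
    assume "\<not> D x \<le> 0"
    then obtain y where y: "\<bar>x - y\<bar> < D x / C" "D y \<le> 0" using x[of "D x / C"] C by auto
    then have "C * \<bar>x - y\<bar> < D x" using C by (simp add: field_simps)
    then show False using Dlip[of x y] y by linarith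
  qed
  have Dcoer: "\<bar>s\<bar> \<le> (c - lam * f 0) / k" if "D s \<le> 0" for s
    using that k(1) k(2)[of s] by (simp add: D_def field_simps)
  define S where "S = {s. P \<le> s \<and> (\<forall>x. P \<le> x \<longrightarrow> x \<le> s \<longrightarrow> D x \<le> 0)}"
  have "D P \<le> 0" using F.critical_slope[OF \<sigma>0 P] by (simp add: D_def)
  then have PS: "P \<in> S" unfolding S_def by (auto dest: order.antisym)
  have bdd: "bdd_above S"
    by (rule bdd_aboveI[of _ "(c - lam * f 0) / k"]) (use Dcoer in \<open>force simp: S_def\<close>)
  define b where "b = Sup S"
  have Pb: "P \<le> b" unfolding b_def using PS bdd by (rule cSup_upper)
  have below: "D x \<le> 0" if x: "P \<le> x" "x < b" for x
  proof -
    obtain s where "s \<in> S" "x < s" using x less_cSup_iff[OF _ bdd, of x] PS unfolding b_def by blast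
    then show ?thesis using x by (simp add: S_def)
  qed
  have Db: "D b \<le> 0"
  proof (cases "P = b")
    case True then show ?thesis using \<open>D P \<le> 0\<close> by simp
  next
    case False
    then have lt: "P < b" using Pb by simp
    show ?thesis
    proof (rule Dlim)
      fix \<delta> :: real assume "\<delta> > 0"
      then show "\<exists>y. \<bar>b - y\<bar> < \<delta> \<and> D y \<le> 0"
        using lt below[of "max P (b - \<delta> / 2)"]
        by (intro exI[of _ "max P (b - \<delta> / 2)"]) (auto simp: max_def)
    qed
  qed
  have beyond: "\<exists>s. b < s \<and> s < b + \<delta> \<and> 0 < D s" if \<delta>: "\<delta> > 0" for \<delta>
  proof (rule ccontr)
    assume n: "\<not> ?thesis"
    have "D x \<le> 0" if "P \<le> x" "x \<le> b + \<delta> / 2" for x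
    proof (cases "x \<le> b")
      case True
      then show ?thesis using below[of x] Db that(1) by (cases "x = b") auto
    next
      case False
      then have "b < x" "x < b + \<delta>" using that(2) \<delta> by linarith+
      then show ?thesis using n by (meson not_less)
    qed
    then have "b + \<delta> / 2 \<in> S" unfolding S_def using Pb \<delta> by auto
    then have "b + \<delta> / 2 \<le> b" unfolding b_def using bdd by (rule cSup_upper)
    then show False using \<delta> by simp
  qed
  show ?thesis
  proof (cases "\<exists>t0>b. touch_below t0")
    case True
    then obtain t0 where t0: "b < t0" "touch_below t0" by blast
    define \<delta> where "\<delta> = min (t0 - b) (m / (2 * C))"
    have \<delta>: "\<delta> > 0" using t0 m C by (simp add: \<delta>_def)
    obtain s where s: "b < s" "s < b + \<delta>" "0 < D s" using beyond[OF \<delta>] by blast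
    define t where "t = (s + (b + \<delta>)) / 2"
    have t: "s < t" "t < b + \<delta>" using s by (auto simp: t_def)
    have "\<delta> \<le> m / (2 * C)" by (simp add: \<delta>_def)
    then have "C * \<delta> \<le> m / 2" using C by (simp add: field_simps)
    moreover have "C * \<bar>t - b\<bar> \<le> C * \<delta>" using t s C by (intro mult_left_mono) auto
    ultimately have "D t < m" using Dlip[of t b] Db m by linarith
    then have "lam * g 0 + h 0 t < 0" by (simp add: D_def m_def algebra_simps)
    moreover have "t < t0" using t by (simp add: \<delta>_def)
    ultimately show ?thesis using s t Pb t0 unfolding D_def by (intro exI[of _ s] exI[of _ t] exI[of _ t0]) auto
  next
    case False
    then have le: "t \<le> b" if "touch_below t" for t using that by (meson not_le)
    have nt: "D p \<le> 0" if p: "\<not> touch_below p" "p \<le> b" for p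
    proof (cases "P \<le> p")
      case True then show ?thesis using below[of p] Db p(2) by (cases "p = b") auto
    next
      case pP: False
      show ?thesis unfolding D_def
      proof (rule F.crossing_slope)
        show "\<not> touch_above f p" using P pP unfolding upper_slope_def by simp
        fix \<delta> :: real assume "\<delta> > 0"
        then have "min \<delta> r > 0" using F.r_pos by simp
        then obtain z where z: "0 < z" "z < min \<delta> r" "- g z > - g 0 + - p * z"
          using not_touch_aboveD[OF p(1)] by blast
        then have "f z < f 0 + p * z" using max0[of z] by simp
        then show "\<exists>z. 0 < z \<and> z < \<delta> \<and> f z < f 0 + p * z" using z by auto
      qed
    qed
    have ex: "\<exists>t. touch_below t"
    proof (rule ccontr)
      assume n: "\<not> ?thesis"
      define p where "p = - \<bar>b\<bar> - \<bar>(c - lam * f 0) / k\<bar> - 1"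
      have "p \<le> b" unfolding p_def by linarith
      then have "D p \<le> 0" using nt[of p] n by blast
      then have "\<bar>p\<bar> \<le> (c - lam * f 0) / k" by (rule Dcoer)
      moreover have "\<bar>w\<bar> < \<bar>- \<bar>b\<bar> - \<bar>w\<bar> - 1\<bar>" for w by linarith
      ultimately show False unfolding p_def by (meson abs_ge_self not_less order.trans)
    qed
    have "\<not> touch_above (\<lambda>x. - g x) (- (b + 1))" using le[of "b + 1"] by auto
    with ex obtain Q' where Q': "upper_slope (\<lambda>x. - g x) Q'" using upper_slopeI by blast
    define Q where "Q = - Q'"
    have Q: "upper_slope (\<lambda>x. - g x) (- Q)" using Q' by (simp add: Q_def)
    have Qb: "Q \<le> b"
    proof (rule field_le_epsilon)
      fix e :: real assume "e > 0"
      then have "touch_below (Q - e)" using Q unfolding upper_slope_def by simp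
      then show "Q \<le> b + e" using le by fastforce
    qed
    have "D Q \<le> 0"
    proof (cases "Q = b")
      case True then show ?thesis using Db by simp
    next
      case False
      show ?thesis
      proof (rule Dlim)
        fix \<delta> :: real assume \<delta>: "\<delta> > 0"
        define p where "p = min b (Q + \<delta> / 2)"
        have p: "Q < p" "p \<le> b" "\<bar>Q - p\<bar> < \<delta>" using False Qb \<delta> by (auto simp: p_def min_def)
        have "\<not> touch_below p" using Q p unfolding upper_slope_def by simp
        then show "\<exists>y. \<bar>Q - y\<bar> < \<delta> \<and> D y \<le> 0" using nt p by blast
      qed
    qed
    moreover have "lam * (- g 0) + - h 0 (- (- Q)) \<le> 0" by (rule G.critical_slope[OF \<sigma>0 Q])
    ultimately show ?thesis using m by (simp add: D_def m_def algebra_simps)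
  qed
qed

text \<open>
  This is Hopf's lemma for \<open>f - g\<close>. If the slopes of \<open>f\<close> and \<open>g\<close> at \<open>0\<close> were equal, the second order
  expansions would give \<open>f - g\<close> a second derivative of at least \<open>d / 2 > 0\<close> at its maximum, since the
  equation separates the second derivatives by \<open>d = lam * (f 0 - g 0) / (\<sigma> 0)\<^sup>2\<close>.
\<close>

lemma elliptic_gap:
  assumes \<sigma>0: "\<sigma> 0 \<noteq> 0" and P: "upper_slope f P"
  shows "\<exists>t>P. touch_below t"
proof (rule ccontr)
  assume n: "\<not> ?thesis"
  have Q: "upper_slope (\<lambda>x. - g x) (- P)"
    unfolding upper_slope_def
  proof (intro conjI allI impI)
    fix s assume "s > - P"
    then obtain \<rho> where \<rho>: "\<rho> > 0" "\<rho> \<le> r" "\<And>z. 0 < z \<Longrightarrow> z \<le> \<rho> \<Longrightarrow> f 0 + (P - (s + P)) * z \<le> f z"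
      using F.lower_slope[OF \<sigma>0 P, of "s + P"] by auto
    show "touch_above (\<lambda>x. - g x) s"
    proof (rule touch_aboveI[OF \<rho>(1)])
      fix z assume z: "0 < z" "z < \<rho>"
      then show "- g z \<le> - g 0 + s * z" using \<rho>(3)[of z] \<rho>(2) max0[of z] by simp
    qed
  next
    fix s assume "s < - P"
    then show "\<not> touch_above (\<lambda>x. - g x) s" using n by (metis minus_minus neg_less_iff_less)
  qed
  define d where "d = lam * (f 0 - g 0) / (\<sigma> 0)\<^sup>2"
  have d: "d > 0" using \<sigma>0 gap F.lam_pos by (simp add: d_def)
  define X where "X = (lam * f 0 + h 0 P) / (\<sigma> 0)\<^sup>2 - d / 4"
  define Y where "Y = (lam * - g 0 + - h 0 (- (- P))) / (\<sigma> 0)\<^sup>2 - d / 4"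
  have XY: "X + Y = d / 2"
    unfolding X_def Y_def d_def using \<sigma>0 by (simp add: field_simps)
  obtain \<rho> where \<rho>: "\<rho> > 0" "\<rho> \<le> r" "\<And>z. 0 < z \<Longrightarrow> z \<le> \<rho> \<Longrightarrow> f 0 + P * z + X / 2 * z\<^sup>2 \<le> f z"
    using F.second_order_expansion[OF \<sigma>0 P, of "d / 4"] d unfolding X_def by auto
  obtain \<rho>' where \<rho>': "\<rho>' > 0" "\<rho>' \<le> r" "\<And>z. 0 < z \<Longrightarrow> z \<le> \<rho>' \<Longrightarrow> - g 0 + - P * z + Y / 2 * z\<^sup>2 \<le> - g z"
    using G.second_order_expansion[OF \<sigma>0 Q, of "d / 4"] d unfolding Y_def by auto
  define z where "z = min \<rho> \<rho>'"
  have z: "0 < z" "z \<le> \<rho>" "z \<le> \<rho>'" using \<rho> \<rho>' by (auto simp: z_def)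
  have "f 0 - g 0 + (X + Y) / 2 * z\<^sup>2 \<le> f z - g z"
    using \<rho>(3)[OF z(1,2)] \<rho>'(3)[OF z(1,3)] by (simp add: field_simps)
  also have "\<dots> \<le> f 0 - g 0" using max0[of z] z \<rho> by simp
  finally show False using XY d z by (simp add: mult_le_0_iff)
qed

lemma edge_gap:
  assumes coer: "\<sigma> 0 = 0 \<Longrightarrow> \<exists>k>0. \<exists>c. \<forall>p. k * \<bar>p\<bar> - c \<le> h 0 p"
    and P: "upper_slope f P"
  shows "\<exists>s t X Y. s < t \<and>
    jet_above f s X \<and> 0 < lam * f 0 - (\<sigma> 0)\<^sup>2 * X + h 0 s \<and>
    jet_above (\<lambda>x. - g x) (- t) (- Y) \<and> lam * g 0 - (\<sigma> 0)\<^sup>2 * Y + h 0 t < 0"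
proof -
  have jetf: "jet_above f s X" if "P < s" for s X
  proof -
    have "touch_above f ((P + s) / 2)" using P that unfolding upper_slope_def by simp
    then show ?thesis by (rule jet_above_of_touch) (use that in simp)
  qed
  have jetg: "jet_above (\<lambda>x. - g x) (- t) (- Y)" if "touch_below t'" "t < t'" for t t' Y
    by (rule jet_above_of_touch[OF that(1)]) (use that in simp)
  show ?thesis
  proof (cases "\<sigma> 0 = 0")
    case True
    then obtain k c where "k > 0" "\<And>p. k * \<bar>p\<bar> - c \<le> h 0 p" using coer by blast
    from degenerate_gap[OF True this P] obtain s t t' where
      *: "P < s" "s < t" "t < t'" "0 < lam * f 0 + h 0 s" "touch_below t'" "lam * g 0 + h 0 t < 0" by blast
    show ?thesis
      by (intro exI[of _ s] exI[of _ t] exI[of _ 0]) (use * jetf jetg[of t' t 0] True in auto)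
  next
    case False
    obtain t' where t': "P < t'" "touch_below t'" using elliptic_gap[OF False P] by blast
    define s where "s = P + (t' - P) / 3"
    define t where "t = P + (t' - P) / 2"
    have "t' - P > 0" using t' by simp
    then have "P < s" "s < t" by (simp_all add: s_def t_def)
    moreover have "t < t'"
      using t'(1) by (simp add: t_def field_simps)
    ultimately have st: "P < s" "s < t" "t < t'" by blast+
    define X where "X = - (\<bar>lam * f 0 + h 0 s\<bar> + 1) / (\<sigma> 0)\<^sup>2"
    define Y where "Y = (\<bar>lam * g 0 + h 0 t\<bar> + 1) / (\<sigma> 0)\<^sup>2"
    have "(\<sigma> 0)\<^sup>2 * X = - (\<bar>lam * f 0 + h 0 s\<bar> + 1)" "(\<sigma> 0)\<^sup>2 * Y = \<bar>lam * g 0 + h 0 t\<bar> + 1"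
      using False by (auto simp: X_def Y_def)
    then show ?thesis
      by (intro exI[of _ s] exI[of _ t] exI[of _ X] exI[of _ Y])
        (use st jetf jetg[OF t'(2)] in \<open>auto simp: abs_if\<close>)
  qed
qed

end

context hj_sub
begin

text \<open>
  The barrier \<open>- K z - \<delta> ln z\<close> is infinite at \<open>0\<close> and keeps the maximum away from \<open>0\<close>. Its slope
  \<open>K + \<delta> / z\<close> is controlled by coercivity, and its second derivative \<open>\<delta> / z\<^sup>2\<close> is neutralized by
  \<open>(\<sigma> z)\<^sup>2 \<le> C\<^sup>2 z\<^sup>2\<close>. Letting \<open>\<delta>\<close> tend to \<open>0\<close> shows \<open>f z + K z \<le> f y + K y\<close> for points
  \<open>z < y\<close> with \<open>f z\<close> close to \<open>f 0\<close>, and such \<open>z\<close> accumulate at \<open>0\<close> because \<open>f 0\<close> is the limit superior.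
\<close>

lemma slope_bound_of_limsup:
  assumes \<sigma>0: "\<sigma> 0 = 0"
    and coer: "\<rho> > 0" "k > 0" "\<And>x p. 0 \<le> x \<Longrightarrow> x \<le> \<rho> \<Longrightarrow> k * \<bar>p\<bar> - c \<le> h x p"
    and limsup: "\<And>\<epsilon> \<delta>. \<epsilon> > 0 \<Longrightarrow> \<delta> > 0 \<Longrightarrow> \<exists>z. 0 < z \<and> z < \<delta> \<and> f 0 - \<epsilon> < f z"
  shows "\<exists>s. \<not> touch_above f s"
proof -
  obtain A where A: "\<And>x. 0 \<le> x \<Longrightarrow> x \<le> r \<Longrightarrow> f x \<le> A" using bounded_above by blast
  define K where "K = max 1 ((c + 2 - lam * (f 0 - 3)) / k)"
  have K: "K \<ge> 1" "c + 2 - lam * (f 0 - 3) \<le> k * K"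
  proof -
    show "K \<ge> 1" by (simp add: K_def)
    have "(c + 2 - lam * (f 0 - 3)) / k \<le> K" by (simp add: K_def)
    then show "c + 2 - lam * (f 0 - 3) \<le> k * K" using coer(2) by (simp add: field_simps)
  qed
  define d where "d = min (min \<rho> r) (1 / K)"
  have d: "d > 0" "d \<le> \<rho>" "d \<le> r" "K * d \<le> 1"
  proof -
    show "d > 0" "d \<le> \<rho>" "d \<le> r" using coer r_pos K by (auto simp: d_def)
    have "d \<le> 1 / K" by (simp add: d_def)
    then show "K * d \<le> 1" using K(1) by (simp add: field_simps)
  qed
  have main: "f 0 \<le> f y + K * y" if y: "0 < y" "y < d" for y
  proof (rule ccontr)
    assume "\<not> ?thesis"
    define e where "e = min 1 (f 0 - (f y + K * y))"
    have e: "e > 0" using \<open>\<not> _\<close> by (simp add: e_def)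
    obtain z where z: "0 < z" "z < y" "f 0 - e / 2 < f z" using limsup[of "e / 2" y] e y by auto
    \<comment> \<open>The weight of the logarithm is so small that \<open>z\<close> still beats \<open>y\<close>, and that the second order term is at most \<open>1\<close>.\<close>
    define \<delta> where "\<delta> = min (e / (2 * (ln y - ln z) + 1)) (1 / (4 * C\<^sup>2))"
    have L: "ln y - ln z > 0" using z by simp
    have \<delta>: "\<delta> > 0" "\<delta> * (ln y - ln z) < e / 2" "4 * C\<^sup>2 * \<delta> \<le> 1"
    proof -
      show "\<delta> > 0" using e L C_pos by (simp add: \<delta>_def)
      have "\<delta> \<le> e / (2 * (ln y - ln z) + 1)" by (simp add: \<delta>_def)
      then have "\<delta> * (2 * (ln y - ln z) + 1) \<le> e" using L by (simp add: field_simps)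
      then show "\<delta> * (ln y - ln z) < e / 2" using \<open>\<delta> > 0\<close> by (simp add: algebra_simps)
      have "\<delta> \<le> 1 / (4 * C\<^sup>2)" by (simp add: \<delta>_def)
      then show "4 * C\<^sup>2 * \<delta> \<le> 1" using C_pos by (simp add: field_simps)
    qed
    define \<kappa> where "\<kappa> x = f x + (K * x + \<delta> * ln x)" for x
    define a where "a = min (z / 2) (exp ((\<kappa> z - A - K * r - 1) / \<delta>))"
    have a: "0 < a" "a < z" using z by (auto simp: a_def)
    have "ln a \<le> ln (exp ((\<kappa> z - A - K * r - 1) / \<delta>))"
      using a by (subst ln_le_cancel_iff) (auto simp: a_def)
    then have "ln a \<le> (\<kappa> z - A - K * r - 1) / \<delta>" by simp
    then have "\<delta> * ln a \<le> \<kappa> z - A - K * r - 1" using \<delta> by (simp add: field_simps)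
    moreover have "K * a \<le> K * r" using a z y d K by simp
    ultimately have \<kappa>a: "\<kappa> a < \<kappa> z" using A[of a] a z y d by (simp add: \<kappa>_def)
    have Kz: "0 \<le> K * z" using K z by simp
    have "f y + K * y \<le> f 0 - e" by (simp add: e_def)
    then have \<kappa>y: "\<kappa> y < \<kappa> z"
      using z(3) \<delta>(2) Kz right_diff_distrib[of \<delta> "ln y" "ln z"] unfolding \<kappa>_def by linarith
    have "usc_on {a..y} \<kappa>"
      unfolding \<kappa>_def using a y d
      by (intro usc_on_add_continuous usc_on_subset[OF usc] continuous_intros) auto
    then obtain x where x: "x \<in> {a..y}" "\<And>t. t \<in> {a..y} \<Longrightarrow> \<kappa> t \<le> \<kappa> x"
      using usc_on_attains_max[of a y \<kappa>] a z by auto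
    have \<kappa>x: "\<kappa> z \<le> \<kappa> x" using x(2)[of z] a z by simp
    then have "x \<noteq> a" "x \<noteq> y" using \<kappa>a \<kappa>y by auto
    then have xin: "a < x" "x < y" using x(1) by auto
    have x0: "x > 0" using xin a by simp
    define q where "q = - (K + \<delta> / x)"
    define X where "X = 4 * \<delta> / x\<^sup>2"
    have "\<forall>\<^sub>F t in at x. t \<in> {max a (x / 2)<..<min y (3 * x / 2)}"
      using xin x0 by (intro eventually_at_in_open') auto
    then have "\<forall>\<^sub>F t in at x. f t \<le> f x + q * (t - x) + X / 2 * (t - x)\<^sup>2"
    proof eventually_elim
      case (elim t)
      define s where "s = (t - x) / x"
      have t: "t = x * (1 + s)" using x0 by (simp add: s_def field_simps)
      have "x / 2 < t" "t < 3 * x / 2" using elim by auto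
      then have "\<bar>t - x\<bar> \<le> x / 2" by linarith
      then have s: "\<bar>s\<bar> \<le> 1 / 2" using x0 by (simp add: s_def abs_divide field_simps)
      \<comment> \<open>The second order bound for \<open>ln\<close> replaces the barrier by a quadratic test function with \<open>X = 4 \<delta> / x\<^sup>2\<close>.\<close>
      have "\<bar>ln (1 + s) - s\<bar> \<le> 2 * s\<^sup>2" by (rule abs_ln_one_plus_x_minus_x_bound[OF s])
      moreover have "1 + s > 0" using s by linarith
      then have "ln t = ln x + ln (1 + s)" using t x0 by (simp add: ln_mult)
      ultimately have l: "ln t \<ge> ln x + s - 2 * s\<^sup>2" by linarith
      have "f t \<le> f x + K * (x - t) + \<delta> * (ln x - ln t)"
        using x(2)[of t] elim by (simp add: \<kappa>_def algebra_simps)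
      also have "\<delta> * (ln x - ln t) \<le> \<delta> * (2 * s\<^sup>2 - s)"
        using l \<delta> by (intro mult_left_mono) auto
      finally have "f t \<le> f x + K * (x - t) + \<delta> * (2 * s\<^sup>2 - s)" by simp
      also have "\<dots> = f x + q * (t - x) + X / 2 * (t - x)\<^sup>2"
        using x0 by (simp add: q_def X_def s_def power_divide field_simps)
      finally show ?case .
    qed
    then have ineq: "lam * f x - (\<sigma> x)\<^sup>2 * X + h x q \<le> 0"
      using sub xin a y d unfolding visc_sub_on_def by auto
    have "\<bar>\<sigma> x\<bar> \<le> C * x" using \<sigma>_lip[of x 0] \<sigma>0 x0 xin y d by simp
    then have "\<bar>\<sigma> x\<bar>\<^sup>2 \<le> (C * x)\<^sup>2" by (intro power_mono) auto
    then have "(\<sigma> x)\<^sup>2 * X \<le> (C * x)\<^sup>2 * X" using \<delta> by (intro mult_right_mono) (auto simp: X_def)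
    also have "\<dots> = 4 * C\<^sup>2 * \<delta>" using x0 by (simp add: X_def power_mult_distrib)
    also have "\<dots> \<le> 1" by (rule \<delta>)
    finally have s1: "(\<sigma> x)\<^sup>2 * X \<le> 1" .
    have "K + \<delta> / x \<ge> K" using \<delta> x0 by simp
    then have "k * K \<le> k * \<bar>q\<bar>" using coer(2) K by (simp add: q_def)
    then have h1: "k * K - c \<le> h x q" using coer(3)[of x q] x0 xin y d by simp
    have "K * x \<le> K * d" using xin y K by simp
    then have Kx: "K * x \<le> 1" using d by simp
    have "\<delta> * ln x \<le> \<delta> * ln y" using \<delta> xin x0 by simp
    then have "f z - 1 - e / 2 \<le> f x"
      using \<kappa>x Kx \<delta>(2) Kz right_diff_distrib[of \<delta> "ln y" "ln z"] unfolding \<kappa>_def by linarith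
    moreover have "e \<le> 1" by (simp add: e_def)
    ultimately have "f 0 - 3 \<le> f x" using z by simp
    then have "lam * (f 0 - 3) \<le> lam * f x" using lam_pos by simp
    then show False using ineq s1 h1 K by linarith
  qed
  have "\<not> touch_above f (- K - 1)"
  proof
    assume "touch_above f (- K - 1)"
    then obtain \<delta> where \<delta>: "\<delta> > 0" "\<And>z. 0 < z \<Longrightarrow> z < \<delta> \<Longrightarrow> f z \<le> f 0 + (- K - 1) * z"
      using touch_aboveD by blast
    define z where "z = min \<delta> d / 2"
    have z: "0 < z" "z < \<delta>" "z < d" using \<delta> d by (auto simp: z_def)
    show False using \<delta>(2)[of z] main[of z] z by (simp add: algebra_simps)
  qed
  then show ?thesis by blast
qed

end

section \<open>Translation and reflection of the variable\<close>

lemma visc_sub_on_affine: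
  assumes f: "visc_sub_on lam \<sigma> h f S" and e: "e = 1 \<or> e = - 1"
    and T: "\<And>z. z \<in> T \<Longrightarrow> b + e * z \<in> S"
  shows "visc_sub_on lam (\<lambda>z. \<sigma> (b + e * z)) (\<lambda>z p. h (b + e * z) (e * p)) (\<lambda>z. f (b + e * z)) T"
  unfolding visc_sub_on_def
proof (intro ballI allI impI)
  fix x p X
  assume x: "x \<in> T"
    and ev: "\<forall>\<^sub>F y in at x. f (b + e * y) \<le> f (b + e * x) + p * (y - x) + X / 2 * (y - x)\<^sup>2"
  have ee: "e * e = 1" using e by auto
  then have ee': "e * (e * w) = w" for w by (simp add: mult.assoc[symmetric])
  have ae: "\<bar>e\<bar> = 1" using e by auto
  obtain d where d: "d > 0" "\<And>y. y \<noteq> x \<Longrightarrow> \<bar>y - x\<bar> < d \<Longrightarrow>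
    f (b + e * y) \<le> f (b + e * x) + p * (y - x) + X / 2 * (y - x)\<^sup>2"
    using ev unfolding eventually_at dist_real_def by auto
  have "\<forall>\<^sub>F y in at (b + e * x). f y \<le> f (b + e * x) + (e * p) * (y - (b + e * x)) + X / 2 * (y - (b + e * x))\<^sup>2"
    unfolding eventually_at dist_real_def
  proof (intro exI conjI ballI impI)
    fix y assume y: "y \<noteq> b + e * x \<and> \<bar>y - (b + e * x)\<bar> < d"
    define z where "z = e * (y - b)"
    have yz: "y = b + e * z" by (simp add: z_def ee')
    have diff: "y - (b + e * x) = e * (z - x)" by (simp add: yz algebra_simps)
    have "\<bar>z - x\<bar> < d" using y diff ae by (simp add: abs_mult)
    moreover have "z \<noteq> x" using y yz by auto
    ultimately have "f y \<le> f (b + e * x) + p * (z - x) + X / 2 * (z - x)\<^sup>2" using d(2) yz by simp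
    moreover have "e * p * (e * (z - x)) = p * (z - x)"
      using ee by (metis mult.assoc mult.commute mult.left_neutral)
    moreover have "(e * (z - x))\<^sup>2 = (z - x)\<^sup>2" using e by (auto simp: power2_commute)
    ultimately show "f y \<le> f (b + e * x) + (e * p) * (y - (b + e * x)) + X / 2 * (y - (b + e * x))\<^sup>2"
      by (simp only: diff)
  qed (use d in auto)
  then show "lam * f (b + e * x) - (\<sigma> (b + e * x))\<^sup>2 * X + h (b + e * x) (e * p) \<le> 0"
    using f T[OF x] unfolding visc_sub_on_def by blast
qed

lemma usc_on_affine:
  assumes f: "usc_on S f" and e: "e = 1 \<or> e = - 1"
    and T: "\<And>z. z \<in> T \<Longrightarrow> b + e * z \<in> S"
  shows "usc_on T (\<lambda>z. f (b + e * z :: real))"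
  unfolding usc_on_iff
proof (intro ballI allI impI)
  fix t c assume t: "t \<in> T" "f (b + e * t) < c"
  then obtain d where d: "d > 0" "\<And>s. s \<in> S \<Longrightarrow> \<bar>s - (b + e * t)\<bar> < d \<Longrightarrow> f s < c"
    using f T unfolding usc_on_iff by meson
  have "\<bar>(b + e * s) - (b + e * t)\<bar> = \<bar>s - t\<bar>" for s using e by auto
  then show "\<exists>d>0. \<forall>s\<in>T. \<bar>s - t\<bar> < d \<longrightarrow> f (b + e * s) < c"
    using d T by metis
qed

lemma lipschitz_coeffs_affine:
  assumes "lipschitz_coeffs C \<sigma> h S" and e: "e = 1 \<or> e = - 1"
    and T: "\<And>z. z \<in> T \<Longrightarrow> b + e * z \<in> S"
  shows "lipschitz_coeffs C (\<lambda>z. \<sigma> (b + e * z)) (\<lambda>z p. h (b + e * z) (e * p)) T"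
proof -
  have e': "\<bar>(b + e * s) - (b + e * t)\<bar> = \<bar>s - t\<bar>" "\<bar>e * s - e * t\<bar> = \<bar>s - t\<bar>" "\<bar>e * s\<bar> = \<bar>s\<bar>"
    for s t using e by auto
  have a: "C > 0" "\<And>x y. x \<in> S \<Longrightarrow> y \<in> S \<Longrightarrow> \<bar>\<sigma> x - \<sigma> y\<bar> \<le> C * \<bar>x - y\<bar>"
    "\<And>x y p. x \<in> S \<Longrightarrow> y \<in> S \<Longrightarrow> \<bar>h x p - h y p\<bar> \<le> C * (1 + \<bar>p\<bar>) * \<bar>x - y\<bar>"
    "\<And>x p q. x \<in> S \<Longrightarrow> \<bar>h x p - h x q\<bar> \<le> C * \<bar>p - q\<bar>"
    using assms(1) unfolding lipschitz_coeffs_def by blast+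
  show ?thesis
    unfolding lipschitz_coeffs_def
  proof (intro conjI ballI allI)
    fix x y p q assume xy: "x \<in> T"
    show "\<bar>h (b + e * x) (e * p) - h (b + e * x) (e * q)\<bar> \<le> C * \<bar>p - q\<bar>"
      using a(4)[OF T[OF xy], of "e * p" "e * q"] by (simp only: e')
    assume y: "y \<in> T"
    show "\<bar>\<sigma> (b + e * x) - \<sigma> (b + e * y)\<bar> \<le> C * \<bar>x - y\<bar>"
      using a(2)[OF T[OF xy] T[OF y]] by (simp only: e')
    show "\<bar>h (b + e * x) (e * p) - h (b + e * y) (e * p)\<bar> \<le> C * (1 + \<bar>p\<bar>) * \<bar>x - y\<bar>"
      using a(3)[OF T[OF xy] T[OF y], of "e * p"] by (simp only: e')
  qed (rule a(1))
qed

lemma hj_sub_shift: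
  assumes "hj_sub lam C \<sigma> h r f" "0 \<le> b" "b < r"
  shows "hj_sub lam C (\<lambda>z. \<sigma> (b + z)) (\<lambda>z. h (b + z)) (r - b) (\<lambda>z. f (b + z))"
proof -
  interpret hj_sub lam C \<sigma> h r f by fact
  show ?thesis
    using assms lam_pos lipschitz_coeffs_affine[OF coeffs, of 1 "{0..r - b}" b]
      usc_on_affine[OF usc, of 1 "{0..r - b}" b] visc_sub_on_affine[OF sub, of 1 "{0<..<r - b}" b]
    by unfold_locales auto
qed

lemma hj_sub_reflect:
  assumes "hj_sub lam C \<sigma> h r f"
  shows "hj_sub lam C (\<lambda>z. \<sigma> (r - z)) (\<lambda>z p. h (r - z) (- p)) r (\<lambda>z. f (r - z))"
proof -
  interpret hj_sub lam C \<sigma> h r f by fact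
  show ?thesis
    using lam_pos r_pos lipschitz_coeffs_affine[OF coeffs, of "- 1" "{0..r}" r]
      usc_on_affine[OF usc, of "- 1" "{0..r}" r] visc_sub_on_affine[OF sub, of "- 1" "{0<..<r}" r]
    by unfold_locales auto
qed

section \<open>Maxima inside an edge\<close>

context hj_sub
begin

text \<open>
  A kink is impossible: if the slope to the right were smaller than \<open>p\<close>, a line of intermediate slope
  \<open>q\<close> would leave room on both sides for an arbitrarily concave quadratic touching \<open>f\<close> from above at \<open>x\<close>,
  and ellipticity contradicts the equation.
\<close>

lemma interior_upper_slope:
  assumes x: "0 < x" "x < r" and ell: "\<sigma> x \<noteq> 0"
    and touch: "\<And>z. 0 \<le> z \<Longrightarrow> z \<le> r \<Longrightarrow> f z \<le> f x + p * (z - x) + X / 2 * (z - x)\<^sup>2"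
  shows "upper_slope (\<lambda>z. f (x + z)) p"
  unfolding upper_slope_def
proof (intro conjI allI impI)
  fix s assume "s > p"
  then show "touch_above (\<lambda>z. f (x + z)) s"
  proof (rule touch_above_quadratic)
    show "r - x > 0" using x by simp
    fix z assume "0 < z" "z < r - x"
    then have "0 \<le> x + z" "x + z \<le> r" using x by linarith+
    from touch[OF this] show "f (x + z) \<le> f (x + 0) + p * z + X / 2 * z\<^sup>2" by simp
  qed
next
  fix s assume s: "s < p"
  show "\<not> touch_above (\<lambda>z. f (x + z)) s"
  proof
    assume "touch_above (\<lambda>z. f (x + z)) s"
    then obtain \<delta> where \<delta>: "\<delta> > 0" "\<And>z. 0 < z \<Longrightarrow> z < \<delta> \<Longrightarrow> f (x + z) \<le> f x + s * z"
      using touch_aboveD[of "\<lambda>z. f (x + z)" s] by (metis add.right_neutral)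
    define q where "q = (s + p) / 2"
    have q: "s < q" "q < p" using s by (auto simp: q_def field_simps)
    have "lam * f x - (\<sigma> x)\<^sup>2 * Y + h x q \<le> 0" for Y
    proof -
      define e where "e = min (min \<delta> (min x (r - x))) (min ((q - s) / (\<bar>Y\<bar> + 1)) ((p - q) / (\<bar>X\<bar> + \<bar>Y\<bar> + 1)))"
      have e: "e > 0" using \<delta> x q by (auto simp: e_def intro!: divide_pos_pos add_nonneg_pos)
      have "\<forall>\<^sub>F y in at x. f y \<le> f x + q * (y - x) + Y / 2 * (y - x)\<^sup>2"
        unfolding eventually_at dist_real_def
      proof (intro exI conjI ballI impI)
        fix y assume y: "y \<noteq> x \<and> \<bar>y - x\<bar> < e"
        have d0: "\<bar>y - x\<bar> < \<delta>" "\<bar>y - x\<bar> < x" "\<bar>y - x\<bar> < r - x"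
          "\<bar>y - x\<bar> < (q - s) / (\<bar>Y\<bar> + 1)" "\<bar>y - x\<bar> < (p - q) / (\<bar>X\<bar> + \<bar>Y\<bar> + 1)"
          using y by (auto simp: e_def)
        have d1: "\<bar>y - x\<bar> * (\<bar>Y\<bar> + 1) < q - s" "\<bar>y - x\<bar> * (\<bar>X\<bar> + \<bar>Y\<bar> + 1) < p - q"
          using d0(4,5) by (simp_all add: pos_less_divide_eq add_nonneg_pos)
        consider "y > x" | "y < x" using y by linarith
        then show "f y \<le> f x + q * (y - x) + Y / 2 * (y - x)\<^sup>2"
        proof cases
          case 1
          define z where "z = y - x"
          have z: "z > 0" "z < \<delta>" "z * (\<bar>Y\<bar> + 1) < q - s" using 1 d0 d1 by (auto simp: z_def)
          have "f y \<le> f x + s * z" using \<delta>(2)[OF z(1,2)] by (simp add: z_def)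
          moreover have "z * (- Y / 2) \<le> z * (\<bar>Y\<bar> + 1)" using z by (intro mult_left_mono) auto
          then have "z * (z * (- Y / 2)) \<le> z * (q - s)" using z by (intro mult_left_mono) auto
          ultimately have "f y \<le> f x + q * z + Y / 2 * z\<^sup>2"
            by (simp add: power2_eq_square algebra_simps)
          then show ?thesis by (simp add: z_def)
        next
          case 2
          define z where "z = x - y"
          have z: "z > 0" "z < x" "z * (\<bar>X\<bar> + \<bar>Y\<bar> + 1) < p - q" using 2 d0 d1 by (auto simp: z_def)
          have "f y \<le> f x + p * (y - x) + X / 2 * (y - x)\<^sup>2"
            using touch[of y] z x by (simp add: z_def)
          then have "f y \<le> f x - p * z + X / 2 * z\<^sup>2"
            by (simp add: z_def power2_commute algebra_simps)
          moreover have "z * ((X - Y) / 2) \<le> z * (\<bar>X\<bar> + \<bar>Y\<bar> + 1)" using z(1) by (intro mult_left_mono) auto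
          then have "z * ((X - Y) / 2) \<le> p - q" using z(3) by (rule order.trans[OF _ less_imp_le])
          then have "z * (z * ((X - Y) / 2)) \<le> z * (p - q)" using z by (intro mult_left_mono) auto
          ultimately have "f y \<le> f x - q * z + Y / 2 * z\<^sup>2"
            by (simp add: power2_eq_square field_simps)
          then show ?thesis by (simp add: z_def power2_commute algebra_simps)
        qed
      qed (use e in auto)
      then show ?thesis using sub x unfolding visc_sub_on_def by auto
    qed
    from this[of "- (\<bar>lam * f x + h x q\<bar> + 1) / (\<sigma> x)\<^sup>2"] show False using ell by (simp add: abs_if split: if_splits)
  qed
qed

lemma interior_expansion:
  assumes x: "0 < x" "x < r" and ell: "\<sigma> x \<noteq> 0"
    and touch: "\<And>z. 0 \<le> z \<Longrightarrow> z \<le> r \<Longrightarrow> f z \<le> f x + p * (z - x) + X / 2 * (z - x)\<^sup>2"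
    and \<eta>: "\<eta> > 0"
  shows "\<exists>\<rho>>0. \<forall>z. 0 < z \<longrightarrow> z \<le> \<rho> \<longrightarrow>
    f x + p * z + ((lam * f x + h x p) / (\<sigma> x)\<^sup>2 - \<eta>) / 2 * z\<^sup>2 \<le> f (x + z)"
proof -
  interpret S: hj_sub lam C "\<lambda>z. \<sigma> (x + z)" "\<lambda>z. h (x + z)" "r - x" "\<lambda>z. f (x + z)"
    using hj_sub_shift[OF hj_sub_axioms] x by simp
  have "upper_slope (\<lambda>z. f (x + z)) p"
    by (rule interior_upper_slope[OF x ell touch])
  from S.second_order_expansion[OF _ this \<eta>] ell show ?thesis by auto
qed

lemma interior_touch:
  assumes x: "0 < x" "x < r"
    and touch: "\<And>z. 0 \<le> z \<Longrightarrow> z \<le> r \<Longrightarrow> f z \<le> f x + p * (z - x) + X / 2 * (z - x)\<^sup>2"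
  shows "lam * f x - (\<sigma> x)\<^sup>2 * X + h x p \<le> 0"
proof -
  have "\<forall>\<^sub>F z in at x. z \<in> {0<..<r}"
    using x by (intro eventually_at_in_open') auto
  then have "\<forall>\<^sub>F z in at x. f z \<le> f x + p * (z - x) + X / 2 * (z - x)\<^sup>2"
    by eventually_elim (use touch in auto)
  then show ?thesis using sub x unfolding visc_sub_on_def by auto
qed

end

context hj_sub_super
begin

text \<open>
  In the classical proof the left side is bounded by applying the matrix inequality of the theorem on sums to the vector
  \<open>(\<sigma> x, \<sigma> y)\<close>. Here the one-sided expansions of \<open>f\<close> at \<open>x\<close> and of \<open>g\<close> at \<open>y\<close> are inserted into the
  maximality at the points \<open>(x + \<bar>\<sigma> x\<bar> z, y + \<bar>\<sigma> y\<bar> z)\<close>. The terms of first order in \<open>z\<close> cancel, and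
  those of second order are the claim. Absolute values are harmless, because
  \<open>(\<bar>\<sigma> x\<bar> - \<bar>\<sigma> y\<bar>)\<^sup>2 \<le> (\<sigma> x - \<sigma> y)\<^sup>2\<close>. The term with \<open>\<kappa>\<close> localizes the maximum.
\<close>

lemma doubled_inequality:
  assumes x: "0 < x" "x < r" and y: "0 < y" "y < r" and \<epsilon>: "\<epsilon> > 0" and \<kappa>: "\<kappa> \<ge> 0"
    and max: "\<And>x' y'. \<lbrakk>0 \<le> x'; x' \<le> r; 0 \<le> y'; y' \<le> r\<rbrakk> \<Longrightarrow>
      f x' - g y' - (x' - y')\<^sup>2 / (2 * \<epsilon>) - \<kappa> * (x' - x0)\<^sup>2 \<le>
      f x - g y - (x - y)\<^sup>2 / (2 * \<epsilon>) - \<kappa> * (x - x0)\<^sup>2"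
  defines "p \<equiv> (x - y) / \<epsilon>"
  defines "p1 \<equiv> p + 2 * \<kappa> * (x - x0)"
  shows "lam * f x + h x p1 - (lam * g y + h y p) \<le> (\<sigma> x - \<sigma> y)\<^sup>2 / \<epsilon> + 2 * \<kappa> * (\<sigma> x)\<^sup>2"
proof -
  define X1 where "X1 = 1 / \<epsilon> + 2 * \<kappa>"
  have sq: "(a + b)\<^sup>2 / (2 * \<epsilon>) - a\<^sup>2 / (2 * \<epsilon>) = a / \<epsilon> * b + 1 / \<epsilon> / 2 * b\<^sup>2" for a b :: real
    using \<epsilon> by (simp add: power2_eq_square field_simps)
  have fx: "f z \<le> f x + p1 * (z - x) + X1 / 2 * (z - x)\<^sup>2" if "0 \<le> z" "z \<le> r" for z
  proof -
    have "f z \<le> f x + ((x - y + (z - x))\<^sup>2 / (2 * \<epsilon>) - (x - y)\<^sup>2 / (2 * \<epsilon>))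
        + \<kappa> * ((z - x0)\<^sup>2 - (x - x0)\<^sup>2)"
      using max[of z y] that y by (simp add: algebra_simps)
    also have "\<dots> = f x + (p * (z - x) + 1 / \<epsilon> / 2 * (z - x)\<^sup>2) + \<kappa> * ((z - x0)\<^sup>2 - (x - x0)\<^sup>2)"
      unfolding sq p_def ..
    also have "\<dots> = f x + p1 * (z - x) + X1 / 2 * (z - x)\<^sup>2"
      by (simp add: p1_def X1_def power2_eq_square algebra_simps add_divide_distrib)
    finally show ?thesis .
  qed
  have gy: "- g z \<le> - g y + - p * (z - y) + (1 / \<epsilon>) / 2 * (z - y)\<^sup>2" if "0 \<le> z" "z \<le> r" for z
  proof -
    have "- g z \<le> - g y + ((x - y + (y - z))\<^sup>2 / (2 * \<epsilon>) - (x - y)\<^sup>2 / (2 * \<epsilon>))"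
      using max[of x z] that x by (simp add: algebra_simps)
    also have "\<dots> = - g y + (p * (y - z) + 1 / \<epsilon> / 2 * (y - z)\<^sup>2)"
      unfolding sq p_def ..
    also have "\<dots> = - g y + - p * (z - y) + (1 / \<epsilon>) / 2 * (z - y)\<^sup>2"
      by (simp add: power2_commute algebra_simps)
    finally show ?thesis .
  qed
  have F1: "lam * f x - (\<sigma> x)\<^sup>2 * X1 + h x p1 \<le> 0" by (rule F.interior_touch[OF x fx])
  have G1: "lam * - g y - (\<sigma> y)\<^sup>2 * (1 / \<epsilon>) + - h y (- (- p)) \<le> 0"
    by (rule G.interior_touch[OF y gy])
  consider "\<sigma> x = 0" | "\<sigma> y = 0" | "\<sigma> x \<noteq> 0" "\<sigma> y \<noteq> 0" by blast
  then show ?thesis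
  proof cases
    case 1
    then show ?thesis using F1 G1 by simp
  next
    case 2
    then show ?thesis using F1 G1 by (simp add: X1_def algebra_simps)
  next
    case 3
    define a where "a = \<bar>\<sigma> x\<bar>"
    define b where "b = \<bar>\<sigma> y\<bar>"
    have ab: "a > 0" "b > 0" "a\<^sup>2 = (\<sigma> x)\<^sup>2" "b\<^sup>2 = (\<sigma> y)\<^sup>2" using 3 by (auto simp: a_def b_def)
    define K1 where "K1 = lam * f x + h x p1"
    define K2 where "K2 = lam * g y + h y p"
    have main: "K1 - K2 - \<eta> * (a\<^sup>2 + b\<^sup>2) \<le> (a - b)\<^sup>2 / \<epsilon> + 2 * \<kappa> * a\<^sup>2" if \<eta>: "\<eta> > 0" for \<eta>
    proof -
      obtain \<rho> where \<rho>: "\<rho> > 0" "\<And>z. 0 < z \<Longrightarrow> z \<le> \<rho> \<Longrightarrow>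
        f x + p1 * z + (K1 / (\<sigma> x)\<^sup>2 - \<eta>) / 2 * z\<^sup>2 \<le> f (x + z)"
        using F.interior_expansion[OF x 3(1) fx \<eta>] unfolding K1_def by blast
      obtain \<rho>' where \<rho>': "\<rho>' > 0" "\<And>z. 0 < z \<Longrightarrow> z \<le> \<rho>' \<Longrightarrow>
        - g y + - p * z + ((lam * - g y + - h y (- (- p))) / (\<sigma> y)\<^sup>2 - \<eta>) / 2 * z\<^sup>2 \<le> - g (y + z)"
        using G.interior_expansion[OF y 3(2) gy \<eta>] by blast
      define z where "z = min (min (\<rho> / a) (\<rho>' / b)) (min ((r - x) / a) ((r - y) / b))"
      have z: "z > 0" "a * z \<le> \<rho>" "b * z \<le> \<rho>'" "x + a * z \<le> r" "y + b * z \<le> r"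
      proof -
        show "z > 0" using \<rho> \<rho>' ab x y by (simp add: z_def)
        have "z \<le> \<rho> / a" "z \<le> \<rho>' / b" "z \<le> (r - x) / a" "z \<le> (r - y) / b" by (auto simp: z_def)
        then show "a * z \<le> \<rho>" "b * z \<le> \<rho>'" "x + a * z \<le> r" "y + b * z \<le> r"
          using ab(1,2) by (simp_all add: field_simps)
      qed
      have az: "0 < a * z" "0 < b * z" using z ab by auto
      have scale: "(w - \<eta>) / 2 * (c * z)\<^sup>2 = (w * c\<^sup>2 - \<eta> * c\<^sup>2) / 2 * z\<^sup>2" for w c
        by (simp add: power2_eq_square algebra_simps)
      have "K1 / (\<sigma> x)\<^sup>2 * a\<^sup>2 = K1" using 3 ab by simp
      then have "(K1 / (\<sigma> x)\<^sup>2 - \<eta>) / 2 * (a * z)\<^sup>2 = (K1 - \<eta> * a\<^sup>2) / 2 * z\<^sup>2"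
        unfolding scale by simp
      then have f1: "f x + p1 * (a * z) + (K1 - \<eta> * a\<^sup>2) / 2 * z\<^sup>2 \<le> f (x + a * z)"
        using \<rho>(2)[OF az(1) z(2)] by simp
      have "(- K2) / (\<sigma> y)\<^sup>2 * b\<^sup>2 = - K2" using 3 ab by simp
      then have "((- K2) / (\<sigma> y)\<^sup>2 - \<eta>) / 2 * (b * z)\<^sup>2 = (- K2 - \<eta> * b\<^sup>2) / 2 * z\<^sup>2"
        unfolding scale by simp
      moreover have "lam * - g y + - h y (- (- p)) = - K2" by (simp add: K2_def)
      ultimately have g1: "- g y + - p * (b * z) + (- K2 - \<eta> * b\<^sup>2) / 2 * z\<^sup>2 \<le> - g (y + b * z)"
        using \<rho>'(2)[OF az(2) z(3)] by simp
      have "f (x + a * z) - g (y + b * z) \<le> f x - g y +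
          ((x - y + (a - b) * z)\<^sup>2 / (2 * \<epsilon>) - (x - y)\<^sup>2 / (2 * \<epsilon>)) + \<kappa> * ((x + a * z - x0)\<^sup>2 - (x - x0)\<^sup>2)"
        using max[of "x + a * z" "y + b * z"] z az x y by (simp add: algebra_simps)
      also have "\<dots> = f x - g y + p1 * (a * z) - p * (b * z) + (1 / \<epsilon> * (a - b)\<^sup>2 + 2 * \<kappa> * a\<^sup>2) / 2 * z\<^sup>2"
        unfolding sq p1_def p_def using \<epsilon> by (simp add: power2_eq_square field_simps)
      finally have "(K1 - \<eta> * a\<^sup>2) / 2 * z\<^sup>2 + (- K2 - \<eta> * b\<^sup>2) / 2 * z\<^sup>2
          \<le> (1 / \<epsilon> * (a - b)\<^sup>2 + 2 * \<kappa> * a\<^sup>2) / 2 * z\<^sup>2"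
        using f1 g1 by linarith
      then have "(K1 - K2 - \<eta> * (a\<^sup>2 + b\<^sup>2)) * (z\<^sup>2 / 2) \<le> (1 / \<epsilon> * (a - b)\<^sup>2 + 2 * \<kappa> * a\<^sup>2) * (z\<^sup>2 / 2)"
        by (simp add: field_simps)
      then show ?thesis using z(1) by simp
    qed
    have "K1 - K2 \<le> (a - b)\<^sup>2 / \<epsilon> + 2 * \<kappa> * a\<^sup>2"
    proof (rule field_le_epsilon)
      fix e :: real assume "e > 0"
      moreover have "a\<^sup>2 + b\<^sup>2 > 0" using ab(1,2) by (intro add_pos_pos) auto
      ultimately show "K1 - K2 \<le> (a - b)\<^sup>2 / \<epsilon> + 2 * \<kappa> * a\<^sup>2 + e"
        using main[of "e / (a\<^sup>2 + b\<^sup>2)"] ab(1) by simp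
    qed
    moreover have "(a - b)\<^sup>2 \<le> (\<sigma> x - \<sigma> y)\<^sup>2"
      unfolding a_def b_def by (rule abs_le_square_iff[THEN iffD1]) (rule abs_triangle_ineq3)
    then have "(a - b)\<^sup>2 / \<epsilon> \<le> (\<sigma> x - \<sigma> y)\<^sup>2 / \<epsilon>" using \<epsilon> by (simp add: divide_right_mono)
    ultimately show ?thesis using ab(3) by (simp add: K1_def K2_def)
  qed
qed

text \<open>
  Semicontinuity and compactness extend the bound on the diagonal to a neighbourhood of it. This is
  what makes the penalization term \<open>(x - y)\<^sup>2 / \<epsilon>\<close> vanish in the limit.
\<close>

lemma near_diagonal:
  assumes diag: "\<And>z. 0 \<le> z \<Longrightarrow> z \<le> r \<Longrightarrow> f z - g z \<le> m" and \<theta>: "\<theta> > 0"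
  shows "\<exists>\<delta>>0. \<forall>x y. 0 \<le> x \<longrightarrow> x \<le> r \<longrightarrow> 0 \<le> y \<longrightarrow> y \<le> r \<longrightarrow> \<bar>x - y\<bar> < \<delta> \<longrightarrow> f x - g y < m + \<theta>"
proof (rule ccontr)
  assume "\<not> ?thesis"
  then have "\<forall>n. \<exists>x y. 0 \<le> x \<and> x \<le> r \<and> 0 \<le> y \<and> y \<le> r \<and> \<bar>x - y\<bar> < inverse (real (Suc n)) \<and> m + \<theta> \<le> f x - g y"
    by (metis inverse_positive_iff_positive not_less of_nat_0_less_iff zero_less_Suc)
  then obtain x y where xy: "\<And>n. x n \<in> {0..r}" "\<And>n. y n \<in> {0..r}"
    "\<And>n. \<bar>x n - y n\<bar> < inverse (real (Suc n))" "\<And>n. m + \<theta> \<le> f (x n) - g (y n)"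
    by (metis atLeastAtMost_iff)
  obtain z \<phi> where z: "z \<in> {0..r}" "strict_mono \<phi>" "(x \<circ> \<phi>) \<longlonglongrightarrow> z"
    using compact_Icc[of 0 r] xy(1) unfolding compact_def by meson
  have "(\<lambda>n. x n - y n) \<longlonglongrightarrow> 0"
    by (rule LIMSEQ_norm_0) (use xy(3) in \<open>auto simp: inverse_eq_divide less_imp_le\<close>)
  then have "((\<lambda>n. x n - y n) \<circ> \<phi>) \<longlonglongrightarrow> 0" using z(2) by (rule LIMSEQ_subseq_LIMSEQ)
  from tendsto_diff[OF z(3) this] have yz: "(y \<circ> \<phi>) \<longlonglongrightarrow> z" by (simp add: o_def)
  obtain d where d: "d > 0" "\<And>s. s \<in> {0..r} \<Longrightarrow> \<bar>s - z\<bar> < d \<Longrightarrow> f s < f z + \<theta> / 2"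
    using F.usc[unfolded usc_on_iff, rule_format, OF z(1), of "f z + \<theta> / 2"] \<theta> by auto
  obtain d' where d': "d' > 0" "\<And>s. s \<in> {0..r} \<Longrightarrow> \<bar>s - z\<bar> < d' \<Longrightarrow> - g s < - g z + \<theta> / 2"
    using G.usc[unfolded usc_on_iff, rule_format, OF z(1), of "- g z + \<theta> / 2"] \<theta> by auto
  have "\<forall>\<^sub>F n in sequentially. \<bar>(x \<circ> \<phi>) n - z\<bar> < d" "\<forall>\<^sub>F n in sequentially. \<bar>(y \<circ> \<phi>) n - z\<bar> < d'"
    using tendstoD[OF z(3) d(1)] tendstoD[OF yz d'(1)] by (simp_all add: dist_real_def)
  then have "\<forall>\<^sub>F n in sequentially. f (x (\<phi> n)) - g (y (\<phi> n)) < f z - g z + \<theta>"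
  proof eventually_elim
    case (elim n)
    then show ?case using d(2)[OF xy(1)[of "\<phi> n"]] d'(2)[OF xy(2)[of "\<phi> n"]] by simp
  qed
  then obtain n where "f (x (\<phi> n)) - g (y (\<phi> n)) < f z - g z + \<theta>"
    by (auto simp: eventually_sequentially)
  then show False using xy(4)[of "\<phi> n"] diag[of z] z(1) by simp
qed

lemma doubled_max_exists:
  fixes k :: "real \<Rightarrow> real \<Rightarrow> real"
  assumes k: "continuous_on UNIV (\<lambda>t. k (fst t) (snd t))"
  shows "\<exists>x y. 0 \<le> x \<and> x \<le> r \<and> 0 \<le> y \<and> y \<le> r \<and>
    (\<forall>x' y'. 0 \<le> x' \<longrightarrow> x' \<le> r \<longrightarrow> 0 \<le> y' \<longrightarrow> y' \<le> r \<longrightarrow> f x' - g y' - k x' y' \<le> f x - g y - k x y)"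
proof -
  let ?\<Phi> = "\<lambda>t. f (fst t) - g (snd t) - k (fst t) (snd t)"
  have "\<exists>t\<in>{0..r} \<times> {0..r}. \<forall>s\<in>{0..r} \<times> {0..r}. ?\<Phi> s \<le> ?\<Phi> t"
  proof (rule usc_attains_max)
    show "compact ({0..r} \<times> {0..r})" by (intro compact_Times compact_Icc)
    show "{0..r} \<times> {0..r} \<noteq> {}" using F.r_pos by auto
    fix t :: "real \<times> real" and c assume t: "t \<in> {0..r} \<times> {0..r}" "?\<Phi> t < c"
    define e where "e = (c - ?\<Phi> t) / 3"
    have e: "e > 0" using t by (simp add: e_def)
    have t12: "fst t \<in> {0..r}" "snd t \<in> {0..r}" using t(1) by (simp_all only: mem_Times_iff)
    obtain d1 where d1: "d1 > 0" "\<And>s. s \<in> {0..r} \<Longrightarrow> \<bar>s - fst t\<bar> < d1 \<Longrightarrow> f s < f (fst t) + e"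
      using F.usc[unfolded usc_on_iff, rule_format, OF t12(1), of "f (fst t) + e"] e by auto
    obtain d2 where d2: "d2 > 0" "\<And>s. s \<in> {0..r} \<Longrightarrow> \<bar>s - snd t\<bar> < d2 \<Longrightarrow> - g s < - g (snd t) + e"
      using G.usc[unfolded usc_on_iff, rule_format, OF t12(2), of "- g (snd t) + e"] e by auto
    obtain d3 where d3: "d3 > 0" "\<And>s. dist s t < d3 \<Longrightarrow> dist (k (fst s) (snd s)) (k (fst t) (snd t)) < e"
      using k e unfolding continuous_on_iff by (metis UNIV_I)
    show "\<exists>d>0. \<forall>s\<in>{0..r} \<times> {0..r}. dist s t < d \<longrightarrow> ?\<Phi> s < c"
    proof (intro exI[of _ "min d1 (min d2 d3)"] conjI ballI impI)
      fix s assume s: "s \<in> {0..r} \<times> {0..r}" "dist s t < min d1 (min d2 d3)"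
      have "\<bar>fst s - fst t\<bar> < d1" "\<bar>snd s - snd t\<bar> < d2"
        using s(2) dist_fst_le[of s t] dist_snd_le[of s t] by (auto simp: dist_real_def)
      then have "f (fst s) < f (fst t) + e" "- g (snd s) < - g (snd t) + e"
        using d1 d2 s(1) by (auto simp: mem_Times_iff)
      moreover have "\<bar>k (fst s) (snd s) - k (fst t) (snd t)\<bar> < e" using d3(2)[of s] s(2) by (simp add: dist_real_def)
      moreover have "3 * e = c - ?\<Phi> t" by (simp add: e_def)
      ultimately show "?\<Phi> s < c" by linarith
    qed (use d1 d2 d3 in auto)
  qed
  then show ?thesis by (force simp: mem_Times_iff)
qed

text \<open>
  The constants are chosen in the order \<open>\<kappa>\<close>, \<open>\<theta>\<close>, \<open>\<epsilon>\<close>: the localization costs at most \<open>lam * m / 3\<close>;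
  then \<open>\<theta>\<close>, a bound for both penalization terms, keeps the maximum point inside the edge
  and costs at most \<open>lam * m / 3\<close>; finally \<open>\<epsilon>\<close> forces \<open>\<bar>x - y\<bar> < d\<close>, which costs \<open>lam * m / 6\<close>.
\<close>

lemma no_positive_interior_max:
  assumes x0: "0 < x0" "x0 < r"
    and max: "\<And>z. 0 \<le> z \<Longrightarrow> z \<le> r \<Longrightarrow> f z - g z \<le> f x0 - g x0"
  shows "f x0 \<le> g x0"
proof (rule ccontr)
  assume "\<not> ?thesis"
  define m where "m = f x0 - g x0"
  have m: "m > 0" using \<open>\<not> _\<close> by (simp add: m_def)
  have C: "C > 0" by (rule F.C_pos)
  have lm: "lam * m > 0" using m F.lam_pos by simp
  define B where "B = \<bar>\<sigma> 0\<bar> + C * r"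
  have B: "(\<sigma> z)\<^sup>2 \<le> B\<^sup>2" if z: "0 \<le> z" "z \<le> r" for z
  proof -
    have "\<bar>\<sigma> z - \<sigma> 0\<bar> \<le> C * z" using F.\<sigma>_lip[of z 0] z by simp
    also have "\<dots> \<le> C * r" using z C by simp
    finally have "\<bar>\<sigma> z\<bar> \<le> \<bar>B\<bar>" by (simp add: B_def)
    then show ?thesis by (rule abs_le_square_iff[THEN iffD1])
  qed
  define \<kappa> where "\<kappa> = lam * m / (6 * (B\<^sup>2 + C * r + 1))"
  have Bp: "B\<^sup>2 + C * r + 1 > 0" using C F.r_pos by (intro add_nonneg_pos) auto
  have \<kappa>: "\<kappa> > 0" "2 * \<kappa> * B\<^sup>2 + 2 * \<kappa> * C * r \<le> lam * m / 3"
  proof -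
    show "\<kappa> > 0" unfolding \<kappa>_def using lm Bp by simp
    have "\<kappa> * (6 * (B\<^sup>2 + C * r + 1)) = lam * m" using Bp by (simp add: \<kappa>_def)
    then show "2 * \<kappa> * B\<^sup>2 + 2 * \<kappa> * C * r \<le> lam * m / 3" using \<open>\<kappa> > 0\<close> by (simp add: algebra_simps)
  qed
  define \<rho> where "\<rho> = min x0 (r - x0) / 2"
  have \<rho>: "\<rho> > 0" "2 * \<rho> \<le> x0" "2 * \<rho> \<le> r - x0" using x0 by (auto simp: \<rho>_def)
  define \<theta> where "\<theta> = min (\<kappa> * \<rho>\<^sup>2) (lam * m / (6 * (C\<^sup>2 + C)))"
  have Cp: "C\<^sup>2 + C > 0" using C by (intro add_pos_pos) auto
  have \<theta>: "\<theta> > 0" "\<theta> \<le> \<kappa> * \<rho>\<^sup>2" "2 * C\<^sup>2 * \<theta> + 2 * C * \<theta> \<le> lam * m / 3"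
  proof -
    show "\<theta> > 0" "\<theta> \<le> \<kappa> * \<rho>\<^sup>2" using \<kappa> \<rho> lm Cp by (auto simp: \<theta>_def)
    have "\<theta> \<le> lam * m / (6 * (C\<^sup>2 + C))" by (simp add: \<theta>_def)
    then have "\<theta> * (6 * (C\<^sup>2 + C)) \<le> lam * m" using Cp by (subst (asm) pos_le_divide_eq) auto
    then show "2 * C\<^sup>2 * \<theta> + 2 * C * \<theta> \<le> lam * m / 3" by (simp add: algebra_simps)
  qed
  obtain \<delta> where \<delta>: "\<delta> > 0"
    "\<And>x y. 0 \<le> x \<Longrightarrow> x \<le> r \<Longrightarrow> 0 \<le> y \<Longrightarrow> y \<le> r \<Longrightarrow> \<bar>x - y\<bar> < \<delta> \<Longrightarrow> f x - g y < m + \<theta>"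
    using near_diagonal[of m \<theta>] max \<theta>(1) unfolding m_def by blast
  obtain A1 where A1: "\<And>x. 0 \<le> x \<Longrightarrow> x \<le> r \<Longrightarrow> f x \<le> A1" using F.bounded_above by blast
  obtain A2 where A2: "\<And>x. 0 \<le> x \<Longrightarrow> x \<le> r \<Longrightarrow> - g x \<le> A2" using G.bounded_above by blast
  define R where "R = A1 + A2 - m"
  have R: "R \<ge> 0" using A1[of x0] A2[of x0] x0 by (simp add: R_def m_def)
  define d where "d = min \<delta> (min \<rho> (lam * m / (6 * C)))"
  have d: "d > 0" "d \<le> \<delta>" "d \<le> \<rho>" "C * d \<le> lam * m / 6"
  proof -
    show "d > 0" "d \<le> \<delta>" "d \<le> \<rho>" using \<delta> \<rho> lm C by (auto simp: d_def)
    have "d \<le> lam * m / (6 * C)" by (simp add: d_def)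
    then show "C * d \<le> lam * m / 6" using C by (simp add: field_simps)
  qed
  define \<epsilon> where "\<epsilon> = d\<^sup>2 / (2 * (R + 1))"
  have \<epsilon>: "\<epsilon> > 0" using d R by (simp add: \<epsilon>_def)
  have \<epsilon>R: "2 * \<epsilon> * R < d\<^sup>2"
  proof -
    have "2 * (R + 1) \<noteq> 0" using R by simp
    then have "\<epsilon> * (2 * (R + 1)) = d\<^sup>2" unfolding \<epsilon>_def by (metis nonzero_eq_divide_eq)
    then show ?thesis using \<epsilon> by (simp add: algebra_simps)
  qed
  let ?k = "\<lambda>x y. (x - y)\<^sup>2 / (2 * \<epsilon>) + \<kappa> * (x - x0)\<^sup>2"
  have "continuous_on UNIV (\<lambda>t. ?k (fst t) (snd t))"
    using \<epsilon> by (intro continuous_intros) auto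
  from doubled_max_exists[OF this] obtain x y where x: "0 \<le> x" "x \<le> r" and y: "0 \<le> y" "y \<le> r"
    and mx: "\<And>x' y'. \<lbrakk>0 \<le> x'; x' \<le> r; 0 \<le> y'; y' \<le> r\<rbrakk> \<Longrightarrow> f x' - g y' - ?k x' y' \<le> f x - g y - ?k x y"
    by blast
  have low: "m \<le> f x - g y - ?k x y" using mx[of x0 x0] x0 by (simp add: m_def)
  have k1: "0 \<le> (x - y)\<^sup>2 / (2 * \<epsilon>)" and k2: "0 \<le> \<kappa> * (x - x0)\<^sup>2" using \<epsilon> \<kappa> by auto
  have "(x - y)\<^sup>2 / (2 * \<epsilon>) \<le> R" using low k2 A1[OF x] A2[OF y] by (simp add: R_def)
  then have "(x - y)\<^sup>2 \<le> 2 * \<epsilon> * R" using \<epsilon> by (simp add: field_simps)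
  then have "(x - y)\<^sup>2 < d\<^sup>2" using \<epsilon>R by simp
  then have xyd: "\<bar>x - y\<bar> < d" using d(1) by (metis less_imp_le power2_abs power_less_imp_less_base)
  then have up: "f x - g y < m + \<theta>" using \<delta>(2)[OF x y] d by simp
  then have kt: "?k x y < \<theta>" using low by simp
  have "\<kappa> * (x - x0)\<^sup>2 < \<kappa> * \<rho>\<^sup>2" using kt k1 \<theta>(2) by simp
  then have "(x - x0)\<^sup>2 < \<rho>\<^sup>2" using \<kappa> by simp
  then have "\<bar>x - x0\<bar> < \<rho>" using \<rho>(1) by (metis less_imp_le power2_abs power_less_imp_less_base)
  then have xi: "0 < x" "x < r" and yi: "0 < y" "y < r" using xyd d(3) \<rho> by (auto simp: abs_less_iff)
  define p where "p = (x - y) / \<epsilon>"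
  define p1 where "p1 = p + 2 * \<kappa> * (x - x0)"
  have "lam * f x + h x p1 - (lam * g y + h y p) \<le> (\<sigma> x - \<sigma> y)\<^sup>2 / \<epsilon> + 2 * \<kappa> * (\<sigma> x)\<^sup>2"
    unfolding p1_def p_def
  proof (rule doubled_inequality[OF xi yi \<epsilon>])
    show "\<kappa> \<ge> 0" using \<kappa> by simp
    fix x' y' assume "0 \<le> x'" "x' \<le> r" "0 \<le> y'" "y' \<le> r"
    from mx[OF this] show "f x' - g y' - (x' - y')\<^sup>2 / (2 * \<epsilon>) - \<kappa> * (x' - x0)\<^sup>2 \<le>
      f x - g y - (x - y)\<^sup>2 / (2 * \<epsilon>) - \<kappa> * (x - x0)\<^sup>2" by simp
  qed
  moreover have "(\<sigma> x - \<sigma> y)\<^sup>2 / \<epsilon> \<le> 2 * C\<^sup>2 * \<theta>"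
  proof -
    have "\<bar>\<sigma> x - \<sigma> y\<bar>\<^sup>2 \<le> (C * \<bar>x - y\<bar>)\<^sup>2" using F.\<sigma>_lip[of x y] x y by (intro power_mono) auto
    then have "(\<sigma> x - \<sigma> y)\<^sup>2 / \<epsilon> \<le> C\<^sup>2 * (x - y)\<^sup>2 / \<epsilon>"
      using \<epsilon> by (intro divide_right_mono) (auto simp: power_mult_distrib)
    also have "\<dots> = 2 * C\<^sup>2 * ((x - y)\<^sup>2 / (2 * \<epsilon>))" by simp
    also have "\<dots> \<le> 2 * C\<^sup>2 * \<theta>" using kt k2 by (intro mult_left_mono) auto
    finally show ?thesis .
  qed
  moreover have "2 * \<kappa> * (\<sigma> x)\<^sup>2 \<le> 2 * \<kappa> * B\<^sup>2" using B[OF x] \<kappa> by simp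
  moreover have "\<bar>h x p1 - h y p\<bar> \<le> C * d + 2 * C * \<theta> + 2 * \<kappa> * C * r"
  proof -
    have "\<bar>p\<bar> * \<bar>x - y\<bar> = 2 * ((x - y)\<^sup>2 / (2 * \<epsilon>))"
      using \<epsilon> by (simp add: p_def abs_divide power2_eq_square abs_mult[symmetric])
    then have "\<bar>p\<bar> * \<bar>x - y\<bar> \<le> 2 * \<theta>" using kt k2 by simp
    then have "C * (\<bar>p\<bar> * \<bar>x - y\<bar>) \<le> C * (2 * \<theta>)" using C by (intro mult_left_mono) auto
    moreover have "C * \<bar>x - y\<bar> \<le> C * d" using xyd C by simp
    moreover have "\<bar>h x p - h y p\<bar> \<le> C * (1 + \<bar>p\<bar>) * \<bar>x - y\<bar>" using F.h_x[of x y p] x y by simp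
    moreover have "\<bar>h x p1 - h x p\<bar> \<le> C * \<bar>p1 - p\<bar>" using F.h_p[of x p1 p] x by simp
    moreover have "C * \<bar>p1 - p\<bar> \<le> 2 * \<kappa> * C * r"
    proof -
      have "\<bar>x - x0\<bar> \<le> r" using x x0 by (auto simp: abs_le_iff)
      then have "2 * \<kappa> * C * \<bar>x - x0\<bar> \<le> 2 * \<kappa> * C * r" using \<kappa> C by (intro mult_left_mono) auto
      moreover have "p1 - p = (2 * \<kappa>) * (x - x0)" by (simp add: p1_def)
      then have "\<bar>p1 - p\<bar> = 2 * \<kappa> * \<bar>x - x0\<bar>" using \<kappa>(1) by (simp only: abs_mult)
      ultimately show ?thesis by (simp only: mult_ac)
    qed
    moreover have "C * (1 + \<bar>p\<bar>) * \<bar>x - y\<bar> = C * \<bar>x - y\<bar> + C * (\<bar>p\<bar> * \<bar>x - y\<bar>)"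
      "C * (2 * \<theta>) = 2 * C * \<theta>" by (simp_all add: algebra_simps)
    ultimately show ?thesis by linarith
  qed
  moreover have "lam * m \<le> lam * f x - lam * g y"
  proof -
    have "m \<le> f x - g y" using low k1 k2 by simp
    then have "lam * m \<le> lam * (f x - g y)" using F.lam_pos by simp
    then show ?thesis by (simp add: algebra_simps)
  qed
  ultimately show False using \<kappa>(2) \<theta>(3) d(4) lm by linarith
qed

end

section \<open>Maxima at a vertex and at the junction point\<close>

context hj_pair
begin

text \<open>
  Placed at \<open>0\<close>, a vertex at which \<open>f\<close> exceeds \<open>g\<close> admits a test function for \<open>g\<close> that violates the
  supersolution inequality of the equation. In the elliptic case a barrier for \<open>g\<close> alone does it.
\<close>

lemma vertex_gap:
  assumes st: "steep_or_elliptic \<sigma> h"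
    and limsup: "\<And>\<epsilon> \<delta>. \<epsilon> > 0 \<Longrightarrow> \<delta> > 0 \<Longrightarrow> \<exists>z. 0 < z \<and> z < \<delta> \<and> f 0 - \<epsilon> < f z"
  shows "\<exists>t Y. jet_above (\<lambda>x. - g x) (- t) (- Y) \<and> lam * g 0 - (\<sigma> 0)\<^sup>2 * Y + h 0 t < 0"
proof (cases "\<sigma> 0 = 0")
  case False
  then have "steep_or_elliptic \<sigma> (mirror h)" by (simp add: steep_or_elliptic_def)
  then obtain s X where "jet_above (\<lambda>x. - g x) s X" "0 < lam * - g 0 - (\<sigma> 0)\<^sup>2 * X + - h 0 (- s)"
    using G.jet_above_strict by blast
  then show ?thesis by (intro exI[of _ "- s"] exI[of _ "- X"]) simp
next
  case True
  then obtain \<rho> k c where k: "\<rho> > 0" "k > 0" "\<And>x p. 0 \<le> x \<Longrightarrow> x \<le> \<rho> \<Longrightarrow> k * \<bar>p\<bar> - c \<le> h x p"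
    using st unfolding steep_or_elliptic_def by blast
  obtain P where "upper_slope f P"
    using F.touch_above_exists[OF st] F.slope_bound_of_limsup[OF True k limsup] upper_slopeI by blast
  moreover have "\<exists>k>0. \<exists>c. \<forall>p. k * \<bar>p\<bar> - c \<le> h 0 p" using k by (meson less_imp_le order_refl)
  ultimately show ?thesis using edge_gap by blast
qed

end

text \<open>
  First, the slopes of every \<open>f i\<close> are bounded below: otherwise one component of the test slopes could be
  sent to \<open>- \<infinity>\<close> with positive operators on all edges, and the junction condition would contradict
  \<open>F_lim\<close>. Then \<open>edge_gap\<close> yields test slopes \<open>s i < t i\<close> for \<open>f i\<close> and \<open>g i\<close> at which no edge can
  fulfil the junction condition, and \<open>F u0 s \<le> 0 \<le> F v0 t\<close> contradicts strict monotonicity.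
\<close>

lemma junction_point_contradiction:
  fixes F :: "real \<Rightarrow> real ^ 'n::finite \<Rightarrow> real"
  assumes pair: "\<And>i. hj_pair lam C (\<sigma> i) (h i) (l i) (f i) (g i)"
    and f0: "\<And>i. f i 0 = u0" and g0: "\<And>i. g i 0 = v0"
    and st: "\<And>i. steep_or_elliptic (\<sigma> i) (h i)"
    and sub: "\<And>p X. (\<And>i. jet_above (f i) (p i) (X i)) \<Longrightarrow>
      (\<exists>i. lam * u0 - (\<sigma> i 0)\<^sup>2 * X i + h i 0 (p i) \<le> 0) \<or> F u0 (\<chi> i. p i) \<le> 0"
    and super: "\<And>p X. (\<And>i. jet_above (\<lambda>x. - g i x) (- p i) (- X i)) \<Longrightarrow>
      (\<exists>i. 0 \<le> lam * v0 - (\<sigma> i 0)\<^sup>2 * X i + h i 0 (p i)) \<or> 0 \<le> F v0 (\<chi> i. p i)"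
    and F_strict: "\<And>r s p q. \<lbrakk>r \<ge> s; \<forall>i. p $ i \<le> q $ i; \<exists>j. p $ j < q $ j\<rbrakk> \<Longrightarrow> F r p > F s q"
    and F_lim: "\<And>i r p. filterlim (\<lambda>t. F r (\<chi> j. if j = i then t else p $ j)) at_top at_bot"
  shows False
proof -
  have hjf: "hj_sub lam C (\<sigma> i) (h i) (l i) (f i)" for i using pair[of i] by (simp add: hj_pair_def hj_sub_super_def)
  have "\<exists>s X. jet_above (f i) s X \<and> 0 < lam * u0 - (\<sigma> i 0)\<^sup>2 * X + h i 0 s" for i
    using hj_sub.jet_above_strict[OF hjf st, of i] f0 by simp
  then obtain p0 X0 where p0: "\<And>i. jet_above (f i) (p0 i) (X0 i)"
    "\<And>i. 0 < lam * u0 - (\<sigma> i 0)\<^sup>2 * X0 i + h i 0 (p0 i)" by metis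
  have slope: "\<exists>P. upper_slope (f i) P" for i
  proof -
    have "\<exists>s. \<not> touch_above (f i) s"
    proof (rule ccontr)
      assume "\<not> ?thesis"
      then have all: "jet_above (f i) s X" for s X
        using jet_above_of_touch[of "f i" "s - 1" s X] by simp
      obtain S where S: "\<And>s. S \<le> \<bar>s\<bar> \<Longrightarrow> \<exists>X. 0 < lam * u0 - (\<sigma> i 0)\<^sup>2 * X + h i 0 s"
        using strict_jet[OF st[of i]] by metis
      have "filterlim (\<lambda>t. F u0 (\<chi> j. if j = i then t else p0 j)) at_top at_bot"
        using F_lim[of u0 i "\<chi> j. p0 j"] by (simp only: vec_lambda_beta)
      then have "\<forall>\<^sub>F t in at_bot. 1 \<le> F u0 (\<chi> j. if j = i then t else p0 j)"
        by (simp only: filterlim_at_top)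
      then obtain b where b: "\<And>t. t \<le> b \<Longrightarrow> 1 \<le> F u0 (\<chi> j. if j = i then t else p0 j)"
        by (auto simp: eventually_at_bot_linorder)
      define s where "s = min b (- \<bar>S\<bar>)"
      have s: "s \<le> b" "S \<le> \<bar>s\<bar>" by (auto simp: s_def min_def)
      obtain X where X: "0 < lam * u0 - (\<sigma> i 0)\<^sup>2 * X + h i 0 s" using S[OF s(2)] by blast
      define p where "p j = (if j = i then s else p0 j)" for j
      define Y where "Y j = (if j = i then X else X0 j)" for j
      have pos: "0 < lam * u0 - (\<sigma> j 0)\<^sup>2 * Y j + h j 0 (p j)" for j
        using X p0(2)[of j] by (auto simp: p_def Y_def)
      have "jet_above (f j) (p j) (Y j)" for j using all p0(1)[of j] by (auto simp: p_def Y_def)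
      from sub[OF this] pos have "F u0 (\<chi> j. p j) \<le> 0" by (meson not_less)
      then show False using b[OF s(1)] by (simp add: p_def)
    qed
    then show ?thesis
      using hj_sub.touch_above_exists[OF hjf st, of i] upper_slopeI by blast
  qed
  have "\<exists>s t X Y. s < t \<and>
    jet_above (f i) s X \<and> 0 < lam * u0 - (\<sigma> i 0)\<^sup>2 * X + h i 0 s \<and>
    jet_above (\<lambda>x. - g i x) (- t) (- Y) \<and> lam * v0 - (\<sigma> i 0)\<^sup>2 * Y + h i 0 t < 0" for i
  proof -
    have "\<exists>k>0. \<exists>c. \<forall>p. k * \<bar>p\<bar> - c \<le> h i 0 p" if "\<sigma> i 0 = 0"
      using st[of i] that unfolding steep_or_elliptic_def by (meson less_imp_le order_refl)
    moreover obtain P where "upper_slope (f i) P" using slope by blast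
    ultimately show ?thesis
      using hj_pair.edge_gap[OF pair, of i] unfolding f0 g0 by blast
  qed
  then obtain s t X Y where *: "\<And>i. s i < t i"
    "\<And>i. jet_above (f i) (s i) (X i)" "\<And>i. 0 < lam * u0 - (\<sigma> i 0)\<^sup>2 * X i + h i 0 (s i)"
    "\<And>i. jet_above (\<lambda>x. - g i x) (- t i) (- Y i)" "\<And>i. lam * v0 - (\<sigma> i 0)\<^sup>2 * Y i + h i 0 (t i) < 0"
    by metis
  have "F u0 (\<chi> i. s i) \<le> 0" using sub[OF *(2)] *(3) by (meson not_less)
  moreover have "0 \<le> F v0 (\<chi> i. t i)" using super[OF *(4)] *(5) by (meson not_less)
  moreover have "F u0 (\<chi> i. s i) > F v0 (\<chi> i. t i)"
  proof (rule F_strict)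
    show "v0 \<le> u0"
      using hj_pair.gap[OF pair] unfolding f0 g0 by simp
  qed (use *(1) in \<open>auto simp: less_imp_le\<close>)
  ultimately show False by simp
qed

section \<open>From the junction to its edges\<close>

lemma junction_vertices_sgn_inj:
  assumes "junction_vertices V" "sgn (V i) = sgn (V j)" shows "i = j"
proof (rule ccontr)
  assume ij: "i \<noteq> j"
  have nz: "V i \<noteq> 0" "V j \<noteq> 0" using assms(1) by (auto simp: junction_vertices_def)
  have "V j = norm (V j) *\<^sub>R sgn (V j)" using nz by (simp add: sgn_div_norm)
  also have "\<dots> = norm (V j) *\<^sub>R sgn (V i)" using assms(2) by simp
  also have "\<dots> = (norm (V j) / norm (V i)) *\<^sub>R V i" by (simp add: sgn_div_norm divide_inverse)
  finally have "collinear {0, V i, V j}" unfolding collinear_lemma by blast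
  then show False using assms(1) ij by (auto simp: junction_vertices_def)
qed

lemma closure_edge_arc_length:
  assumes "w \<noteq> 0"
  shows "x \<in> closure (edge w) \<longleftrightarrow> (\<exists>t. 0 \<le> t \<and> t \<le> norm w \<and> x = t *\<^sub>R sgn w)"
proof
  assume "x \<in> closure (edge w)"
  then obtain t where "0 \<le> t" "t \<le> 1" "x = t *\<^sub>R w" by (auto simp: closure_edge)
  then show "\<exists>t. 0 \<le> t \<and> t \<le> norm w \<and> x = t *\<^sub>R sgn w"
    using assms by (intro exI[of _ "t * norm w"]) (auto simp: sgn_div_norm mult_left_le_one_le)
next
  assume "\<exists>t. 0 \<le> t \<and> t \<le> norm w \<and> x = t *\<^sub>R sgn w"
  then obtain t where "0 \<le> t" "t \<le> norm w" "x = t *\<^sub>R sgn w" by blast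
  then show "x \<in> closure (edge w)"
    using assms unfolding closure_edge
    by (intro CollectI exI[of _ "t / norm w"]) (auto simp: sgn_div_norm divide_inverse[symmetric])
qed

lemma edge_arc_length:
  assumes "w \<noteq> 0"
  shows "x \<in> edge w \<longleftrightarrow> (\<exists>t. 0 < t \<and> t < norm w \<and> x = t *\<^sub>R sgn w)"
proof
  assume "x \<in> edge w"
  then obtain t where "0 < t" "t < 1" "x = t *\<^sub>R w" by (auto simp: edge_def)
  then show "\<exists>t. 0 < t \<and> t < norm w \<and> x = t *\<^sub>R sgn w"
    using assms by (intro exI[of _ "t * norm w"]) (auto simp: sgn_div_norm)
next
  assume "\<exists>t. 0 < t \<and> t < norm w \<and> x = t *\<^sub>R sgn w"
  then obtain t where "0 < t" "t < norm w" "x = t *\<^sub>R sgn w" by blast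
  then show "x \<in> edge w"
    using assms unfolding edge_def
    by (intro CollectI exI[of _ "t / norm w"]) (auto simp: sgn_div_norm divide_inverse[symmetric])
qed

lemma norm_sgn_scale: "(w :: 'a::real_normed_vector) \<noteq> 0 \<Longrightarrow> 0 \<le> t \<Longrightarrow> norm (t *\<^sub>R sgn w) = t"
  by (simp add: norm_sgn)

lemma dist_sgn_scale: "(w :: 'a::real_normed_vector) \<noteq> 0 \<Longrightarrow> dist (s *\<^sub>R sgn w) (t *\<^sub>R sgn w) = \<bar>s - t\<bar>"
  unfolding dist_norm scaleR_diff_left[symmetric] by (simp add: norm_sgn)

lemma vertex_arc_length: "V = norm V *\<^sub>R sgn (V :: 'a::real_normed_vector)"
  by (cases "V = 0") (simp_all add: sgn_div_norm)

text \<open>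
  The test function equal to \<open>c + p i t + X i t\<^sup>2 / 2\<close> at arc length \<open>t\<close> on the edge \<open>i\<close>. The edges are
  told apart by \<open>sgn\<close>; at the junction point all summands vanish, because \<open>sgn 0 = 0\<close> is not a direction of
  an edge.
\<close>

definition quad_test ::
  "('n::finite \<Rightarrow> 'a::euclidean_space) \<Rightarrow> real \<Rightarrow> ('n \<Rightarrow> real) \<Rightarrow> ('n \<Rightarrow> real) \<Rightarrow> 'a \<Rightarrow> real" where
  "quad_test V c p X y =
     c + (\<Sum>i\<in>UNIV. if sgn y = sgn (V i) then p i * norm y + X i / 2 * (norm y)\<^sup>2 else 0)"

lemma quad_test_uminus: "- quad_test V c p X y = quad_test V (- c) (\<lambda>i. - p i) (\<lambda>i. - X i) y"
  unfolding quad_test_def minus_add_distrib sum_negf[symmetric]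
  by (intro arg_cong2[of _ _ _ _ "(+)"] sum.cong) auto

context
  fixes V :: "'n::finite \<Rightarrow> 'a::euclidean_space"
  assumes V: "junction_vertices V"
begin

lemma V_nonzero: "V i \<noteq> 0" using V by (simp add: junction_vertices_def)

lemma norm_V_pos: "norm (V i) > 0" using V_nonzero by simp

lemma quad_test_0: "quad_test V c p X 0 = c"
proof -
  have "sgn (V i) \<noteq> 0" for i using V_nonzero[of i] by (simp add: sgn_zero_iff)
  then show ?thesis by (auto simp: quad_test_def intro!: sum.neutral dest: sym)
qed

lemma quad_test_edge:
  assumes "0 \<le> t" shows "quad_test V c p X (t *\<^sub>R sgn (V i)) = c + p i * t + X i / 2 * t\<^sup>2"
proof (cases "t = 0")
  case True then show ?thesis using quad_test_0 by simp
next
  case False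
  then have t: "t > 0" using assms by simp
  have n: "norm (t *\<^sub>R sgn (V i)) = t" using norm_sgn_scale[OF V_nonzero[of i] assms] .
  moreover have "sgn (t *\<^sub>R sgn (V i)) = sgn (V i)"
    unfolding sgn_div_norm[of "t *\<^sub>R sgn (V i)"] n using t by simp
  ultimately have "quad_test V c p X (t *\<^sub>R sgn (V i)) =
      c + (\<Sum>j\<in>UNIV. if j = i then p j * t + X j / 2 * t\<^sup>2 else 0)"
    unfolding quad_test_def
    using junction_vertices_sgn_inj[OF V] by (intro arg_cong2[of _ _ _ _ "(+)"] sum.cong) auto
  then show ?thesis by simp
qed

lemma interval_deriv_eq:
  assumes "0 < l" "t \<in> {0..l}" "\<And>s. s \<in> {0..l} \<Longrightarrow> g s = c + p * s + X / 2 * s\<^sup>2"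
  shows "(g has_vector_derivative p + X * t) (at t within {0..l})"
    and "interval_deriv l g t = p + X * t"
proof -
  have "((\<lambda>s. c + p * s + X / 2 * s\<^sup>2) has_vector_derivative p + X * t) (at t within {0..l})"
    by (auto intro!: derivative_eq_intros simp: has_real_derivative_iff_has_vector_derivative[symmetric])
  then show d: "(g has_vector_derivative p + X * t) (at t within {0..l})"
    by (rule has_vector_derivative_transform[rotated 2]) (use assms in auto)
  then show "interval_deriv l g t = p + X * t"
    unfolding interval_deriv_def
    using vector_derivative_within_cbox[of 0 l t g] assms by simp
qed

lemma quad_test_edge_fun:
  assumes "s \<in> {0..l}"
  shows "edge_fun (V i) (quad_test V c p X) s = c + p i * s + X i / 2 * s\<^sup>2"
  using quad_test_edge assms by (simp add: edge_fun_def)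

lemma quad_test_dx:
  assumes "t \<in> {0..norm (V i)}"
  shows "interval_deriv (norm (V i)) (edge_fun (V i) (quad_test V c p X)) t = p i + X i * t"
  by (rule interval_deriv_eq(2)[OF norm_V_pos assms quad_test_edge_fun])

lemma quad_test_dxx:
  assumes "t \<in> {0..norm (V i)}"
  shows "interval_deriv (norm (V i)) (interval_deriv (norm (V i)) (edge_fun (V i) (quad_test V c p X))) t = X i"
  using interval_deriv_eq(2)[OF norm_V_pos assms, of _ "p i" "X i" 0] quad_test_dx[of _ i c p X] by simp

lemma quad_test_C2: "quad_test V c p X \<in> Cm_junction 2 V"
proof -
  have diff: "g differentiable_on {0..norm (V i)}"
    if "\<And>s. s \<in> {0..norm (V i)} \<Longrightarrow> g s = c + p * s + X / 2 * s\<^sup>2" for g c p X i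
    unfolding differentiable_on_def
    using interval_deriv_eq(1)[OF norm_V_pos[of i] _ that] differentiableI_vector by blast
  have diff0: "edge_fun (V i) (quad_test V c p X) differentiable_on {0..norm (V i)}" for i
    by (rule diff[of i _ c "p i" "X i"]) (rule quad_test_edge_fun)
  have cont: "continuous_on {0..norm (V i)} (edge_fun (V i) (quad_test V c p X))" for i
    by (rule differentiable_imp_continuous_on[OF diff0])
  have "usc_on {0..norm (V i)} (edge_fun (V i) (quad_test V c p X))"
    and "lsc_on {0..norm (V i)} (edge_fun (V i) (quad_test V c p X))" for i
    using cont[of i] unfolding lsc_on_iff_usc by (auto intro!: continuous_imp_usc_on continuous_intros)
  moreover have "Cm_interval 2 (norm (V i)) (edge_fun (V i) (quad_test V c p X))" for i
  proof -
    have "interval_deriv (norm (V i)) (edge_fun (V i) (quad_test V c p X)) differentiable_on {0..norm (V i)}"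
      by (rule diff[of i _ "p i" "X i" 0]) (use quad_test_dx in simp)
    moreover have "continuous_on {0..norm (V i)}
      (interval_deriv (norm (V i)) (interval_deriv (norm (V i)) (edge_fun (V i) (quad_test V c p X))))"
      by (rule continuous_on_eq[of _ "\<lambda>_. X i"]) (simp_all add: quad_test_dxx)
    ultimately show ?thesis
      using diff0 by (simp add: numeral_2_eq_2)
  qed
  ultimately show ?thesis
    by (simp add: Cm_junction_def C_junction_def USC_junction_def LSC_junction_def)
qed

lemma junction_arc_length:
  "x \<in> junction V \<longleftrightarrow> (\<exists>i t. 0 \<le> t \<and> t \<le> norm (V i) \<and> x = t *\<^sub>R sgn (V i))"
  unfolding junction_def using closure_edge_arc_length[OF V_nonzero] by auto

text \<open>
  Near a point other than the junction point, the junction is the single edge through that point: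
  the other edges form a closed set that does not contain it.
\<close>

lemma eventually_junction_edge:
  assumes t: "0 < t" "t \<le> norm (V i)"
    and ev: "\<forall>\<^sub>F s in at t within {0..norm (V i)}. P (s *\<^sub>R sgn (V i))"
  shows "\<forall>\<^sub>F y in at (t *\<^sub>R sgn (V i)) within junction V. P y"
proof -
  let ?x = "t *\<^sub>R sgn (V i)"
  obtain d where d: "d > 0" "\<And>s. s \<in> {0..norm (V i)} \<Longrightarrow> s \<noteq> t \<Longrightarrow> \<bar>s - t\<bar> < d \<Longrightarrow> P (s *\<^sub>R sgn (V i))"
    using ev unfolding eventually_at dist_real_def by blast
  define N where "N = - (\<Union>j\<in>UNIV - {i}. closure (edge (V j)))"
  have "open N" unfolding N_def by (auto intro!: open_Compl closed_UN)
  moreover have "?x \<in> N"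
  proof (rule ccontr)
    assume "?x \<notin> N"
    then obtain j where j: "j \<noteq> i" "?x \<in> closure (edge (V j))" by (auto simp: N_def)
    then obtain s where s: "0 \<le> s" "?x = s *\<^sub>R sgn (V j)"
      using closure_edge_arc_length[OF V_nonzero] by blast
    have "t = s" using s t norm_sgn_scale[OF V_nonzero, of t i] norm_sgn_scale[OF V_nonzero, of s j]
      by (metis less_imp_le)
    then have "sgn (V i) = sgn (V j)" using s t by simp
    then show False using junction_vertices_sgn_inj[OF V] j by blast
  qed
  ultimately obtain e where e: "e > 0" "\<And>y. dist y ?x < e \<Longrightarrow> y \<in> N"
    unfolding open_dist by blast
  show ?thesis
    unfolding eventually_at
  proof (intro exI[of _ "min d e"] conjI ballI impI)
    fix y assume y: "y \<in> junction V" "y \<noteq> ?x \<and> dist y ?x < min d e"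
    then have "y \<in> closure (edge (V i))" using e(2)[of y] by (auto simp: junction_def N_def)
    then obtain s where s: "0 \<le> s" "s \<le> norm (V i)" "y = s *\<^sub>R sgn (V i)"
      using closure_edge_arc_length[OF V_nonzero] by blast
    then have "\<bar>s - t\<bar> < d" "s \<noteq> t" using y dist_sgn_scale[OF V_nonzero[of i], of s t] by auto
    then show "P y" using d(2)[of s] s by simp
  qed (use d e in auto)
qed

lemma eventually_junction_0:
  assumes ev: "\<And>i. \<forall>\<^sub>F s in at_right 0. P (s *\<^sub>R sgn (V i))"
  shows "\<forall>\<^sub>F y in at 0 within junction V. P y"
proof -
  have "\<exists>d>0. \<forall>s. 0 < s \<and> s < d \<longrightarrow> P (s *\<^sub>R sgn (V i))" for i
    using ev[of i] unfolding eventually_at_right_0 .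
  then obtain d where d: "\<And>i. d i > 0" "\<And>i s. 0 < s \<Longrightarrow> s < d i \<Longrightarrow> P (s *\<^sub>R sgn (V i))" by metis
  define e where "e = Min (range d)"
  have e: "e > 0" "\<And>i. e \<le> d i" using d(1) by (auto simp: e_def)
  show ?thesis
    unfolding eventually_at
  proof (intro exI[of _ e] conjI ballI impI)
    fix y assume y: "y \<in> junction V" "y \<noteq> 0 \<and> dist y 0 < e"
    then obtain i s where s: "0 \<le> s" "y = s *\<^sub>R sgn (V i)" unfolding junction_arc_length by blast
    then have "s \<noteq> 0" "s < e" using y norm_sgn_scale[OF V_nonzero[of i], of s] by auto
    then show "P y" using d(2)[of s i] e(2)[of i] s by simp
  qed (rule e(1))
qed

text \<open>
  The viscosity inequalities tested with \<open>quad_test\<close> only. For this finite-dimensional family, unlike for general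
  test functions, a change of sign is a change of parameters, so that subsolutions and sign-changed
  supersolutions are treated at once.
\<close>

definition quad_sub ::
  "real \<Rightarrow> ('n \<Rightarrow> 'a \<Rightarrow> real) \<Rightarrow> ('n \<Rightarrow> 'a \<Rightarrow> real \<Rightarrow> real) \<Rightarrow>
   (real \<Rightarrow> real ^ 'n \<Rightarrow> real) \<Rightarrow> ('n \<Rightarrow> real) \<Rightarrow> ('a \<Rightarrow> real) \<Rightarrow> bool" where
  "quad_sub lam a H F h u \<longleftrightarrow>
     (\<forall>x c p X. local_max_on (junction V) (\<lambda>y. u y - quad_test V c p X y) x \<longrightarrow>
        (\<forall>i. x \<in> edge (V i) \<longrightarrow> lam * u x - a i x * X i + H i x (p i + X i * norm x) \<le> 0) \<and>
        (x = 0 \<longrightarrow> (\<exists>i. lam * u 0 - a i 0 * X i + H i 0 (p i) \<le> 0) \<or> F (u 0) (\<chi> i. p i) \<le> 0) \<and>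
        (\<forall>i. x = V i \<longrightarrow> lam * u x - a i x * X i + H i x (p i + X i * norm x) \<le> 0 \<or> u x \<le> h i))"

lemma edge_derivs_quad_test:
  assumes "x \<in> closure (edge (V i))"
  shows "edge_dx (V i) (quad_test V c p X) x = p i + X i * norm x"
    and "edge_dxx (V i) (quad_test V c p X) x = X i"
proof -
  have "norm x \<in> {0..norm (V i)}"
  proof -
    obtain t where "0 \<le> t" "t \<le> norm (V i)" "x = t *\<^sub>R sgn (V i)"
      using assms closure_edge_arc_length[OF V_nonzero[of i], of x] by blast
    then show ?thesis using norm_sgn_scale[OF V_nonzero[of i], of t] by (simp only: atLeastAtMost_iff)
  qed
  then show "edge_dx (V i) (quad_test V c p X) x = p i + X i * norm x"
    and "edge_dxx (V i) (quad_test V c p X) x = X i"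
    unfolding edge_dx_def edge_dxx_def by (simp_all add: quad_test_dx quad_test_dxx)
qed

lemma junction_point_in_closure: "0 \<in> closure (edge (V i))" "V i \<in> closure (edge (V i))"
  unfolding closure_edge by (auto intro: exI[of _ 0] exI[of _ 1])

lemma visc_subsolution_quad_sub:
  assumes "visc_subsolution V lam a H F h u"
  shows "quad_sub lam a H F h u"
  unfolding quad_sub_def
proof (intro allI impI)
  fix x c p X assume m: "local_max_on (junction V) (\<lambda>y. u y - quad_test V c p X y) x"
  then have x: "x \<in> junction V" by (simp add: local_max_on_def)
  let ?\<phi> = "quad_test V c p X"
  have *: "(\<forall>i. x \<in> edge (V i) \<longrightarrow> G_op lam a H i (u x) (edge_dx (V i) ?\<phi> x) (edge_dxx (V i) ?\<phi> x) x \<le> 0)"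
    "x = 0 \<longrightarrow> min (Min (range (\<lambda>i. G_op lam a H i (u 0) (edge_dx (V i) ?\<phi> 0) (edge_dxx (V i) ?\<phi> 0) 0)))
               (F (u 0) (\<chi> i. edge_dx (V i) ?\<phi> 0)) \<le> 0"
    "\<forall>i. x = V i \<longrightarrow> min (G_op lam a H i (u x) (edge_dx (V i) ?\<phi> x) (edge_dxx (V i) ?\<phi> x) x) (u x - h i) \<le> 0"
    using assms m x quad_test_C2 unfolding visc_subsolution_def by blast+
  show "(\<forall>i. x \<in> edge (V i) \<longrightarrow> lam * u x - a i x * X i + H i x (p i + X i * norm x) \<le> 0) \<and>
        (x = 0 \<longrightarrow> (\<exists>i. lam * u 0 - a i 0 * X i + H i 0 (p i) \<le> 0) \<or> F (u 0) (\<chi> i. p i) \<le> 0) \<and>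
        (\<forall>i. x = V i \<longrightarrow> lam * u x - a i x * X i + H i x (p i + X i * norm x) \<le> 0 \<or> u x \<le> h i)"
  proof (intro conjI allI impI)
    fix i assume x: "x \<in> edge (V i)"
    then have "x \<in> closure (edge (V i))" using closure_subset by blast
    then show "lam * u x - a i x * X i + H i x (p i + X i * norm x) \<le> 0"
      using *(1)[rule_format, OF x] by (simp add: edge_derivs_quad_test G_op_def)
  next
    assume "x = 0"
    then show "(\<exists>i. lam * u 0 - a i 0 * X i + H i 0 (p i) \<le> 0) \<or> F (u 0) (\<chi> i. p i) \<le> 0"
      using *(2) by (simp add: min_le_iff_disj Min_le_iff edge_derivs_quad_test junction_point_in_closure G_op_def)
  next
    fix i assume "x = V i"
    then show "lam * u x - a i x * X i + H i x (p i + X i * norm x) \<le> 0 \<or> u x \<le> h i"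
      using *(3) by (simp add: min_le_iff_disj edge_derivs_quad_test junction_point_in_closure G_op_def)
  qed
qed

lemma visc_supersolution_quad_sub:
  assumes "visc_supersolution V lam a H F h v"
  shows "quad_sub lam a (\<lambda>i x p. - H i x (- p)) (\<lambda>r p. - F (- r) (- p)) (\<lambda>i. - h i) (\<lambda>x. - v x)"
  unfolding quad_sub_def
proof (intro allI impI)
  fix x c p X assume m: "local_max_on (junction V) (\<lambda>y. - v y - quad_test V c p X y) x"
  let ?\<phi> = "quad_test V (- c) (\<lambda>i. - p i) (\<lambda>i. - X i)"
  have "quad_test V c p X = (\<lambda>y. - ?\<phi> y)"
    by (rule ext) (simp add: quad_test_uminus)
  with m have "local_max_on (junction V) (\<lambda>y. - v y - - ?\<phi> y) x" by simp
  then have m': "local_min_on (junction V) (\<lambda>y. v y - ?\<phi> y) x"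
    unfolding local_max_on_def local_min_on_def by (auto elim!: eventually_mono)
  then have x: "x \<in> junction V" by (simp add: local_min_on_def)
  have *: "(\<forall>i. x \<in> edge (V i) \<longrightarrow> G_op lam a H i (v x) (edge_dx (V i) ?\<phi> x) (edge_dxx (V i) ?\<phi> x) x \<ge> 0)"
    "x = 0 \<longrightarrow> max (Max (range (\<lambda>i. G_op lam a H i (v 0) (edge_dx (V i) ?\<phi> 0) (edge_dxx (V i) ?\<phi> 0) 0)))
               (F (v 0) (\<chi> i. edge_dx (V i) ?\<phi> 0)) \<ge> 0"
    "\<forall>i. x = V i \<longrightarrow> max (G_op lam a H i (v x) (edge_dx (V i) ?\<phi> x) (edge_dxx (V i) ?\<phi> x) x) (v x - h i) \<ge> 0"
    using assms m' x quad_test_C2 unfolding visc_supersolution_def by blast+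
  have neg: "- (p i + X i * norm x) = - p i + - X i * norm x" for i by simp
  show "(\<forall>i. x \<in> edge (V i) \<longrightarrow> lam * - v x - a i x * X i + - H i x (- (p i + X i * norm x)) \<le> 0) \<and>
        (x = 0 \<longrightarrow> (\<exists>i. lam * - v 0 - a i 0 * X i + - H i 0 (- p i) \<le> 0) \<or> - F (- (- v 0)) (- (\<chi> i. p i)) \<le> 0) \<and>
        (\<forall>i. x = V i \<longrightarrow> lam * - v x - a i x * X i + - H i x (- (p i + X i * norm x)) \<le> 0 \<or> - v x \<le> - h i)"
    unfolding neg
  proof (intro conjI allI impI)
    fix i assume "x \<in> edge (V i)"
    then have "0 \<le> G_op lam a H i (v x) (edge_dx (V i) ?\<phi> x) (edge_dxx (V i) ?\<phi> x) x"
      and "x \<in> closure (edge (V i))"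
      using *(1) closure_subset[of "edge (V i)"] by auto
    then show "lam * - v x - a i x * X i + - H i x (- p i + - X i * norm x) \<le> 0"
      by (simp add: edge_derivs_quad_test G_op_def)
  next
    assume "x = 0"
    moreover have "(\<chi> i. - p i) = - (\<chi> i. p i)" by (simp add: vec_eq_iff)
    moreover have "lam * - v 0 - a i 0 * X i + - H i 0 (- p i) \<le> 0 \<longleftrightarrow>
        0 \<le> G_op lam a H i (v 0) (- p i) (- X i) 0" for i
      by (auto simp: G_op_def)
    ultimately show "(\<exists>i. lam * - v 0 - a i 0 * X i + - H i 0 (- p i) \<le> 0) \<or> - F (- (- v 0)) (- (\<chi> i. p i)) \<le> 0"
      using *(2) by (auto simp add: le_max_iff_disj Max_ge_iff edge_derivs_quad_test junction_point_in_closure)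
  next
    fix i assume "x = V i"
    then show "lam * - v x - a i x * X i + - H i x (- p i + - X i * norm x) \<le> 0 \<or> - v x \<le> - h i"
      using *(3) by (auto simp add: le_max_iff_disj edge_derivs_quad_test junction_point_in_closure G_op_def)
  qed
qed

lemma quad_sub_edge:
  assumes u: "quad_sub lam a H F h u"
    and \<sigma>: "\<And>t. 0 < t \<Longrightarrow> t < norm (V i) \<Longrightarrow> a i (t *\<^sub>R sgn (V i)) = (\<sigma> t)\<^sup>2"
  shows "visc_sub_on lam \<sigma> (\<lambda>t. H i (t *\<^sub>R sgn (V i))) (\<lambda>t. u (t *\<^sub>R sgn (V i))) {0<..<norm (V i)}"
  unfolding visc_sub_on_def
proof (intro ballI allI impI)
  fix t p X assume t: "t \<in> {0<..<norm (V i)}"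
    and ev: "\<forall>\<^sub>F s in at t. u (s *\<^sub>R sgn (V i)) \<le> u (t *\<^sub>R sgn (V i)) + p * (s - t) + X / 2 * (s - t)\<^sup>2"
  let ?\<phi> = "quad_test V 0 (\<lambda>_. p - X * t) (\<lambda>_. X)"
  let ?x = "t *\<^sub>R sgn (V i)"
  have "\<forall>\<^sub>F s in at t within {0..norm (V i)}. u (s *\<^sub>R sgn (V i)) - ?\<phi> (s *\<^sub>R sgn (V i)) \<le> u ?x - ?\<phi> ?x"
  proof -
    have "\<forall>\<^sub>F s in at t. s \<in> {0<..<norm (V i)}" using t by (intro eventually_at_in_open') auto
    with ev have "\<forall>\<^sub>F s in at t. u (s *\<^sub>R sgn (V i)) - ?\<phi> (s *\<^sub>R sgn (V i)) \<le> u ?x - ?\<phi> ?x"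
    proof eventually_elim
      case (elim s)
      have "p * (s - t) + X / 2 * (s - t)\<^sup>2 =
          ((p - X * t) * s + X / 2 * s\<^sup>2) - ((p - X * t) * t + X / 2 * t\<^sup>2)"
        by (simp add: power2_eq_square field_simps)
      then show ?case using elim t by (simp add: quad_test_edge)
    qed
    then show ?thesis by (rule filter_leD[OF at_le[OF subset_UNIV]])
  qed
  then have "\<forall>\<^sub>F y in at ?x within junction V. u y - ?\<phi> y \<le> u ?x - ?\<phi> ?x"
    using t by (intro eventually_junction_edge) auto
  moreover have "?x \<in> junction V" unfolding junction_arc_length using t by (intro exI[of _ i] exI[of _ t]) auto
  ultimately have "local_max_on (junction V) (\<lambda>y. u y - ?\<phi> y) ?x" by (simp add: local_max_on_def)
  moreover have "?x \<in> edge (V i)" unfolding edge_arc_length[OF V_nonzero] using t by auto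
  ultimately have "lam * u ?x - a i ?x * X + H i ?x (p - X * t + X * norm ?x) \<le> 0"
    using u unfolding quad_sub_def by blast
  then show "lam * u ?x - (\<sigma> t)\<^sup>2 * X + H i ?x p \<le> 0"
    using \<sigma>[of t] t norm_sgn_scale[OF V_nonzero[of i], of t] by simp
qed

lemma quad_sub_vertex:
  assumes u: "quad_sub lam a H F h u"
    and jet: "jet_above (\<lambda>z. u ((norm (V i) - z) *\<^sub>R sgn (V i))) q X"
  shows "lam * u (V i) - a i (V i) * X + H i (V i) (- q) \<le> 0 \<or> u (V i) \<le> h i"
proof -
  define l where "l = norm (V i)"
  have l: "l > 0" and Vi: "V i = l *\<^sub>R sgn (V i)"
    using norm_V_pos vertex_arc_length unfolding l_def by auto
  let ?\<phi> = "quad_test V 0 (\<lambda>_. - q - X * l) (\<lambda>_. X)"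
  obtain d where d: "d > 0" "\<And>z. 0 < z \<Longrightarrow> z < d \<Longrightarrow>
    u ((l - z) *\<^sub>R sgn (V i)) \<le> u (V i) + q * z + X / 2 * z\<^sup>2"
    using jet unfolding jet_above_def eventually_at_right_0 l_def[symmetric] by (auto simp flip: Vi)
  have "\<forall>\<^sub>F s in at l within {0..l}. u (s *\<^sub>R sgn (V i)) - ?\<phi> (s *\<^sub>R sgn (V i)) \<le> u (V i) - ?\<phi> (V i)"
    unfolding eventually_at dist_real_def
  proof (intro exI[of _ d] conjI ballI impI)
    fix s assume s: "s \<in> {0..l}" "s \<noteq> l \<and> \<bar>s - l\<bar> < d"
    have e: "q * (l - s) + X / 2 * (l - s)\<^sup>2 =
          ((- q - X * l) * s + X / 2 * s\<^sup>2) - ((- q - X * l) * l + X / 2 * l\<^sup>2)"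
      by (simp add: power2_eq_square field_simps)
    have "?\<phi> (V i) = (- q - X * l) * l + X / 2 * l\<^sup>2"
      using quad_test_edge[of l 0 "\<lambda>_. - q - X * l" "\<lambda>_. X" i] l by (simp flip: Vi)
    moreover have "?\<phi> (s *\<^sub>R sgn (V i)) = (- q - X * l) * s + X / 2 * s\<^sup>2"
      using quad_test_edge[of s 0 "\<lambda>_. - q - X * l" "\<lambda>_. X" i] s by simp
    ultimately show "u (s *\<^sub>R sgn (V i)) - ?\<phi> (s *\<^sub>R sgn (V i)) \<le> u (V i) - ?\<phi> (V i)"
      using d(2)[of "l - s"] s e by auto
  qed (rule d(1))
  then have "\<forall>\<^sub>F y in at (l *\<^sub>R sgn (V i)) within junction V. u y - ?\<phi> y \<le> u (V i) - ?\<phi> (V i)"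
    using l by (intro eventually_junction_edge) (auto simp: l_def)
  moreover have "V i \<in> junction V"
    unfolding junction_def using junction_point_in_closure by blast
  ultimately have "local_max_on (junction V) (\<lambda>y. u y - ?\<phi> y) (V i)"
    by (simp add: local_max_on_def flip: Vi)
  then have "lam * u (V i) - a i (V i) * X + H i (V i) (- q - X * l + X * norm (V i)) \<le> 0 \<or> u (V i) \<le> h i"
    using u unfolding quad_sub_def by blast
  then show ?thesis by (simp add: l_def)
qed

lemma quad_sub_origin:
  assumes u: "quad_sub lam a H F h u"
    and jet: "\<And>i. jet_above (\<lambda>t. u (t *\<^sub>R sgn (V i))) (p i) (X i)"
  shows "(\<exists>i. lam * u 0 - a i 0 * X i + H i 0 (p i) \<le> 0) \<or> F (u 0) (\<chi> i. p i) \<le> 0"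
proof -
  let ?\<phi> = "quad_test V 0 p X"
  have "\<forall>\<^sub>F s in at_right 0. u (s *\<^sub>R sgn (V i)) - ?\<phi> (s *\<^sub>R sgn (V i)) \<le> u 0 - ?\<phi> 0" for i
  proof -
    have "\<forall>\<^sub>F s in at_right (0::real). 0 < s" by (simp add: eventually_at_filter)
    with jet[of i, unfolded jet_above_def] show ?thesis
      by eventually_elim (simp add: quad_test_edge quad_test_0)
  qed
  then have "\<forall>\<^sub>F y in at 0 within junction V. u y - ?\<phi> y \<le> u 0 - ?\<phi> 0"
    by (rule eventually_junction_0)
  moreover have "0 \<in> junction V"
    unfolding junction_def using junction_point_in_closure by blast
  ultimately have "local_max_on (junction V) (\<lambda>y. u y - ?\<phi> y) 0" by (simp add: local_max_on_def)
  then show ?thesis using u unfolding quad_sub_def by blast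
qed

text \<open>
  The limit superior at a vertex in terms of arc length; it may be \<open>- \<infinity>\<close>, but not \<open>\<infinity>\<close>.
\<close>

lemma vertex_Limsup:
  assumes "usc_on {0..norm (V i)} (\<lambda>t. u (t *\<^sub>R sgn (V i)))"
  defines "L \<equiv> Limsup (at (V i) within edge (V i)) (\<lambda>y. ereal (u y))"
  shows "L \<le> ereal (u (V i))"
    and "\<And>c. L < ereal c \<Longrightarrow> \<exists>d>0. \<forall>s. 0 < s \<and> s < norm (V i) \<and> norm (V i) - s < d \<longrightarrow> u (s *\<^sub>R sgn (V i)) < c"
    and "\<And>c d. ereal c < L \<Longrightarrow> d > 0 \<Longrightarrow> \<exists>s. 0 < s \<and> s < norm (V i) \<and> norm (V i) - s < d \<and> c < u (s *\<^sub>R sgn (V i))"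
proof -
  define l where "l = norm (V i)"
  have l: "l > 0" and Vi: "V i = l *\<^sub>R sgn (V i)"
    using norm_V_pos vertex_arc_length unfolding l_def by auto
  have dist: "dist (s *\<^sub>R sgn (V i)) (V i) = \<bar>s - l\<bar>" for s
    using dist_sgn_scale[OF V_nonzero[of i], of s l] Vi by simp
  have ev: "eventually P (at (V i) within edge (V i)) \<longleftrightarrow>
    (\<exists>d>0. \<forall>s. 0 < s \<and> s < l \<and> l - s < d \<longrightarrow> P (s *\<^sub>R sgn (V i)))" for P
    unfolding eventually_at
  proof (intro iff_exI conj_cong refl iffI allI impI ballI)
    fix d s assume a: "\<forall>x\<in>edge (V i). x \<noteq> V i \<and> dist x (V i) < d \<longrightarrow> P x" and s: "0 < s \<and> s < l \<and> l - s < d"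
    have "s *\<^sub>R sgn (V i) \<in> edge (V i)" using s edge_arc_length[OF V_nonzero] by (auto simp: l_def)
    moreover have "dist (s *\<^sub>R sgn (V i)) (V i) < d" "dist (s *\<^sub>R sgn (V i)) (V i) \<noteq> 0"
      unfolding dist using s by auto
    ultimately show "P (s *\<^sub>R sgn (V i))" using a by auto
  next
    fix d x assume a: "\<forall>s. 0 < s \<and> s < l \<and> l - s < d \<longrightarrow> P (s *\<^sub>R sgn (V i))"
      and x: "x \<in> edge (V i)" "x \<noteq> V i \<and> dist x (V i) < d"
    obtain s where s: "0 < s" "s < l" "x = s *\<^sub>R sgn (V i)"
      using x(1) edge_arc_length[OF V_nonzero] by (auto simp: l_def)
    then show "P x" using a x(2) dist[of s] by auto
  qed
  show "L \<le> ereal (u (V i))"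
    unfolding L_def
  proof (rule Limsup_le_iff[THEN iffD2], intro allI impI)
    fix y assume y: "ereal (u (V i)) < y"
    then obtain c where c: "u (V i) < c" "ereal c \<le> y"
      by (metis ereal_dense2 ereal_less_eq(3) less_ereal.simps(1) less_imp_le)
    have "u (l *\<^sub>R sgn (V i)) < c" using c Vi by simp
    then obtain d where d: "d > 0" "\<And>s. s \<in> {0..l} \<Longrightarrow> \<bar>s - l\<bar> < d \<Longrightarrow> u (s *\<^sub>R sgn (V i)) < c"
      using assms(1)[folded l_def, unfolded usc_on_iff, rule_format, of l c] l by auto
    have "u (s *\<^sub>R sgn (V i)) < c" if "0 < s" "s < l" "l - s < d" for s
      using d(2)[of s] that by simp
    then have "\<forall>\<^sub>F x in at (V i) within edge (V i). u x < c" unfolding ev using d(1) by blast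
    then show "\<forall>\<^sub>F x in at (V i) within edge (V i). ereal (u x) < y"
      by eventually_elim (use c in \<open>metis ereal_less_eq(3) less_ereal.simps(1) less_le_trans\<close>)
  qed
  show "\<exists>d>0. \<forall>s. 0 < s \<and> s < norm (V i) \<and> norm (V i) - s < d \<longrightarrow> u (s *\<^sub>R sgn (V i)) < c"
    if "L < ereal c" for c
    using Limsup_lessD[OF that[unfolded L_def]] unfolding ev l_def by simp
  show "\<exists>s. 0 < s \<and> s < norm (V i) \<and> norm (V i) - s < d \<and> c < u (s *\<^sub>R sgn (V i))"
    if c: "ereal c < L" "d > 0" for c d
  proof (rule ccontr)
    assume n: "\<not> ?thesis"
    then have "\<forall>\<^sub>F x in at (V i) within edge (V i). u x \<le> c"
      unfolding ev l_def using c(2) by (meson not_less)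
    then have "L \<le> ereal c" unfolding L_def
      by (intro Limsup_bounded) (auto elim: eventually_mono)
    then show False using c(1) by simp
  qed
qed

end

section \<open>The comparison theorem\<close>

theorem theorem4p1:
  fixes V :: "'n::finite \<Rightarrow> 'a::euclidean_space"
    and lam C_H C_a :: real
    and h :: "'n \<Rightarrow> real"
    and a :: "'n \<Rightarrow> 'a \<Rightarrow> real"
    and H :: "'n \<Rightarrow> 'a \<Rightarrow> real \<Rightarrow> real"
    and F :: "real \<Rightarrow> real ^ 'n \<Rightarrow> real"
    and u v :: "'a \<Rightarrow> real"
  assumes dim: "DIM('a) \<ge> 2"
    and junction: "junction_vertices V"
    and constants: "C_H > 0" "C_a > 0"
    and lam_pos: "lam > 0"
    and H_cont: "\<And>i. continuous_on (closure (edge (V i)) \<times> UNIV) (\<lambda>(x, p). H i x p)"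
    and H_x: "\<And>i x y p. \<lbrakk>x \<in> closure (edge (V i)); y \<in> closure (edge (V i))\<rbrakk> \<Longrightarrow>
                \<bar>H i x p - H i y p\<bar> \<le> C_H * (1 + \<bar>p\<bar>) * norm (x - y)"
    and H_p: "\<And>i x p q. x \<in> closure (edge (V i)) \<Longrightarrow>
                \<bar>H i x p - H i x q\<bar> \<le> C_H * \<bar>p - q\<bar>"
    and a_form: "\<And>i. \<exists>\<sigma> :: 'a \<Rightarrow> real.
                (\<forall>x\<in>closure (edge (V i)). a i x = (\<sigma> x)\<^sup>2) \<and>
                (\<forall>x\<in>closure (edge (V i)). \<forall>y\<in>closure (edge (V i)).
                   \<bar>\<sigma> x - \<sigma> y\<bar> \<le> C_a * norm (x - y))"
    and H_coercive: "\<And>i x p. \<lbrakk>a i 0 = 0; x \<in> closure (edge (V i))\<rbrakk> \<Longrightarrow>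
                H i x p \<ge> inverse C_H * \<bar>p\<bar> - C_H"
    and F_cont: "continuous_on UNIV (\<lambda>(r, p). F r p)"
    and F_mono: "\<And>r s p q. \<lbrakk>r \<ge> s; \<forall>i. p $ i \<le> q $ i\<rbrakk> \<Longrightarrow> F r p \<ge> F s q"
    and F_strict: "\<And>r s p q. \<lbrakk>r \<ge> s; \<forall>i. p $ i \<le> q $ i; \<exists>j. p $ j < q $ j\<rbrakk> \<Longrightarrow> F r p > F s q"
    and F_lim: "\<And>i r p. filterlim (\<lambda>t. F r (\<chi> j. if j = i then t else p $ j)) at_top at_bot"
    and vertex: "\<And>i. a i (V i) > 0 \<or>
                (\<exists>U. openin (top_of_set (closure (edge (V i)))) U \<and> V i \<in> U \<and>
                   (\<forall>x\<in>U. \<forall>p. H i x p \<ge> inverse C_H * \<bar>p\<bar> - C_H))"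
    and sub: "visc_subsolution V lam a H F h u"
    and super: "visc_supersolution V lam a H F h v"
  shows "(\<forall>x\<in>junction V. vertex_limsup V u x \<le> ereal (v x)) \<and>
         (\<forall>x\<in>junction V - range V. u x \<le> v x)"
proof -
  define l where "l i = norm (V i)" for i
  define e where "e i = sgn (V i)" for i
  have l: "l i > 0" for i using norm_V_pos[OF junction] by (simp add: l_def)
  have Ve: "V i = l i *\<^sub>R e i" for i unfolding l_def e_def by (rule vertex_arc_length)
  have on_edge: "t *\<^sub>R e i \<in> closure (edge (V i))" if "t \<in> {0..l i}" for t i
    using that closure_edge_arc_length[OF V_nonzero[OF junction]] unfolding l_def e_def by auto
  have dist_e: "norm (s *\<^sub>R e i - t *\<^sub>R e i) = \<bar>s - t\<bar>" for s t i
    using dist_sgn_scale[OF V_nonzero[OF junction, of i], of s t] by (simp add: e_def dist_norm)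
  obtain \<sigma>0 where \<sigma>0: "\<And>i x. x \<in> closure (edge (V i)) \<Longrightarrow> a i x = (\<sigma>0 i x)\<^sup>2"
    "\<And>i x y. x \<in> closure (edge (V i)) \<Longrightarrow> y \<in> closure (edge (V i)) \<Longrightarrow>
       \<bar>\<sigma>0 i x - \<sigma>0 i y\<bar> \<le> C_a * norm (x - y)"
    using a_form by metis
  define \<sigma> where "\<sigma> i t = \<sigma>0 i (t *\<^sub>R e i)" for i t
  define hh where "hh i t = H i (t *\<^sub>R e i)" for i t
  define U where "U i t = u (t *\<^sub>R e i)" for i t
  define W where "W i t = v (t *\<^sub>R e i)" for i t
  define C where "C = C_H + C_a"
  have C: "C > 0" "C_H \<le> C" "C_a \<le> C" using constants by (auto simp: C_def)
  have a_\<sigma>: "a i (t *\<^sub>R e i) = (\<sigma> i t)\<^sup>2" if "t \<in> {0..l i}" for i t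
    using \<sigma>0(1)[OF on_edge[OF that]] by (simp add: \<sigma>_def)
  have coeffs: "lipschitz_coeffs C (\<sigma> i) (hh i) {0..l i}" for i
    unfolding lipschitz_coeffs_def
  proof (intro conjI ballI allI)
    fix x y p q assume x: "x \<in> {0..l i}"
    have "\<bar>hh i x p - hh i x q\<bar> \<le> C_H * \<bar>p - q\<bar>" using H_p[OF on_edge[OF x]] by (simp add: hh_def)
    also have "\<dots> \<le> C * \<bar>p - q\<bar>" using C by (intro mult_right_mono) auto
    finally show "\<bar>hh i x p - hh i x q\<bar> \<le> C * \<bar>p - q\<bar>" .
    assume y: "y \<in> {0..l i}"
    have "\<bar>\<sigma> i x - \<sigma> i y\<bar> \<le> C_a * \<bar>x - y\<bar>"
      using \<sigma>0(2)[OF on_edge[OF x] on_edge[OF y]] by (simp add: \<sigma>_def dist_e)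
    also have "\<dots> \<le> C * \<bar>x - y\<bar>" using C by (intro mult_right_mono) auto
    finally show "\<bar>\<sigma> i x - \<sigma> i y\<bar> \<le> C * \<bar>x - y\<bar>" .
    have "\<bar>hh i x p - hh i y p\<bar> \<le> C_H * (1 + \<bar>p\<bar>) * \<bar>x - y\<bar>"
      using H_x[OF on_edge[OF x] on_edge[OF y], of p] by (simp add: hh_def dist_e)
    also have "\<dots> \<le> C * (1 + \<bar>p\<bar>) * \<bar>x - y\<bar>" using C by (intro mult_right_mono) auto
    finally show "\<bar>hh i x p - hh i y p\<bar> \<le> C * (1 + \<bar>p\<bar>) * \<bar>x - y\<bar>" .
  qed (rule C)
  have coeffs': "lipschitz_coeffs C (\<sigma> i) (mirror (hh i)) {0..l i}" for i
  proof -
    have "\<bar>- hh i x (- p) - - hh i x (- q)\<bar> \<le> C * \<bar>p - q\<bar>" if "x \<in> {0..l i}" for x p q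
    proof -
      have "\<bar>hh i x (- p) - hh i x (- q)\<bar> \<le> C * \<bar>- p - - q\<bar>"
        using coeffs[of i] that unfolding lipschitz_coeffs_def by blast
      then show ?thesis by (simp add: abs_minus_commute)
    qed
    moreover have "\<bar>- hh i x (- p) - - hh i y (- p)\<bar> \<le> C * (1 + \<bar>p\<bar>) * \<bar>x - y\<bar>"
      if "x \<in> {0..l i}" "y \<in> {0..l i}" for x y p
    proof -
      have "\<bar>hh i x (- p) - hh i y (- p)\<bar> \<le> C * (1 + \<bar>- p\<bar>) * \<bar>x - y\<bar>"
        using coeffs[of i] that unfolding lipschitz_coeffs_def by blast
      then show ?thesis by (simp add: abs_minus_commute)
    qed
    ultimately show ?thesis using coeffs[of i] unfolding lipschitz_coeffs_def by blast
  qed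
  have qu: "quad_sub V lam a H F h u" by (rule visc_subsolution_quad_sub[OF junction sub])
  have qv: "quad_sub V lam a (\<lambda>i x p. - H i x (- p)) (\<lambda>r p. - F (- r) (- p)) (\<lambda>i. - h i) (\<lambda>x. - v x)"
    by (rule visc_supersolution_quad_sub[OF junction super])
  have uscU: "usc_on {0..l i} (U i)" for i
    using sub unfolding visc_subsolution_def USC_junction_def edge_fun_def[abs_def] U_def[abs_def] l_def e_def by simp
  have uscW: "usc_on {0..l i} (\<lambda>t. - W i t)" for i
    using super unfolding visc_supersolution_def LSC_junction_def edge_fun_def[abs_def] W_def[abs_def] l_def e_def lsc_on_iff_usc by simp
  have subU: "visc_sub_on lam (\<sigma> i) (hh i) (U i) {0<..<l i}" for i
    using quad_sub_edge[OF junction qu, of i "\<sigma> i"] a_\<sigma>[of _ i]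
    unfolding U_def[abs_def] hh_def[abs_def] l_def e_def by simp
  have subW: "visc_sub_on lam (\<sigma> i) (mirror (hh i)) (\<lambda>t. - W i t) {0<..<l i}" for i
    using quad_sub_edge[OF junction qv, of i "\<sigma> i"] a_\<sigma>[of _ i]
    unfolding W_def[abs_def] hh_def[abs_def] l_def e_def by simp
  have hjU: "hj_sub lam C (\<sigma> i) (hh i) (l i) (U i)" for i
    using lam_pos l coeffs uscU subU by unfold_locales
  have hjW: "hj_sub lam C (\<sigma> i) (mirror (hh i)) (l i) (\<lambda>t. - W i t)" for i
    using lam_pos l coeffs' uscW subW by unfold_locales
  define L where "L i = Limsup (at (V i) within edge (V i)) (\<lambda>y. ereal (u y))" for i
  note limsup = vertex_Limsup[OF junction, of _ u, folded l_def e_def, folded U_def L_def]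
  have L1: "L i \<le> ereal (U i (l i))" for i
    using limsup(1)[of i] uscU[of i] Ve[of i] by (simp add: U_def[abs_def])
  have L2: "\<exists>d>0. \<forall>s. 0 < s \<and> s < l i \<and> l i - s < d \<longrightarrow> U i s < c" if "L i < ereal c" for i c
    using limsup(2)[OF _ that] uscU[of i] by (simp add: U_def[abs_def])
  have L3: "\<exists>s. 0 < s \<and> s < l i \<and> l i - s < d \<and> c < U i s" if "ereal c < L i" "d > 0" for i c d
    using limsup(3)[OF _ that] uscU[of i] by (simp add: U_def[abs_def])
  \<comment> \<open>A limit superior below \<open>v - 1\<close>, possibly \<open>- \<infinity>\<close>, is raised to the real number \<open>v - 1\<close>. This keeps
    semicontinuity at the vertex and cannot create a positive value of \<open>G - W\<close>.\<close>
  define R where "R i = real_of_ereal (max (L i) (ereal (W i (l i) - 1)))" for i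
  have R: "ereal (R i) = max (L i) (ereal (W i (l i) - 1))" for i
    using L1[of i] unfolding R_def by (cases "L i") (auto simp: max_def)
  have LR: "L i \<le> ereal (R i)" for i unfolding R by simp
  define G where "G i t = (if t = l i then R i else U i t)" for i t
  have uscG: "usc_on {0..l i} (G i)" for i
    unfolding usc_on_iff
  proof (intro ballI allI impI)
    fix t c assume t: "t \<in> {0..l i}" "G i t < c"
    show "\<exists>d>0. \<forall>s\<in>{0..l i}. \<bar>s - t\<bar> < d \<longrightarrow> G i s < c"
    proof (cases "t = l i")
      case True
      then have R_c: "R i < c" using t by (simp add: G_def)
      then have "L i < ereal c" using LR[of i] by (metis le_less_trans less_ereal.simps(1))
      from L2[OF this] obtain d where d: "d > 0" "\<And>s. 0 < s \<Longrightarrow> s < l i \<Longrightarrow> l i - s < d \<Longrightarrow> U i s < c" by blast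
      have "G i s < c" if "s \<in> {0..l i}" "\<bar>s - t\<bar> < min d (l i)" for s
        using d(2)[of s] that True R_c by (cases "s = l i") (auto simp: G_def)
      then show ?thesis using d(1) l[of i] by (intro exI[of _ "min d (l i)"]) auto
    next
      case False
      then have tl: "t < l i" "U i t < c" using t by (auto simp: G_def)
      obtain d where d: "d > 0" "\<And>s. s \<in> {0..l i} \<Longrightarrow> \<bar>s - t\<bar> < d \<Longrightarrow> U i s < c"
        using uscU[of i, unfolded usc_on_iff, rule_format, OF t(1) tl(2)] by blast
      have "G i s < c" if "s \<in> {0..l i}" "\<bar>s - t\<bar> < min d (l i - t)" for s
        using d(2)[of s] that by (auto simp: G_def)
      then show ?thesis using d(1) tl by (intro exI[of _ "min d (l i - t)"]) auto
    qed
  qed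
  have subG: "visc_sub_on lam (\<sigma> i) (hh i) (G i) {0<..<l i}" for i
    unfolding visc_sub_on_def
  proof (intro ballI allI impI)
    fix x p X assume x: "x \<in> {0<..<l i}"
      and ev: "\<forall>\<^sub>F y in at x. G i y \<le> G i x + p * (y - x) + X / 2 * (y - x)\<^sup>2"
    have "\<forall>\<^sub>F y in at x. y \<in> {0<..<l i}" using x by (intro eventually_at_in_open') auto
    with ev have "\<forall>\<^sub>F y in at x. U i y \<le> U i x + p * (y - x) + X / 2 * (y - x)\<^sup>2"
      by eventually_elim (use x in \<open>auto simp: G_def\<close>)
    then show "lam * G i x - (\<sigma> i x)\<^sup>2 * X + hh i x p \<le> 0"
      using subU[of i] x unfolding visc_sub_on_def by (auto simp: G_def)
  qed
  have hjG: "hj_sub lam C (\<sigma> i) (hh i) (l i) (G i)" for i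
    using lam_pos l coeffs uscG subG by unfold_locales
  have coer0: "steep_or_elliptic (\<sigma> i) (hh i)" for i
  proof (cases "\<sigma> i 0 = 0")
    case True
    then have a0: "a i 0 = 0" using a_\<sigma>[of 0 i] l[of i] by simp
    have "\<And>x p. 0 \<le> x \<Longrightarrow> x \<le> l i \<Longrightarrow> inverse C_H * \<bar>p\<bar> - C_H \<le> hh i x p"
      using H_coercive[OF a0 on_edge] by (simp add: hh_def)
    then show ?thesis unfolding steep_or_elliptic_def using l[of i] constants
      by (intro disjI2 exI[of _ "l i"] conjI exI[of _ "inverse C_H"] exI[of _ C_H]) auto
  qed (simp add: steep_or_elliptic_def)
  have coer1: "steep_or_elliptic (\<lambda>z. \<sigma> i (l i - z)) (\<lambda>z p. hh i (l i - z) (- p))" for i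
  proof (cases "\<sigma> i (l i) = 0")
    case True
    then have "\<not> a i (V i) > 0" using a_\<sigma>[of "l i" i] l[of i] Ve[of i] by simp
    then obtain N where N: "openin (top_of_set (closure (edge (V i)))) N" "V i \<in> N"
      "\<And>x p. x \<in> N \<Longrightarrow> H i x p \<ge> inverse C_H * \<bar>p\<bar> - C_H" using vertex[of i] by blast
    obtain d where d: "d > 0" "\<And>x. x \<in> closure (edge (V i)) \<Longrightarrow> dist x (V i) < d \<Longrightarrow> x \<in> N"
      using N(1,2) unfolding openin_euclidean_subtopology_iff by blast
    have "inverse C_H * \<bar>p\<bar> - C_H \<le> hh i (l i - z) (- p)" if z: "0 \<le> z" "z \<le> min (d / 2) (l i)" for z p
    proof -
      have "(l i - z) *\<^sub>R e i \<in> closure (edge (V i))" using z by (intro on_edge) auto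
      moreover have "dist ((l i - z) *\<^sub>R e i) (V i) < d"
        using dist_e[of "l i - z" i "l i"] z d(1) Ve[of i] by (simp add: dist_norm)
      ultimately show ?thesis using N(3)[OF d(2), of _ "- p"] by (simp add: hh_def)
    qed
    then show ?thesis unfolding steep_or_elliptic_def using l[of i] d(1) constants
      by (intro disjI2 exI[of _ "min (d / 2) (l i)"] conjI exI[of _ "inverse C_H"] exI[of _ C_H]) auto
  qed (simp add: steep_or_elliptic_def)
  have "\<exists>t\<in>{0..l i}. \<forall>s\<in>{0..l i}. G i s + - W i s \<le> G i t + - W i t" for i
    by (rule usc_on_attains_max[OF usc_on_add[OF uscG uscW]]) (use l[of i] in simp)
  then obtain T where T: "\<And>i. T i \<in> {0..l i}"
    "\<And>i s. s \<in> {0..l i} \<Longrightarrow> G i s - W i s \<le> G i (T i) - W i (T i)"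
    by (metis diff_conv_add_uminus)
  obtain k where k: "\<And>i. G i (T i) - W i (T i) \<le> G k (T k) - W k (T k)"
  proof -
    let ?M = "\<lambda>i. G i (T i) - W i (T i)"
    have "Max (range ?M) \<in> range ?M" by (intro Max_in) auto
    then obtain k where "Max (range ?M) = ?M k" by blast
    moreover have "?M i \<le> Max (range ?M)" for i by (intro Max_ge) auto
    ultimately show ?thesis using that by metis
  qed
  have "G k (T k) \<le> W k (T k)"
  proof (rule ccontr)
    assume "\<not> ?thesis"
    then have pos: "W k (T k) < G k (T k)" by simp
    \<comment> \<open>junction point, interior of an edge, vertex\<close>
    consider "T k = 0" | "0 < T k" "T k < l k" | "T k = l k" using T(1)[of k] by force
    then show False
    proof cases
      case 1
      have z: "G i 0 = u 0" "W i 0 = v 0" for i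
        using l[of i] by (auto simp: G_def U_def W_def)
      have pair: "hj_pair lam C (\<sigma> i) (hh i) (l i) (G i) (W i)" for i
        unfolding hj_pair_def hj_sub_super_def hj_pair_axioms_def
        using hjG hjW T(2)[of _ i] k[of i] pos 1 z by (auto intro: order.trans)
      have jetU: "jet_above (U i) p X" if "jet_above (G i) p X" for i p X
      proof -
        have "\<forall>\<^sub>F s in at_right 0. s < l i" using l[of i] by (auto simp: eventually_at_right_0)
        with that[unfolded jet_above_def] show ?thesis unfolding jet_above_def
          by eventually_elim (use l[of i] in \<open>auto simp: G_def\<close>)
      qed
      have a0: "a i 0 = (\<sigma> i 0)\<^sup>2" for i using a_\<sigma>[of 0 i] l[of i] by simp
      show False
      proof (rule junction_point_contradiction[OF pair z coer0 _ _ F_strict F_lim])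
        fix p X assume "\<And>i. jet_above (G i) (p i) (X i)"
        then have "\<And>i. jet_above (\<lambda>t. u (t *\<^sub>R sgn (V i))) (p i) (X i)"
          using jetU unfolding U_def[abs_def] e_def by blast
        from quad_sub_origin[OF junction qu this]
        show "(\<exists>i. lam * u 0 - (\<sigma> i 0)\<^sup>2 * X i + hh i 0 (p i) \<le> 0) \<or> F (u 0) (\<chi> i. p i) \<le> 0"
          by (simp add: a0 hh_def)
      next
        fix p X assume "\<And>i. jet_above (\<lambda>x. - W i x) (- p i) (- X i)"
        then have "\<And>i. jet_above (\<lambda>t. - v (t *\<^sub>R sgn (V i))) (- p i) (- X i)"
          unfolding W_def[abs_def] e_def by blast
        from quad_sub_origin[OF junction qv this]
        have "(\<exists>i. lam * - v 0 - a i 0 * - X i + - H i 0 (- (- p i)) \<le> 0) \<or> - F (- (- v 0)) (- (\<chi> i. - p i)) \<le> 0" .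
        moreover have "- (\<chi> i. - p i) = (\<chi> i. p i)" by (simp add: vec_eq_iff)
        ultimately show "(\<exists>i. 0 \<le> lam * v 0 - (\<sigma> i 0)\<^sup>2 * X i + hh i 0 (p i)) \<or> 0 \<le> F (v 0) (\<chi> i. p i)"
          by (auto simp: a0 hh_def algebra_simps)
      qed
    next
      case 2
      have "hj_sub_super lam C (\<sigma> k) (hh k) (l k) (G k) (W k)"
        unfolding hj_sub_super_def using hjG hjW by blast
      from hj_sub_super.no_positive_interior_max[OF this 2] T(2)[of _ k] pos show False by force
    next
      case 3
      have RL: "ereal (R k) = L k"
        using pos 3 R[of k] by (auto simp: G_def max_def split: if_splits)
      have VU: "U k (l k) = u (V k)" "W k (l k) = v (V k)" using Ve[of k] by (auto simp: U_def W_def)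
      have ak: "a k (V k) = (\<sigma> k (l k))\<^sup>2" "hh k (l k) = H k (V k)"
        using a_\<sigma>[of "l k" k] l[of k] Ve[of k] by (auto simp: hh_def)
      have uh: "u (V k) \<le> h k"
      proof -
        obtain s X where s: "jet_above (\<lambda>z. U k (l k - z)) s X"
          "0 < lam * u (V k) - (\<sigma> k (l k))\<^sup>2 * X + hh k (l k) (- s)"
          using hj_sub.jet_above_strict[OF hj_sub_reflect[OF hjU] coer1, of k] VU by auto
        have "jet_above (\<lambda>z. u ((norm (V k) - z) *\<^sub>R sgn (V k))) s X"
          using s(1) unfolding U_def l_def e_def .
        from quad_sub_vertex[OF junction qu this] s(2) show ?thesis by (simp add: ak)
      qed
      have "R k \<le> u (V k)" using L1[of k] RL VU by (metis ereal_less_eq(3))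
      then have vh: "v (V k) < h k" using uh pos 3 VU by (simp add: G_def)
      have refl: "hj_pair lam C (\<lambda>z. \<sigma> k (l k - z)) (\<lambda>z p. hh k (l k - z) (- p)) (l k)
          (\<lambda>z. G k (l k - z)) (\<lambda>z. W k (l k - z))"
        unfolding hj_pair_def hj_sub_super_def hj_pair_axioms_def
        using hj_sub_reflect[OF hjG, of k] hj_sub_reflect[OF hjW, of k] T(2)[of _ k] pos 3 by auto
      have "\<exists>z. 0 < z \<and> z < \<delta> \<and> G k (l k - 0) - \<epsilon> < G k (l k - z)" if "\<epsilon> > 0" "\<delta> > 0" for \<epsilon> \<delta>
      proof -
        have "ereal (R k - \<epsilon>) < L k" using that RL by (metis ereal_less_eq(3) diff_less_eq less_add_same_cancel1 less_ereal.simps(1))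
        from L3[OF this that(2)] obtain s where "0 < s" "s < l k" "l k - s < \<delta>" "R k - \<epsilon> < U k s" by blast
        then show ?thesis by (intro exI[of _ "l k - s"]) (auto simp: G_def)
      qed
      from hj_pair.vertex_gap[OF refl coer1 this] obtain t Y where
        tY: "jet_above (\<lambda>z. - W k (l k - z)) (- t) (- Y)"
        "lam * v (V k) - (\<sigma> k (l k))\<^sup>2 * Y + hh k (l k) (- t) < 0"
        using VU by auto
      have "jet_above (\<lambda>z. - v ((norm (V k) - z) *\<^sub>R sgn (V k))) (- t) (- Y)"
        using tY(1) unfolding W_def l_def e_def .
      from quad_sub_vertex[OF junction qv this] tY(2) vh show False by (simp add: ak algebra_simps)
    qed
  qed
  then have le: "G i s \<le> W i s" if "s \<in> {0..l i}" for i s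
    using T(2)[OF that] k[of i] by linarith
  have inner: "u x \<le> v x" if x: "x \<in> junction V - range V" for x
  proof -
    obtain i t where t: "t \<in> {0..l i}" "x = t *\<^sub>R e i"
      using x junction_arc_length[OF junction] unfolding l_def e_def by force
    then have "t \<noteq> l i" using x Ve[of i] by (metis DiffD2 rangeI)
    then show ?thesis using le[OF t(1)] t by (simp add: G_def U_def W_def)
  qed
  moreover have "vertex_limsup V u (V i) \<le> ereal (v (V i))" for i
  proof -
    have "L i \<le> ereal (R i)" by (rule LR)
    also have "R i \<le> v (V i)" using le[of "l i" i] l[of i] Ve[of i] by (simp add: G_def W_def)
    finally show ?thesis by (simp add: vertex_limsup_def L_def)
  qed
  ultimately show ?thesis by (auto simp: vertex_limsup_def)
qed

end
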